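(* Let $n \in \mathbb{N}$ and $p$ a prime. Define $N := \{ (0,\upsilon,z) \in \mathbb{H}_n(\mathbb{F}_p(\!(t)\!)): \upsilon \in \mathbb{F}_p(\!(t)\!)^n, z \in \mathbb{F}_p(\!(t)\!)\}$ and $A := \{ (\xi,0,0) \in \mathbb{H}_n(\mathbb{F}_p(\!(t)\!)): \xi \in \mathbb{F}_p(\!(t)\!)^n\}$. The following hold: (i) The action $A \curvearrowright \widehat{N}$ has closed orbits; (ii) $N$ is regularly embedded in $\mathbb{H}_n(\mathbb{F}_p(\!(t)\!))$; (iii) $\mathbb{H}_n(\mathbb{F}_p(\!(t)\!))$ is CCR.
   Context: $\mathbb{N}=\{1,2,\dots\}$. $\mathbb{F}_p(\!(t)\!)$ is the field of formal Laurent series with its usual locally compact topology. $\mathbb{H}_n(\mathbb{F}_p(\!(t)\!))$ is the $(2n+1)$-dimensional Heisenberg group: the set $\mathbb{F}_p(\!(t)\!)^n\times\mathbb{F}_p(\!(t)\!)^n\times\mathbb{F}_p(\!(t)\!)$ with the product topology and multiplication $(\xi,\upsilon,z)(\zeta,\mu,w)=(\xi+\zeta,\upsilon+\mu,z+w+\xi\cdot\mu)$, where $\xi\cdot\mu$ is the dot product. It is the semidirect product of the normal abelian subgroup $N$ and $A$. For a normal subgroup $N$ of $G$, an element $g\in G$ acts on $\widehat{N}$ (unitary equivalence classes of irreducible unitary representations with the Fell topology; here the Pontryagin dual) by $(g\cdot\pi)(n)=\pi(gng^{-1})$. $N$ is regularly embedded in $G$ if the quotient Borel space $\widehat{N}/G$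 is countably separated, i.e. there are countably many Borel sets $U_i$ such that for each point $x$, the intersection of all $U_i$ containing $x$ is $\{x\}$. A locally compact group is CCR if its group C$^*$-algebra is CCR, i.e. all irreducible $*$-representations have image in the compact operators. *)

theory Defs
  imports
    "HOL-Analysis.Analysis"
    "HOL-Algebra.Group"
    "HOL-Computational_Algebra.Formal_Laurent_Series"
    "Berlekamp_Zassenhaus.Finite_Field"
begin

section \<open>Complex Hilbert spaces\<close>

text \<open>The inner product is linear in the first argument.\<close>

class complex_hilbert = banach +
  fixes scaleC :: "complex \<Rightarrow> 'a \<Rightarrow> 'a"
    and cinner :: "'a \<Rightarrow> 'a \<Rightarrow> complex"
  assumes scaleC_add_right: "scaleC a (x + y) = scaleC a x + scaleC a y"
    and scaleC_add_left: "scaleC (a + b) x = scaleC a x + scaleC b x"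
    and scaleC_scaleC: "scaleC a (scaleC b x) = scaleC (a * b) x"
    and scaleC_of_real: "scaleC (complex_of_real r) x = scaleR r x"
    and cinner_commute: "cinner x y = cnj (cinner y x)"
    and cinner_add_left: "cinner (x + y) z = cinner x z + cinner y z"
    and cinner_scaleC_left: "cinner (scaleC a x) y = a * cinner x y"
    and cinner_self: "cinner x x = complex_of_real ((norm x)\<^sup>2)"

definition clinear_map :: "('a::complex_hilbert \<Rightarrow> 'b::complex_hilbert) \<Rightarrow> bool" where
  "clinear_map S \<longleftrightarrow>
     (\<forall>x y. S (x + y) = S x + S y) \<and> (\<forall>c x. S (scaleC c x) = scaleC c (S x))"

definition bounded_clinear_map :: "('a::complex_hilbert \<Rightarrow> 'b::complex_hilbert) \<Rightarrow> bool" where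
  "bounded_clinear_map S \<longleftrightarrow> clinear_map S \<and> (\<exists>K. \<forall>x. norm (S x) \<le> K * norm x)"

definition unitary_map :: "('a::complex_hilbert \<Rightarrow> 'a) \<Rightarrow> bool" where
  "unitary_map S \<longleftrightarrow> clinear_map S \<and> surj S \<and> (\<forall>x y. cinner (S x) (S y) = cinner x y)"

definition closed_csubspace :: "'a::complex_hilbert set \<Rightarrow> bool" where
  "closed_csubspace W \<longleftrightarrow> closed W \<and> 0 \<in> W \<and>
     (\<forall>x\<in>W. \<forall>y\<in>W. x + y \<in> W) \<and> (\<forall>c. \<forall>x\<in>W. scaleC c x \<in> W)"

definition compact_operator :: "('a::complex_hilbert \<Rightarrow> 'b::complex_hilbert) \<Rightarrow> bool" where
  "compact_operator S \<longleftrightarrow> bounded_clinear_map S \<and> compact (closure (S ` cball 0 1))"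

subsection \<open>The Hilbert space of square-summable families\<close>

typedef 'i ell2 = "{f :: 'i \<Rightarrow> complex. (\<lambda>i. (cmod (f i))\<^sup>2) summable_on UNIV}"
  morphisms ell2_nth Abs_ell2
  by (rule exI[of _ "\<lambda>_. 0"]) simp

setup_lifting type_definition_ell2

lemma ell2_eqI: "(\<And>i. ell2_nth x i = ell2_nth y i) \<Longrightarrow> x = y"
  by (simp add: ell2_nth_inject[symmetric] fun_eq_iff)

lemma ell2_summable: "(\<lambda>i. (cmod (ell2_nth x i))\<^sup>2) summable_on UNIV"
  using ell2_nth[of x] by simp

lemma ell2_bdd_summable:
  assumes "\<And>F. finite F \<Longrightarrow> (\<Sum>i\<in>F. (cmod (f i))\<^sup>2) \<le> B"
  shows "(\<lambda>i. (cmod (f i))\<^sup>2) summable_on UNIV"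
proof (rule nonneg_bdd_above_summable_on)
  show "bdd_above (sum (\<lambda>i. (cmod (f i))\<^sup>2) ` {F. F \<subseteq> UNIV \<and> finite F})"
    using assms by (auto intro!: bdd_aboveI[of _ B])
qed simp

lemma ell2_finite_le:
  assumes "(\<lambda>i. (cmod (f i))\<^sup>2) summable_on UNIV" "finite F"
  shows "L2_set (\<lambda>i. cmod (f i)) F \<le> sqrt (\<Sum>\<^sub>\<infinity>i. (cmod (f i))\<^sup>2)"
  unfolding L2_set_def by (intro real_sqrt_le_mono finite_sum_le_infsum assms) auto

lemma ell2_triangle:
  assumes f: "(\<lambda>i. (cmod (f i))\<^sup>2) summable_on UNIV"
    and g: "(\<lambda>i. (cmod (g i))\<^sup>2) summable_on UNIV"
  shows "(\<lambda>i. (cmod (f i + g i))\<^sup>2) summable_on UNIV"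
    and "sqrt (\<Sum>\<^sub>\<infinity>i. (cmod (f i + g i))\<^sup>2) \<le>
           sqrt (\<Sum>\<^sub>\<infinity>i. (cmod (f i))\<^sup>2) + sqrt (\<Sum>\<^sub>\<infinity>i. (cmod (g i))\<^sup>2)" (is "_ \<le> ?B")
proof -
  have B0: "0 \<le> ?B" by (simp add: infsum_nonneg)
  have le: "(\<Sum>i\<in>F. (cmod (f i + g i))\<^sup>2) \<le> ?B\<^sup>2" if "finite F" for F
  proof -
    have "L2_set (\<lambda>i. cmod (f i + g i)) F \<le> L2_set (\<lambda>i. cmod (f i) + cmod (g i)) F"
      by (intro L2_set_mono) (auto simp: norm_triangle_ineq)
    also have "\<dots> \<le> L2_set (\<lambda>i. cmod (f i)) F + L2_set (\<lambda>i. cmod (g i)) F"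
      by (rule L2_set_triangle_ineq)
    also have "\<dots> \<le> ?B"
      by (intro add_mono ell2_finite_le f g that)
    finally show ?thesis
      using B0 by (simp add: L2_set_def real_sqrt_le_iff' sqrt_le_D)
  qed
  show s: "(\<lambda>i. (cmod (f i + g i))\<^sup>2) summable_on UNIV"
    by (rule ell2_bdd_summable) (rule le)
  have "(\<Sum>\<^sub>\<infinity>i. (cmod (f i + g i))\<^sup>2) \<le> ?B\<^sup>2"
    by (rule infsum_le_finite_sums[OF s]) (use le in auto)
  then show "sqrt (\<Sum>\<^sub>\<infinity>i. (cmod (f i + g i))\<^sup>2) \<le> ?B"
    using B0 by (simp add: real_le_lsqrt)
qed

lemma ell2_scale_summable:
  assumes "(\<lambda>i. (cmod (f i))\<^sup>2) summable_on UNIV"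
  shows "(\<lambda>i. (cmod (c * f i))\<^sup>2) summable_on UNIV"
  using summable_on_cmult_right[OF assms, of "(cmod c)\<^sup>2"]
  by (simp add: norm_mult power_mult_distrib)

lemma ell2_inner_summable:
  assumes f: "(\<lambda>i. (cmod (f i))\<^sup>2) summable_on UNIV"
    and g: "(\<lambda>i. (cmod (g i))\<^sup>2) summable_on UNIV"
  shows "(\<lambda>i. f i * cnj (g i)) summable_on UNIV"
proof (rule abs_summable_summable)
  have *: "(\<lambda>i. (cmod (f i))\<^sup>2 + (cmod (g i))\<^sup>2) summable_on UNIV"
    by (intro summable_on_add f g)
  show "(\<lambda>i. norm (f i * cnj (g i))) summable_on UNIV"
  proof (rule Infinite_Sum.abs_summable_on_comparison_test')
    show "(\<lambda>i. (cmod (f i))\<^sup>2 + (cmod (g i))\<^sup>2) summable_on UNIV" by (rule *)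
    show "norm (f i * cnj (g i)) \<le> (cmod (f i))\<^sup>2 + (cmod (g i))\<^sup>2" for i
    proof -
      have "2 * (cmod (f i) * cmod (g i)) \<le> (cmod (f i))\<^sup>2 + (cmod (g i))\<^sup>2"
        using sum_squares_bound[of "cmod (f i)" "cmod (g i)"] by (simp add: mult.assoc)
      moreover have "0 \<le> cmod (f i) * cmod (g i)" by simp
      ultimately show ?thesis unfolding norm_mult complex_mod_cnj by linarith
    qed
  qed
qed

instantiation ell2 :: (type) real_normed_vector
begin

lift_definition zero_ell2 :: "'a ell2" is "\<lambda>_. 0" by simp

lift_definition plus_ell2 :: "'a ell2 \<Rightarrow> 'a ell2 \<Rightarrow> 'a ell2" is "\<lambda>f g i. f i + g i"
  by (rule ell2_triangle)

lift_definition uminus_ell2 :: "'a ell2 \<Rightarrow> 'a ell2" is "\<lambda>f i. - f i" by simp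

lift_definition minus_ell2 :: "'a ell2 \<Rightarrow> 'a ell2 \<Rightarrow> 'a ell2" is "\<lambda>f g i. f i - g i"
  subgoal for f g using ell2_triangle(1)[of f "\<lambda>i. - g i"] by simp
  done

lift_definition scaleR_ell2 :: "real \<Rightarrow> 'a ell2 \<Rightarrow> 'a ell2" is
  "\<lambda>r f i. complex_of_real r * f i"
  by (rule ell2_scale_summable)

definition norm_ell2 :: "'a ell2 \<Rightarrow> real" where
  "norm_ell2 x = sqrt (\<Sum>\<^sub>\<infinity>i. (cmod (ell2_nth x i))\<^sup>2)"

definition dist_ell2 :: "'a ell2 \<Rightarrow> 'a ell2 \<Rightarrow> real" where
  "dist_ell2 x y = norm (x - y)"

definition sgn_ell2 :: "'a ell2 \<Rightarrow> 'a ell2" where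
  "sgn_ell2 x = inverse (norm x) *\<^sub>R x"

definition uniformity_ell2 :: "('a ell2 \<times> 'a ell2) filter" where
  "uniformity_ell2 = (INF e\<in>{0 <..}. principal {(x, y). dist x y < e})"

definition open_ell2 :: "'a ell2 set \<Rightarrow> bool" where
  "open_ell2 U \<longleftrightarrow> (\<forall>x\<in>U. eventually (\<lambda>(x', y). x' = x \<longrightarrow> y \<in> U) uniformity)"

instance
proof
  fix x y z :: "'a ell2" and a b :: real
  show "norm x = 0 \<longleftrightarrow> x = 0"
  proof
    assume "norm x = 0"
    then have 0: "(\<Sum>\<^sub>\<infinity>i. (cmod (ell2_nth x i))\<^sup>2) = 0"
      by (simp add: norm_ell2_def)
    show "x = 0"
    proof (rule ell2_eqI)
      fix i
      have "(cmod (ell2_nth x i))\<^sup>2 = 0"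
        by (rule nonneg_infsum_le_0D[OF _ ell2_summable]) (use 0 in auto)
      then show "ell2_nth x i = ell2_nth 0 i" by (simp add: zero_ell2.rep_eq)
    qed
  qed (simp add: norm_ell2_def zero_ell2.rep_eq)
  show "norm (x + y) \<le> norm x + norm y"
    unfolding norm_ell2_def plus_ell2.rep_eq by (rule ell2_triangle; rule ell2_summable)
  show "norm (a *\<^sub>R x) = \<bar>a\<bar> * norm x"
    by (simp add: norm_ell2_def scaleR_ell2.rep_eq norm_mult power_mult_distrib
        infsum_cmult_right' real_sqrt_mult)
qed (auto simp: dist_ell2_def sgn_ell2_def uniformity_ell2_def open_ell2_def
       plus_ell2.rep_eq zero_ell2.rep_eq uminus_ell2.rep_eq minus_ell2.rep_eq
       scaleR_ell2.rep_eq algebra_simps intro!: ell2_eqI)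

end

lemma ell2_norm_le:
  assumes "\<And>F. finite F \<Longrightarrow> L2_set (\<lambda>i. cmod (ell2_nth x i)) F \<le> B"
  shows "norm x \<le> B"
proof -
  have B: "0 \<le> B" using assms[of "{}"] by simp
  have "(\<Sum>\<^sub>\<infinity>i. (cmod (ell2_nth x i))\<^sup>2) \<le> B\<^sup>2"
  proof (rule infsum_le_finite_sums[OF ell2_summable])
    fix F :: "'a set" assume "finite F"
    from assms[OF this] show "(\<Sum>i\<in>F. (cmod (ell2_nth x i))\<^sup>2) \<le> B\<^sup>2"
      by (simp add: L2_set_def sqrt_le_D)
  qed
  then show ?thesis unfolding norm_ell2_def using B by (simp add: real_le_lsqrt)
qed

lemma ell2_finite_le_norm: "finite F \<Longrightarrow> L2_set (\<lambda>i. cmod (ell2_nth x i)) F \<le> norm x"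
  unfolding norm_ell2_def by (rule ell2_finite_le[OF ell2_summable])

instance ell2 :: (type) banach
proof
  fix X :: "nat \<Rightarrow> 'a ell2"
  assume X: "Cauchy X"
  have coord: "cmod (ell2_nth x i) \<le> norm x" for x :: "'a ell2" and i
    using ell2_finite_le_norm[of "{i}" x] by simp
  have "Cauchy (\<lambda>n. ell2_nth (X n) i)" for i
  proof (rule metric_CauchyI)
    fix e :: real assume "0 < e"
    with X obtain M where M: "\<And>m n. m \<ge> M \<Longrightarrow> n \<ge> M \<Longrightarrow> dist (X m) (X n) < e"
      by (meson metric_CauchyD)
    have "dist (ell2_nth (X m) i) (ell2_nth (X n) i) < e" if "m \<ge> M" "n \<ge> M" for m n
      using coord[of "X m - X n" i] M[OF that]
      by (simp add: dist_norm minus_ell2.rep_eq)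
    then show "\<exists>M. \<forall>m\<ge>M. \<forall>n\<ge>M. dist (ell2_nth (X m) i) (ell2_nth (X n) i) < e" by blast
  qed
  then have "\<forall>i. \<exists>l. (\<lambda>n. ell2_nth (X n) i) \<longlonglongrightarrow> l"
    by (simp add: Cauchy_convergent_iff convergent_def)
  then obtain f where f: "\<And>i. (\<lambda>n. ell2_nth (X n) i) \<longlonglongrightarrow> f i" by metis
  have tail: "L2_set (\<lambda>i. cmod (ell2_nth (X m) i - f i)) F \<le> e"
    if M: "\<And>m n. m \<ge> M \<Longrightarrow> n \<ge> M \<Longrightarrow> dist (X m) (X n) < e" and m: "m \<ge> M" and F: "finite F"
    for M m e F
  proof (rule LIMSEQ_le_const2)
    show "(\<lambda>n. L2_set (\<lambda>i. cmod (ell2_nth (X m) i - ell2_nth (X n) i)) F)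
            \<longlonglongrightarrow> L2_set (\<lambda>i. cmod (ell2_nth (X m) i - f i)) F"
      unfolding L2_set_def by (intro tendsto_intros f)
    show "\<exists>N. \<forall>n\<ge>N. L2_set (\<lambda>i. cmod (ell2_nth (X m) i - ell2_nth (X n) i)) F \<le> e"
    proof (intro exI allI impI)
      fix n assume "n \<ge> M"
      have "L2_set (\<lambda>i. cmod (ell2_nth (X m - X n) i)) F \<le> norm (X m - X n)"
        by (rule ell2_finite_le_norm[OF F])
      then show "L2_set (\<lambda>i. cmod (ell2_nth (X m) i - ell2_nth (X n) i)) F \<le> e"
        using M[OF m \<open>n \<ge> M\<close>] by (simp add: minus_ell2.rep_eq dist_norm)
    qed
  qed
  have fs: "(\<lambda>i. (cmod (f i))\<^sup>2) summable_on UNIV"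
  proof -
    from X obtain M where M: "\<And>m n. m \<ge> M \<Longrightarrow> n \<ge> M \<Longrightarrow> dist (X m) (X n) < 1"
      using metric_CauchyD[OF X, of 1] by auto
    have "(\<lambda>i. (cmod (ell2_nth (X M) i - f i))\<^sup>2) summable_on UNIV"
    proof (rule ell2_bdd_summable)
      fix F :: "'a set" assume "finite F"
      from tail[OF M order_refl this]
      show "(\<Sum>i\<in>F. (cmod (ell2_nth (X M) i - f i))\<^sup>2) \<le> 1"
        by (simp add: L2_set_def)
    qed
    from ell2_scale_summable[OF this, of "-1"]
    have "(\<lambda>i. (cmod (f i - ell2_nth (X M) i))\<^sup>2) summable_on UNIV"
      by (simp add: norm_minus_commute)
    from ell2_triangle(1)[OF this ell2_summable[of "X M"]] show ?thesis by simp
  qed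
  define L where "L = Abs_ell2 f"
  have L: "ell2_nth L = f" unfolding L_def using fs by (simp add: Abs_ell2_inverse)
  have "X \<longlonglongrightarrow> L"
  proof (rule metric_LIMSEQ_I)
    fix e :: real assume "0 < e"
    then have "0 < e / 2" by simp
    then obtain M where M: "\<And>m n. m \<ge> M \<Longrightarrow> n \<ge> M \<Longrightarrow> dist (X m) (X n) < e / 2"
      using metric_CauchyD[OF X] by meson
    have "dist (X m) L < e" if "m \<ge> M" for m
    proof -
      have "norm (X m - L) \<le> e / 2"
        unfolding minus_ell2.rep_eq L
        by (rule ell2_norm_le) (use tail[OF M that] in \<open>simp add: minus_ell2.rep_eq L\<close>)
      with \<open>0 < e\<close> show ?thesis by (simp add: dist_norm)
    qed
    then show "\<exists>M. \<forall>m\<ge>M. dist (X m) L < e" by blast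
  qed
  then show "convergent X" by (auto simp: convergent_def)
qed

instantiation ell2 :: (type) complex_hilbert
begin

lift_definition scaleC_ell2 :: "complex \<Rightarrow> 'a ell2 \<Rightarrow> 'a ell2" is "\<lambda>c f i. c * f i"
  by (rule ell2_scale_summable)

definition cinner_ell2 :: "'a ell2 \<Rightarrow> 'a ell2 \<Rightarrow> complex" where
  "cinner_ell2 x y = (\<Sum>\<^sub>\<infinity>i. ell2_nth x i * cnj (ell2_nth y i))"

instance
proof
  fix x y z :: "'a ell2" and a b :: complex and r :: real
  show "cinner x y = cnj (cinner y x)"
    by (simp add: cinner_ell2_def infsum_cnj[symmetric] mult.commute)
  show "cinner (x + y) z = cinner x z + cinner y z"
    unfolding cinner_ell2_def plus_ell2.rep_eq distrib_right
    by (intro infsum_add ell2_inner_summable ell2_summable)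
  show "cinner (scaleC a x) y = a * cinner x y"
    by (simp add: cinner_ell2_def scaleC_ell2.rep_eq mult.assoc infsum_cmult_right')
  show "cinner x x = complex_of_real ((norm x)\<^sup>2)"
  proof -
    have "((\<lambda>i. complex_of_real ((cmod (ell2_nth x i))\<^sup>2)) has_sum
             complex_of_real (\<Sum>\<^sub>\<infinity>i. (cmod (ell2_nth x i))\<^sup>2)) UNIV"
      by (intro has_sum_of_real has_sum_infsum ell2_summable)
    then show ?thesis
      by (simp add: cinner_ell2_def norm_ell2_def infsum_nonneg infsumI
          flip: complex_norm_square)
  qed
qed (auto simp: plus_ell2.rep_eq scaleC_ell2.rep_eq scaleR_ell2.rep_eq algebra_simps
       intro!: ell2_eqI)

end


section \<open>Topological groups, unitary representations and Haar measure\<close>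

text \<open>
  A topological group is given by a group \<open>G\<close> and a topology \<open>T\<close> with
  \<^prop>\<open>topspace T = carrier G\<close>. The functions occurring below are only relevant on
  \<^term>\<open>carrier G\<close>.
\<close>

definition locally_compact_group :: "'g monoid \<Rightarrow> 'g topology \<Rightarrow> bool" where
  "locally_compact_group G T \<longleftrightarrow> group G \<and> topspace T = carrier G \<and>
     continuous_map (prod_topology T T) T (\<lambda>(x, y). x \<otimes>\<^bsub>G\<^esub> y) \<and>
     continuous_map T T (\<lambda>x. inv\<^bsub>G\<^esub> x) \<and>
     Hausdorff_space T \<and> locally_compact_space T"

definition borel_of :: "'a topology \<Rightarrow> 'a measure" where
  "borel_of X = sigma (topspace X) {U. openin X U}"

definition unitary_rep ::
    "'g monoid \<Rightarrow> 'g topology \<Rightarrow> ('g \<Rightarrow> 'h::complex_hilbert \<Rightarrow> 'h) \<Rightarrow> bool" where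
  "unitary_rep G T u \<longleftrightarrow>
     (\<forall>g\<in>carrier G. unitary_map (u g)) \<and>
     (\<forall>g\<in>carrier G. \<forall>h\<in>carrier G. \<forall>v. u (g \<otimes>\<^bsub>G\<^esub> h) v = u g (u h v)) \<and>
     (\<forall>v. continuous_map T euclidean (\<lambda>g. u g v))"

definition left_haar_measure :: "'g monoid \<Rightarrow> 'g topology \<Rightarrow> 'g measure \<Rightarrow> bool" where
  "left_haar_measure G T \<mu> \<longleftrightarrow>
     sets \<mu> = sets (borel_of T) \<and>
     emeasure \<mu> (space \<mu>) \<noteq> 0 \<and>
     (\<forall>K. compactin T K \<longrightarrow> emeasure \<mu> K < \<infinity>) \<and>
     (\<forall>B\<in>sets \<mu>. emeasure \<mu> B = (INF U\<in>{U. openin T U \<and> B \<subseteq> U}. emeasure \<mu> U)) \<and>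
     (\<forall>U. openin T U \<longrightarrow>
        emeasure \<mu> U = (SUP K\<in>{K. compactin T K \<and> K \<subseteq> U}. emeasure \<mu> K)) \<and>
     (\<forall>g\<in>carrier G. \<forall>B\<in>sets \<mu>. emeasure \<mu> ((\<lambda>x. g \<otimes>\<^bsub>G\<^esub> x) ` B) = emeasure \<mu> B)"

text \<open>Normalization of the modular function: \<open>\<mu> (B g) = \<Delta>(g) \<mu> B\<close>.\<close>

definition modular_function :: "'g monoid \<Rightarrow> 'g measure \<Rightarrow> 'g \<Rightarrow> real" where
  "modular_function G \<mu> g = (THE c. 0 < c \<and>
     (\<forall>B\<in>sets \<mu>. emeasure \<mu> ((\<lambda>x. x \<otimes>\<^bsub>G\<^esub> g) ` B) = ennreal c * emeasure \<mu> B))"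


section \<open>The group C*-algebra\<close>

text \<open>
  The group C*-algebra is the completion of the convolution algebra of compactly supported
  continuous functions in the universal norm
  \[ \|f\| = \sup_u \Big\| \int f(x)\, u(x)\, d\mu(x) \Big\|, \]
  \<open>u\<close> ranging over the unitary representations of \<open>G\<close>; the operator norm of the weakly
  defined operator is written as the supremum of its matrix coefficients over the unit ball.
  Restricting to representations on one Hilbert space \<open>\<ell>\<^sup>2\<close> with index
  type \<open>'g \<Rightarrow> complex\<close> does not change the supremum: it suffices to consider cyclic
  representations, their dimension is at most the cardinality of that type, and any
  representation on a smaller space can be enlarged by a trivial summand.
\<close>

definition compactly_supported_functions ::
    "'g monoid \<Rightarrow> 'g topology \<Rightarrow> ('g \<Rightarrow> complex) set" where
  "compactly_supported_functions G T = {f. continuous_map T euclidean f \<and>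
     (\<exists>K. compactin T K \<and> (\<forall>x\<in>carrier G - K. f x = 0))}"

definition convolution ::
    "'g monoid \<Rightarrow> 'g measure \<Rightarrow> ('g \<Rightarrow> complex) \<Rightarrow> ('g \<Rightarrow> complex) \<Rightarrow> 'g \<Rightarrow> complex" where
  "convolution G \<mu> f h x = (LINT y|\<mu>. f y * h (inv\<^bsub>G\<^esub> y \<otimes>\<^bsub>G\<^esub> x))"

definition involution ::
    "'g monoid \<Rightarrow> 'g measure \<Rightarrow> ('g \<Rightarrow> complex) \<Rightarrow> 'g \<Rightarrow> complex" where
  "involution G \<mu> f x =
     complex_of_real (modular_function G \<mu> (inv\<^bsub>G\<^esub> x)) * cnj (f (inv\<^bsub>G\<^esub> x))"

definition universal_norm ::
    "'g monoid \<Rightarrow> 'g topology \<Rightarrow> 'g measure \<Rightarrow> ('g \<Rightarrow> complex) \<Rightarrow> real" where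
  "universal_norm G T \<mu> f =
     (SUP (u, v, w) \<in> {(u :: 'g \<Rightarrow> ('g \<Rightarrow> complex) ell2 \<Rightarrow> ('g \<Rightarrow> complex) ell2, v, w).
          unitary_rep G T u \<and> norm v \<le> 1 \<and> norm w \<le> 1}.
        cmod (LINT x|\<mu>. f x * cinner (u x v) w))"

definition cauchy_sequences ::
    "'g monoid \<Rightarrow> 'g topology \<Rightarrow> 'g measure \<Rightarrow> (nat \<Rightarrow> 'g \<Rightarrow> complex) set" where
  "cauchy_sequences G T \<mu> = {F. (\<forall>k. F k \<in> compactly_supported_functions G T) \<and>
     (\<forall>e>0. \<exists>M. \<forall>i\<ge>M. \<forall>j\<ge>M. universal_norm G T \<mu> (\<lambda>x. F i x - F j x) < e)}"

definition cauchy_equiv ::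
    "'g monoid \<Rightarrow> 'g topology \<Rightarrow> 'g measure \<Rightarrow>
     ((nat \<Rightarrow> 'g \<Rightarrow> complex) \<times> (nat \<Rightarrow> 'g \<Rightarrow> complex)) set" where
  "cauchy_equiv G T \<mu> = {(F, H). F \<in> cauchy_sequences G T \<mu> \<and> H \<in> cauchy_sequences G T \<mu> \<and>
     (\<lambda>k. universal_norm G T \<mu> (\<lambda>x. F k x - H k x)) \<longlonglongrightarrow> 0}"

record 'a star_algebra = "'a partial_object" +
  sa_add :: "'a \<Rightarrow> 'a \<Rightarrow> 'a"
  sa_scale :: "complex \<Rightarrow> 'a \<Rightarrow> 'a"
  sa_mult :: "'a \<Rightarrow> 'a \<Rightarrow> 'a"
  sa_star :: "'a \<Rightarrow> 'a"
  sa_norm :: "'a \<Rightarrow> real"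

definition group_cstar ::
    "'g monoid \<Rightarrow> 'g topology \<Rightarrow> 'g measure \<Rightarrow> (nat \<Rightarrow> 'g \<Rightarrow> complex) set star_algebra" where
  "group_cstar G T \<mu> = (let R = cauchy_equiv G T \<mu> in
     \<lparr> carrier = cauchy_sequences G T \<mu> // R,
       sa_add = (\<lambda>X Y. R `` {(\<lambda>k x. F k x + H k x) | F H. F \<in> X \<and> H \<in> Y}),
       sa_scale = (\<lambda>c X. R `` {(\<lambda>k x. c * F k x) | F. F \<in> X}),
       sa_mult = (\<lambda>X Y. R `` {(\<lambda>k. convolution G \<mu> (F k) (H k)) | F H. F \<in> X \<and> H \<in> Y}),
       sa_star = (\<lambda>X. R `` {(\<lambda>k. involution G \<mu> (F k)) | F. F \<in> X}),
       sa_norm = (\<lambda>X. THE r. \<forall>F\<in>X. (\<lambda>k. universal_norm G T \<mu> (F k)) \<longlonglongrightarrow> r) \<rparr>)"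


section \<open>CCR algebras and CCR groups\<close>

definition star_rep ::
    "('a, 'b) star_algebra_scheme \<Rightarrow> ('a \<Rightarrow> 'h::complex_hilbert \<Rightarrow> 'h) \<Rightarrow> bool" where
  "star_rep A \<pi> \<longleftrightarrow>
     (\<forall>a\<in>carrier A. bounded_clinear_map (\<pi> a)) \<and>
     (\<forall>a\<in>carrier A. \<forall>b\<in>carrier A. \<forall>v. \<pi> (sa_add A a b) v = \<pi> a v + \<pi> b v) \<and>
     (\<forall>c. \<forall>a\<in>carrier A. \<forall>v. \<pi> (sa_scale A c a) v = scaleC c (\<pi> a v)) \<and>
     (\<forall>a\<in>carrier A. \<forall>b\<in>carrier A. \<forall>v. \<pi> (sa_mult A a b) v = \<pi> a (\<pi> b v)) \<and>
     (\<forall>a\<in>carrier A. \<forall>v w. cinner (\<pi> (sa_star A a) v) w = cinner v (\<pi> a w))"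

definition irreducible_star_rep ::
    "('a, 'b) star_algebra_scheme \<Rightarrow> ('a \<Rightarrow> 'h::complex_hilbert \<Rightarrow> 'h) \<Rightarrow> bool" where
  "irreducible_star_rep A \<pi> \<longleftrightarrow> star_rep A \<pi> \<and>
     (\<exists>a\<in>carrier A. \<exists>v. \<pi> a v \<noteq> 0) \<and>
     (\<forall>W. closed_csubspace W \<and> (\<forall>a\<in>carrier A. \<pi> a ` W \<subseteq> W) \<longrightarrow> W = {0} \<or> W = UNIV)"

text \<open>
  HOL does not allow quantification over the type \<open>'h\<close> of the representation space inside a
  definition. It is therefore a parameter, over which theorems about CCR algebras and groups
  are universally quantified.
\<close>

definition CCR_algebra ::
    "'h::complex_hilbert itself \<Rightarrow> ('a, 'b) star_algebra_scheme \<Rightarrow> bool" where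
  "CCR_algebra _ A \<longleftrightarrow>
     (\<forall>\<pi> :: 'a \<Rightarrow> 'h \<Rightarrow> 'h. irreducible_star_rep A \<pi> \<longrightarrow>
        (\<forall>a\<in>carrier A. compact_operator (\<pi> a)))"

definition CCR_group ::
    "'h::complex_hilbert itself \<Rightarrow> 'g monoid \<Rightarrow> 'g topology \<Rightarrow> bool" where
  "CCR_group H G T \<longleftrightarrow> locally_compact_group G T \<and>
     (\<forall>\<mu>. left_haar_measure G T \<mu> \<longrightarrow> CCR_algebra H (group_cstar G T \<mu>))"


section \<open>Pontryagin duals and regularly embedded subgroups\<close>

definition pontryagin_dual :: "'g monoid \<Rightarrow> 'g topology \<Rightarrow> ('g \<Rightarrow> complex) set" where
  "pontryagin_dual G T = {\<phi> \<in> extensional (carrier G).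
     continuous_map T euclidean \<phi> \<and>
     (\<forall>x\<in>carrier G. cmod (\<phi> x) = 1) \<and>
     (\<forall>x\<in>carrier G. \<forall>y\<in>carrier G. \<phi> (x \<otimes>\<^bsub>G\<^esub> y) = \<phi> x * \<phi> y)}"

text \<open>The compact-open topology.\<close>

definition dual_topology :: "'g monoid \<Rightarrow> 'g topology \<Rightarrow> ('g \<Rightarrow> complex) topology" where
  "dual_topology G T = topology_generated_by
     {{\<phi> \<in> pontryagin_dual G T. \<phi> ` K \<subseteq> U} | K U. compactin T K \<and> open U}"

definition subgroup_dual ::
    "'g monoid \<Rightarrow> 'g topology \<Rightarrow> 'g set \<Rightarrow> ('g \<Rightarrow> complex) topology" where
  "subgroup_dual G T N = dual_topology (G\<lparr>carrier := N\<rparr>) (subtopology T N)"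

definition conj_act :: "'g monoid \<Rightarrow> 'g set \<Rightarrow> 'g \<Rightarrow> ('g \<Rightarrow> complex) \<Rightarrow> 'g \<Rightarrow> complex" where
  "conj_act G N g \<phi> = (\<lambda>n\<in>N. \<phi> (g \<otimes>\<^bsub>G\<^esub> n \<otimes>\<^bsub>G\<^esub> inv\<^bsub>G\<^esub> g))"

definition dual_orbit ::
    "'g monoid \<Rightarrow> 'g set \<Rightarrow> 'g set \<Rightarrow> ('g \<Rightarrow> complex) \<Rightarrow> ('g \<Rightarrow> complex) set" where
  "dual_orbit G N S \<phi> = (\<lambda>g. conj_act G N g \<phi>) ` S"

text \<open>
  Countable separation of a set \<open>X\<close> with a family \<open>\<B>\<close> of Borel sets. The intersection
  with \<open>X\<close> makes the empty intersection equal to \<open>X\<close>.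
\<close>

definition countably_separated :: "'a set \<Rightarrow> 'a set set \<Rightarrow> bool" where
  "countably_separated X \<B> \<longleftrightarrow>
     (\<exists>\<U>. countable \<U> \<and> \<U> \<subseteq> \<B> \<and> (\<forall>x\<in>X. X \<inter> \<Inter>{U \<in> \<U>. x \<in> U} = {x}))"

definition dual_orbit_space ::
    "'g monoid \<Rightarrow> 'g topology \<Rightarrow> 'g set \<Rightarrow> ('g \<Rightarrow> complex) set set" where
  "dual_orbit_space G T N = dual_orbit G N (carrier G) ` topspace (subgroup_dual G T N)"

definition quotient_borel_sets ::
    "'g monoid \<Rightarrow> 'g topology \<Rightarrow> 'g set \<Rightarrow> ('g \<Rightarrow> complex) set set set" where
  "quotient_borel_sets G T N = {S. S \<subseteq> dual_orbit_space G T N \<and>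
     {\<phi> \<in> topspace (subgroup_dual G T N). dual_orbit G N (carrier G) \<phi> \<in> S}
       \<in> sets (borel_of (subgroup_dual G T N))}"

text \<open>For abelian normal \<open>N\<close>, so that the unitary dual of \<open>N\<close> is its Pontryagin dual.\<close>

definition regularly_embedded :: "'g monoid \<Rightarrow> 'g topology \<Rightarrow> 'g set \<Rightarrow> bool" where
  "regularly_embedded G T N \<longleftrightarrow>
     countably_separated (dual_orbit_space G T N) (quotient_borel_sets G T N)"


section \<open>The Heisenberg group\<close>

text \<open>
  The field $\mathbb{F}_p((t))$ is \<^typ>\<open>'p::prime_card mod_ring fls\<close> with $p$ the cardinality of
  \<open>'p\<close>. The library metric on formal Laurent series induces the usual topology, and
  $\mathbb{H}_n$ carries the product topology of its type.
\<close>

type_synonym ('p, 'n) heis =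
  "(('p mod_ring fls) ^ 'n) \<times> (('p mod_ring fls) ^ 'n) \<times> ('p mod_ring fls)"

definition dot :: "('a::comm_ring_1) ^ 'n \<Rightarrow> 'a ^ 'n \<Rightarrow> 'a" where
  "dot x y = (\<Sum>i\<in>UNIV. vec_nth x i * vec_nth y i)"

definition heisenberg :: "('p::prime_card, 'n::finite) heis monoid" where
  "heisenberg = \<lparr> carrier = UNIV,
     mult = (\<lambda>(\<xi>, \<upsilon>, z) (\<zeta>, \<mu>, w). (\<xi> + \<zeta>, \<upsilon> + \<mu>, z + w + dot \<xi> \<mu>)),
     one = (0, 0, 0) \<rparr>"

definition heis_N :: "('p::prime_card, 'n::finite) heis set" where
  "heis_N = {(0, \<upsilon>, z) | \<upsilon> z. True}"

definition heis_A :: "('p::prime_card, 'n::finite) heis set" where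
  "heis_A = {(\<xi>, 0, 0) | \<xi>. True}"

end

theory Submission
  imports Defs
begin

text \<open>
  Write \<open>F\<close> for the Laurent series field, \<open>K\<^sub>m\<close> for the compact open subgroups of elements
  of the Heisenberg group whose coordinates are divisible by \<open>t\<^sup>m\<close>.

  Every character of \<open>F\<close> has the form \<open>x \<mapsto> \<psi>(\<xi> x)\<close> for any fixed nontrivial \<open>\<psi>\<close>. Hence the orbit
  of a character of \<open>N\<close> that is nontrivial on the centre consists of all characters with the same
  central restriction, and all other orbits are points. Such sets are closed and are separated by
  evaluations at a countable dense set.

  For CCR, a star-representation \<open>\<pi>\<close> of the group C*-algebra is contractive, since
  \<open>1 - a\<^sup>* a\<close> has a self-adjoint square root when \<open>a\<close> has norm less than 1. If \<open>\<pi>\<close> is irreducible,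
  it comes from a representation \<open>u\<close> of the group, and \<open>P\<^sub>m\<close>, the image of the normalized
  indicator function of \<open>K\<^sub>m\<close>, projects to the \<open>K\<^sub>m\<close>-fixed vectors. The \<open>P\<^sub>m\<close> form an approximate
  unit, so it suffices that they have finite rank. All group elements have finite order, so central
  elements have eigenvectors and act by scalars without appeal to the spectral theorem. The
  operators \<open>P\<^sub>m u(g) P\<^sub>m\<close> vanish for \<open>g\<close> outside a subgroup that is compact modulo the
  centre (or \<open>u\<close> is one-dimensional), so they span a finite-dimensional space; applied to one
  vector they exhaust the image of \<open>P\<^sub>m\<close> by irreducibility.
\<close>

section \<open>Topology of formal Laurent series over finite groups\<close>

text \<open>\<open>star_rep\<close> bounds each operator by a constant of its own and says nothing
  about the universal norm, so contractivity has to be proved before any limit can pass through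
  \<open>\<pi>\<close>. The completed convolution algebra has no unit adjoined, which is why the
  root is sought as \<open>b\<close> with \<open>h = 2 b - b * b\<close>; its elements are classes
  of sequences, so the iteration producing \<open>b\<close> runs along the sequence that represents
  \<open>h\<close>. Finite rank of every \<open>P m\<close> is enough for compactness because a
  compactly supported function is close in L1 to finite combinations of translates of the bump on
  \<open>K m\<close>, and such a translate acts as \<open>u x\<close> after \<open>P m\<close>.
  Every operator of the algebra is therefore a norm limit of operators of finite rank. The group
  operators are strong limits of translated bumps; the limits exist everywhere since irreducibility
  makes the vectors \<open>sig f w\<close> generate the whole space. Torsion also makes the group
  unimodular, which removes the modular factor from the involution and makes left, right and
  inverted integrals agree.\<close>

notation fls_nth (infixl "$$" 75)

definition fls_ball :: "int \<Rightarrow> 'a::zero fls set" where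
  "fls_ball k = {x. \<forall>j<k. x $$ j = 0}"

lemma fls_ball_iff_subdegree: "x \<in> fls_ball k \<longleftrightarrow> x = 0 \<or> k \<le> fls_subdegree x"
  unfolding fls_ball_def
  using fls_eq0_below_subdegree[of _ x] fls_subdegree_geI[of x k] by force

lemma fls_ball_mono: "k \<le> l \<Longrightarrow> fls_ball l \<subseteq> fls_ball k"
  by (auto simp: fls_ball_def)

lemma zero_in_fls_ball [simp]: "0 \<in> fls_ball k"
  by (simp add: fls_ball_def)

lemma fls_ball_add: "x \<in> fls_ball k \<Longrightarrow> y \<in> fls_ball k \<Longrightarrow> x + y \<in> fls_ball k"
  for x y :: "'a::monoid_add fls"
  by (simp add: fls_ball_def)

lemma fls_ball_diff: "x \<in> fls_ball k \<Longrightarrow> y \<in> fls_ball k \<Longrightarrow> x - y \<in> fls_ball k"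
  for x y :: "'a::group_add fls"
  by (simp add: fls_ball_def)

lemma fls_ball_uminus: "- x \<in> fls_ball k \<longleftrightarrow> x \<in> fls_ball k"
  for x :: "'a::group_add fls"
  by (simp add: fls_ball_def)

lemma fls_ball_mult:
  fixes x y :: "'a::idom fls"
  assumes "x \<in> fls_ball k" "y \<in> fls_ball l"
  shows "x * y \<in> fls_ball (k + l)"
  using assms by (cases "x = 0"; cases "y = 0") (auto simp: fls_ball_iff_subdegree)

lemma fls_ball_sum:
  "(\<And>i. i \<in> A \<Longrightarrow> f i \<in> fls_ball k) \<Longrightarrow> sum f A \<in> fls_ball k"
  for f :: "_ \<Rightarrow> 'a::comm_monoid_add fls"
  by (induction A rule: infinite_finite_induct) (auto intro: fls_ball_add)

lemma ex_fls_ball: "\<exists>k. x \<in> fls_ball k"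
  by (auto simp: fls_ball_iff_subdegree)

lemma dist_fls_powi:
  "dist x y = (if x = y then 0 else 2 powi (- fls_subdegree (x - y)))"
  for x y :: "'a::group_add fls"
  by (auto simp: dist_fls_def power_int_def power_one_over inverse_eq_divide)

lemma powi_two_le_iff: "(2::real) powi a \<le> 2 powi b \<longleftrightarrow> a \<le> b"
  using power_int_strict_increasing[of b a "2::real"] power_int_increasing[of a b "2::real"]
  by force

lemma dist_fls_le_iff: "dist x y \<le> 2 powi (- k) \<longleftrightarrow> x - y \<in> fls_ball k"
  for x y :: "'a::group_add fls"
  by (auto simp: dist_fls_powi fls_ball_iff_subdegree powi_two_le_iff)

lemma fls_ball_eq_cball: "fls_ball k = cball (0 :: 'a::group_add fls) (2 powi (- k))"
proof -
  have "x \<in> fls_ball k \<longleftrightarrow> dist 0 x \<le> 2 powi (- k)" for x :: "'a fls"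
    unfolding dist_fls_le_iff by (simp add: fls_ball_uminus)
  then show ?thesis unfolding set_eq_iff mem_cball by blast
qed

lemma ex_powi_less: "0 < e \<Longrightarrow> \<exists>k\<ge>m. (2::real) powi (- k) < e"
proof -
  assume e: "0 < e"
  obtain n where n: "(1/2::real) ^ n < e" using real_arch_pow_inv[OF e, of "1/2"] by auto
  have "(2::real) powi (- (max m (int n))) \<le> 2 powi (- int n)" by (simp add: powi_two_le_iff)
  also have "\<dots> = (1/2) ^ n" by (simp add: power_int_minus power_one_over inverse_eq_divide)
  finally have "(2::real) powi (- (max m (int n))) < e" using n by linarith
  then show ?thesis by (intro exI[of _ "max m (int n)"]) auto
qed

lemma open_fls_iff:
  "open U \<longleftrightarrow> (\<forall>x\<in>U. \<exists>k. \<forall>y. y - x \<in> fls_ball k \<longrightarrow> y \<in> U)"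
  for U :: "'a::group_add fls set"
proof
  assume U: "open U"
  show "\<forall>x\<in>U. \<exists>k. \<forall>y. y - x \<in> fls_ball k \<longrightarrow> y \<in> U"
  proof
    fix x assume "x \<in> U"
    with U obtain e where e: "e > 0" "\<And>y. dist y x < e \<Longrightarrow> y \<in> U" by (auto simp: open_dist)
    obtain k where "(2::real) powi (- k) < e" using ex_powi_less[OF e(1)] by blast
    then have "\<forall>y. y - x \<in> fls_ball k \<longrightarrow> y \<in> U"
      using e(2) by (auto simp flip: dist_fls_le_iff)
    then show "\<exists>k. \<forall>y. y - x \<in> fls_ball k \<longrightarrow> y \<in> U" by blast
  qed
next
  assume *: "\<forall>x\<in>U. \<exists>k. \<forall>y. y - x \<in> fls_ball k \<longrightarrow> y \<in> U"
  show "open U" unfolding open_dist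
  proof
    fix x assume "x \<in> U"
    with * obtain k where k: "\<And>y. y - x \<in> fls_ball k \<Longrightarrow> y \<in> U" by blast
    have "\<forall>y. dist y x < 2 powi (- k) \<longrightarrow> y \<in> U"
      using k by (auto simp flip: dist_fls_le_iff)
    then show "\<exists>e>0. \<forall>y. dist y x < e \<longrightarrow> y \<in> U" by (intro exI[of _ "2 powi (- k)"]) auto
  qed
qed

lemma open_fls_ball: "open (fls_ball k :: 'a::ab_group_add fls set)"
  unfolding open_fls_iff
proof (intro ballI exI allI impI)
  fix x y :: "'a fls" assume "x \<in> fls_ball k" "y - x \<in> fls_ball k"
  from fls_ball_add[OF this(2,1)] show "y \<in> fls_ball k" by simp
qed

lemma closed_fls_ball: "closed (fls_ball k :: 'a::group_add fls set)"
  unfolding fls_ball_eq_cball by simp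

lemma tendsto_fls_iff:
  "(f \<longlongrightarrow> l) F \<longleftrightarrow> (\<forall>k. eventually (\<lambda>x. f x - l \<in> fls_ball k) F)"
  for l :: "'a::group_add fls"
proof
  assume *: "(f \<longlongrightarrow> l) F"
  show "\<forall>k. eventually (\<lambda>x. f x - l \<in> fls_ball k) F"
  proof
    fix k
    have "eventually (\<lambda>x. dist (f x) l < 2 powi (- k)) F" using * by (simp add: tendstoD)
    then show "eventually (\<lambda>x. f x - l \<in> fls_ball k) F"
      by eventually_elim (simp flip: dist_fls_le_iff)
  qed
next
  assume *: "\<forall>k. eventually (\<lambda>x. f x - l \<in> fls_ball k) F"
  show "(f \<longlongrightarrow> l) F"
  proof (rule tendstoI)
    fix e :: real assume "0 < e"
    then obtain k where k: "(2::real) powi (- k) < e" using ex_powi_less by blast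
    from *[rule_format, of k] show "eventually (\<lambda>x. dist (f x) l < e) F"
      by eventually_elim (use k in \<open>auto simp flip: dist_fls_le_iff\<close>)
  qed
qed

instance fls :: (ab_group_add) topological_ab_group_add
proof
  fix a b :: "'a fls"
  show "((\<lambda>x. fst x + snd x) \<longlongrightarrow> a + b) (nhds a \<times>\<^sub>F nhds b)"
    unfolding tendsto_fls_iff
  proof
    fix k
    have "eventually (\<lambda>x. x - a \<in> fls_ball k) (nhds a)" for a :: "'a fls"
      using filterlim_ident[of "nhds a"] unfolding tendsto_fls_iff by blast
    then have "eventually (\<lambda>x. fst x - a \<in> fls_ball k \<and> snd x - b \<in> fls_ball k) (nhds a \<times>\<^sub>F nhds b)"
      by (intro eventually_prodI)
    then show "eventually (\<lambda>x. fst x + snd x - (a + b) \<in> fls_ball k) (nhds a \<times>\<^sub>F nhds b)"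
    proof eventually_elim
      case (elim x)
      then show ?case using fls_ball_add[of "fst x - a" k "snd x - b"] by (simp add: algebra_simps)
    qed
  qed
  show "(uminus \<longlongrightarrow> - a) (nhds a)"
    unfolding tendsto_fls_iff
  proof
    fix k
    have "eventually (\<lambda>x. x - a \<in> fls_ball k) (nhds a)"
      using filterlim_ident[of "nhds a"] unfolding tendsto_fls_iff by blast
    then show "eventually (\<lambda>x. - x - - a \<in> fls_ball k) (nhds a)"
    proof eventually_elim
      case (elim x)
      then show ?case using fls_ball_uminus[of "x - a" k] by (simp add: algebra_simps)
    qed
  qed
qed

instance fls :: (idom) topological_semigroup_mult
proof
  fix a b :: "'a fls"
  show "((\<lambda>x. fst x * snd x) \<longlongrightarrow> a * b) (nhds a \<times>\<^sub>F nhds b)"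
    unfolding tendsto_fls_iff
  proof
    fix k
    obtain m where m: "a \<in> fls_ball m" using ex_fls_ball by blast
    obtain n where n: "b \<in> fls_ball n" using ex_fls_ball by blast
    \<comment> \<open>The first two bounds send \<open>a\<close> times a perturbation of
      \<open>b\<close>, and a perturbation of \<open>a\<close> times an element of
      \<open>fls_ball n\<close>, into \<open>fls_ball k\<close>; the third keeps the perturbed
      \<open>b\<close> inside \<open>fls_ball n\<close>.\<close>
    define K where "K = Max {k - m, k - n, n}"
    have K: "k \<le> K + m" "k \<le> K + n" "n \<le> K"
      using Max_ge[of "{k - m, k - n, n}"] by (auto simp: K_def algebra_simps)
    have "eventually (\<lambda>x. x - a \<in> fls_ball K) (nhds a)" for a :: "'a fls"
      using filterlim_ident[of "nhds a"] unfolding tendsto_fls_iff by blast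
    then have "eventually (\<lambda>x. fst x - a \<in> fls_ball K \<and> snd x - b \<in> fls_ball K) (nhds a \<times>\<^sub>F nhds b)"
      by (intro eventually_prodI)
    then show "eventually (\<lambda>x. fst x * snd x - a * b \<in> fls_ball k) (nhds a \<times>\<^sub>F nhds b)"
    proof eventually_elim
      case (elim x)
      have "snd x - b + b \<in> fls_ball n"
        using elim n K fls_ball_mono[of n K] by (blast intro: fls_ball_add)
      then have "snd x \<in> fls_ball n" by simp
      then have "(fst x - a) * snd x \<in> fls_ball k"
        using fls_ball_mult[of "fst x - a" K "snd x" n] elim K fls_ball_mono[of k "K + n"] by auto
      moreover have "a * (snd x - b) \<in> fls_ball k"
        using fls_ball_mult[of a m "snd x - b" K] m elim K fls_ball_mono[of k "m + K"] by auto
      ultimately have "(fst x - a) * snd x + a * (snd x - b) \<in> fls_ball k" by (rule fls_ball_add)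
      then show ?case by (simp add: algebra_simps)
    qed
  qed
qed

lemma fls_of_coeffs:
  fixes f :: "int \<Rightarrow> 'a::zero"
  assumes "\<And>j. j < k \<Longrightarrow> f j = 0"
  shows "\<exists>x. \<forall>j. x $$ j = f j"
proof -
  have "\<forall>\<^sub>\<infinity>n. f (- int n) = 0"
    unfolding MOST_nat by (rule exI[of _ "nat (- k)"]) (use assms in auto)
  then show ?thesis by (intro exI[of _ "Abs_fls f"]) simp
qed

lemma finite_fls_ball_truncated:
  "finite {x \<in> fls_ball k. \<forall>j\<ge>l. x $$ j = (0 :: 'a::{finite,zero})}" (is "finite ?A")
proof (rule finite_imageD)
  let ?r = "\<lambda>x :: 'a fls. restrict (fls_nth x) {k..<l}"
  have "?r ` ?A \<subseteq> {k..<l} \<rightarrow>\<^sub>E (UNIV :: 'a set)" by auto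
  then show "finite (?r ` ?A)" by (rule finite_subset) (auto intro!: finite_PiE)
  show "inj_on ?r ?A"
  proof (rule inj_onI)
    fix x y assume *: "x \<in> ?A" "y \<in> ?A" "?r x = ?r y"
    show "x = y"
    proof (rule fls_eqI)
      fix j show "x $$ j = y $$ j"
        using *(1,2) fun_cong[OF *(3), of j]
        by (cases "j < k"; cases "j < l") (auto simp: fls_ball_def)
    qed
  qed
qed

lemma fls_truncate:
  fixes x :: "'a::group_add fls"
  assumes "x \<in> fls_ball k"
  obtains y where "y \<in> fls_ball k" "\<forall>j\<ge>l. y $$ j = 0" "x - y \<in> fls_ball l"
proof -
  have "\<exists>y. \<forall>j. y $$ j = (if j < l then x $$ j else 0)"
    by (rule fls_of_coeffs[of k]) (use assms in \<open>auto simp: fls_ball_def\<close>)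
  then obtain y where y: "\<And>j. y $$ j = (if j < l then x $$ j else 0)" by blast
  then show ?thesis using assms by (intro that[of y]) (auto simp: fls_ball_def)
qed

text \<open>Each coefficient of a Cauchy sequence is eventually constant, which gives the limit.
  Truncation at \<open>t^l\<close> leaves only finitely many centres because the coefficients come
  from a finite group.\<close>

lemma compact_fls_ball: "compact (fls_ball k :: 'a::{finite,group_add} fls set)"
  unfolding compact_eq_totally_bounded
proof (intro conjI allI impI)
  show "complete (fls_ball k :: 'a fls set)"
  proof (rule completeI)
    fix f :: "nat \<Rightarrow> 'a fls"
    assume f: "\<forall>n. f n \<in> fls_ball k" "Cauchy f"
    have ex: "\<exists>M. \<forall>m\<ge>M. \<forall>n\<ge>M. f m - f n \<in> fls_ball j" for j
      using metric_CauchyD[OF f(2), of "2 powi (- j)"]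
      by (auto simp flip: dist_fls_le_iff intro: less_imp_le)
    then obtain M where M: "\<And>j m n. m \<ge> M j \<Longrightarrow> n \<ge> M j \<Longrightarrow> f m - f n \<in> fls_ball j" by metis
    \<comment> \<open>\<open>M (j + 1)\<close> and not \<open>M j\<close>:
      \<open>fls_ball (j + 1)\<close> controls the coefficients up to and including index
      \<open>j\<close>.\<close>
    obtain x where x: "\<And>j. x $$ j = f (M (j + 1)) $$ j"
      using fls_of_coeffs[of k "\<lambda>j. f (M (j + 1)) $$ j"] f(1) by (auto simp: fls_ball_def)
    have "x \<in> fls_ball k" using f(1) by (simp add: fls_ball_def x)
    moreover have "f \<longlonglongrightarrow> x" unfolding tendsto_fls_iff
    proof
      fix l
      have "f n - x \<in> fls_ball l" if "n \<ge> M l" for n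
      proof -
        have "f n $$ j = x $$ j" if "j < l" for j
        proof -
          let ?m = "max n (M (j + 1))"
          have "f n - f ?m \<in> fls_ball l" using M \<open>n \<ge> M l\<close> by simp
          moreover have "f ?m - f (M (j + 1)) \<in> fls_ball (j + 1)" using M by simp
          ultimately show ?thesis using \<open>j < l\<close> by (simp add: fls_ball_def x)
        qed
        then show ?thesis by (simp add: fls_ball_def)
      qed
      then show "eventually (\<lambda>n. f n - x \<in> fls_ball l) sequentially"
        by (auto simp: eventually_sequentially)
    qed
    ultimately show "\<exists>l\<in>fls_ball k. f \<longlonglongrightarrow> l" by blast
  qed
next
  fix e :: real assume "0 < e"
  then obtain l where l: "(2::real) powi (- l) < e" using ex_powi_less by blast
  let ?A = "{x \<in> fls_ball k. \<forall>j\<ge>l. x $$ j = (0 :: 'a)}"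
  have "fls_ball k \<subseteq> (\<Union>y\<in>?A. ball y e)"
  proof
    fix x :: "'a fls" assume "x \<in> fls_ball k"
    then obtain y where y: "y \<in> ?A" "x - y \<in> fls_ball l" by (rule fls_truncate) auto
    with l have "x \<in> ball y e" by (auto simp: dist_commute simp flip: dist_fls_le_iff)
    with y(1) show "x \<in> (\<Union>y\<in>?A. ball y e)" by blast
  qed
  with finite_fls_ball_truncated
  show "\<exists>A. finite A \<and> (fls_ball k :: 'a fls set) \<subseteq> (\<Union>y\<in>A. ball y e)" by blast
qed

lemma bounded_fls_iff: "bounded A \<longleftrightarrow> (\<exists>k. A \<subseteq> fls_ball k)"
  for A :: "'a::group_add fls set"
proof
  assume "bounded A"
  then obtain r where r: "\<forall>y\<in>A. dist 0 y \<le> r" unfolding bounded_any_center[where a = 0] by blast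
  obtain n where n: "r < 2 ^ n" using real_arch_pow[of 2 r] by auto
  have "cball (0 :: 'a fls) r \<subseteq> fls_ball (- int n)"
    unfolding fls_ball_eq_cball using n by (intro subset_cball) (auto simp: power_int_def)
  then show "\<exists>k. A \<subseteq> fls_ball k" using r by (auto simp: subset_iff)
next
  assume "\<exists>k. A \<subseteq> fls_ball k"
  then show "bounded A" unfolding fls_ball_eq_cball using bounded_subset bounded_cball by blast
qed

text \<open>Bounded sets lie in some compact \<open>fls_ball k\<close>. Passing to vectors and
  products, this makes closed balls of the Heisenberg group compact, hence the group locally
  compact.\<close>

instance fls :: ("{finite,group_add}") heine_borel
proof
  fix f :: "nat \<Rightarrow> 'a fls" assume "bounded (range f)"
  then obtain k where "range f \<subseteq> fls_ball k" unfolding bounded_fls_iff by blast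
  then show "\<exists>l r. strict_mono r \<and> (f \<circ> r) \<longlonglongrightarrow> l"
    using compact_fls_ball[of k, where 'a = 'a] unfolding compact_def by blast
qed

section \<open>Second countability\<close>

lemma separable_imp_countable_basis:
  fixes D :: "'a::metric_space set"
  assumes "countable D" and dense: "\<And>x e. 0 < e \<Longrightarrow> \<exists>d\<in>D. dist d x < e"
  shows "\<exists>B :: 'a set set. countable B \<and> open = generate_topology B"
proof -
  define B where "B = (\<lambda>(d, n). ball d (1 / real (Suc n))) ` (D \<times> (UNIV :: nat set))"
  have "countable B" unfolding B_def using assms(1) by (intro countable_image countable_SIGMA) auto
  moreover have "topological_basis B"
  proof (rule topological_basisI)
    show "open U" if "U \<in> B" for U using that by (auto simp: B_def)
    fix U and x :: 'a assume "open U" "x \<in> U"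
    then obtain e where e: "e > 0" "ball x e \<subseteq> U" using openE by blast
    obtain n where n: "1 / real (Suc n) < e / 2"
      using reals_Archimedean[of "e/2"] e(1) by (auto simp: inverse_eq_divide)
    obtain d where d: "d \<in> D" "dist d x < 1 / real (Suc n)" using dense[of "1 / real (Suc n)" x] by auto
    have "ball d (1 / real (Suc n)) \<subseteq> ball x e"
    proof
      fix y assume "y \<in> ball d (1 / real (Suc n))"
      then have "dist d y < e / 2" using n by simp
      moreover have "dist d x < e / 2" using d(2) n by simp
      ultimately have "dist x y < e" using dist_triangle_half_r by (auto simp: dist_commute)
      then show "y \<in> ball x e" by simp
    qed
    with d e show "\<exists>V\<in>B. x \<in> V \<and> V \<subseteq> U"
      by (intro bexI[of _ "ball d (1 / real (Suc n))"]) (auto simp: B_def)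
  qed
  ultimately show ?thesis using topological_basis_imp_subbasis by blast
qed

instance fls :: ("{finite,group_add}") second_countable_topology
proof
  \<comment> \<open>The Laurent polynomials.\<close>
  define D where "D = (\<Union>k. \<Union>l. {x \<in> fls_ball k. \<forall>j\<ge>l. x $$ j = (0 :: 'a)})"
  have "countable D" unfolding D_def
    by (intro countable_UN countableI_type countable_finite finite_fls_ball_truncated)
  moreover have "\<exists>d\<in>D. dist d x < e" if e: "0 < e" for x :: "'a fls" and e
  proof -
    obtain l where l: "(2::real) powi (- l) < e" using ex_powi_less[OF e] by blast
    obtain k where "x \<in> fls_ball k" using ex_fls_ball by blast
    then obtain y where "y \<in> fls_ball k" "\<forall>j\<ge>l. y $$ j = 0" "x - y \<in> fls_ball l"
      by (rule fls_truncate)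
    then show ?thesis using l
      by (intro bexI[of _ y]) (auto simp: D_def dist_commute simp flip: dist_fls_le_iff)
  qed
  ultimately show "\<exists>B :: 'a fls set set. countable B \<and> open = generate_topology B"
    by (rule separable_imp_countable_basis)
qed

instance vec :: ("{metric_space,second_countable_topology}", finite) second_countable_topology
proof
  obtain B :: "'a set set" where B: "countable B" "topological_basis B"
    using ex_countable_basis by blast
  define C where "C = (\<lambda>f. {x :: 'a ^ 'b. \<forall>i. x $ i \<in> f i}) ` (UNIV \<rightarrow>\<^sub>E B)"
  have "countable C" unfolding C_def
    by (intro countable_image countable_PiE) (use B in auto)
  moreover have "topological_basis C"
  proof (rule topological_basisI)
    show "open U" if "U \<in> C" for U
      using that B(2) by (auto simp: C_def intro!: open_vector_box topological_basis_open[OF B(2)])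
    fix U :: "('a ^ 'b) set" and x assume "open U" "x \<in> U"
    then obtain A where A: "\<And>i. open (A i)" "\<And>i. x $ i \<in> A i"
      "\<And>y. (\<And>i. y $ i \<in> A i) \<Longrightarrow> y \<in> U" unfolding open_vec_def by metis
    have "\<exists>V\<in>B. x $ i \<in> V \<and> V \<subseteq> A i" for i
      using topological_basisE[OF B(2) A(1) A(2)] by metis
    then obtain V where V: "\<And>i. V i \<in> B" "\<And>i. x $ i \<in> V i" "\<And>i. V i \<subseteq> A i" by metis
    then show "\<exists>W\<in>C. x \<in> W \<and> W \<subseteq> U"
      by (intro bexI[of _ "{x. \<forall>i. x $ i \<in> V i}"]) (use V(3) in \<open>auto simp: C_def subset_iff intro!: A(3) imageI\<close>)
  qed
  ultimately show "\<exists>C :: ('a ^ 'b) set set. countable C \<and> open = generate_topology C"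
    using topological_basis_imp_subbasis by blast
qed

section \<open>Characters of the local field\<close>

definition fls_char :: "('a::ab_group_add fls \<Rightarrow> complex) \<Rightarrow> bool" where
  "fls_char \<theta> \<longleftrightarrow> continuous_on UNIV \<theta> \<and> (\<forall>x. cmod (\<theta> x) = 1) \<and> (\<forall>x y. \<theta> (x + y) = \<theta> x * \<theta> y)"

lemma fls_charD:
  assumes "fls_char \<theta>"
  shows fls_char_cont: "continuous_on UNIV \<theta>" and fls_char_norm: "cmod (\<theta> x) = 1"
    and fls_char_add: "\<theta> (x + y) = \<theta> x * \<theta> y" and fls_char_nz: "\<theta> x \<noteq> 0"
  using assms unfolding fls_char_def by (auto, metis norm_zero zero_neq_one)

lemma fls_char_zero: "fls_char \<theta> \<Longrightarrow> \<theta> 0 = 1"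
  using fls_char_add[of \<theta> 0 0] fls_char_nz[of \<theta> 0] by simp

lemma fls_char_of_nat_mult:
  fixes \<theta> :: "'a::comm_ring_1 fls \<Rightarrow> complex"
  assumes "fls_char \<theta>"
  shows "\<theta> (of_nat n * x) = \<theta> x ^ n"
  by (induction n) (use assms in \<open>simp_all add: fls_char_zero fls_char_add distrib_right\<close>)

lemma of_nat_card_fls: "(of_nat CARD('p) :: 'p::prime_card mod_ring fls) = 0"
  by (simp add: fls_of_nat)

lemma fls_char_root:
  fixes \<theta> :: "'p::prime_card mod_ring fls \<Rightarrow> complex"
  assumes "fls_char \<theta>"
  shows "\<theta> x ^ CARD('p) = 1"
  using fls_char_of_nat_mult[OF assms, of "CARD('p)" x] by (simp add: of_nat_card_fls fls_char_zero assms)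

text \<open>In characteristic \<open>p\<close> the values are \<open>p\<close>-th roots of unity.
  These are finitely many, so continuity at 0 forces the value 1 on a whole ball.\<close>

lemma fls_char_trivial_on_ball:
  fixes \<theta> :: "'p::prime_card mod_ring fls \<Rightarrow> complex"
  assumes "fls_char \<theta>"
  obtains k where "\<And>x. x \<in> fls_ball k \<Longrightarrow> \<theta> x = 1"
proof -
  have "finite {z::complex. z ^ CARD('p) = 1}" by (rule finite_roots_unity) simp
  from finite_set_avoid[OF this, of 1]
  obtain d where d: "d > 0" "\<forall>z\<in>{z::complex. z ^ CARD('p) = 1}. z \<noteq> 1 \<longrightarrow> d \<le> dist 1 z" by auto
  have "open (\<theta> -` ball 1 d)"
    using fls_char_cont[OF assms] by (intro open_vimage) auto
  moreover have "0 \<in> \<theta> -` ball 1 d" using d(1) by (simp add: fls_char_zero[OF assms])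
  ultimately obtain k where k: "\<And>x. x \<in> fls_ball k \<Longrightarrow> \<theta> x \<in> ball 1 d"
    unfolding open_fls_iff by force
  have "\<theta> x = 1" if "x \<in> fls_ball k" for x
    using k[OF that] d(2) fls_char_root[OF assms, of x] by force
  then show ?thesis by (rule that)
qed

text \<open>No infinite sums are needed: splitting off the lowest monomial moves an element one ball
  closer to the ball on which the character is trivial, and this is reached after finitely many
  steps.\<close>

lemma fls_char_eq_1I:
  fixes \<theta> :: "'p::prime_card mod_ring fls \<Rightarrow> complex"
  assumes \<theta>: "fls_char \<theta>" and 1: "\<And>c k. \<theta> (fls_const c * fls_X_intpow k) = 1"
  shows "\<theta> x = 1"
proof -
  obtain M where M: "\<And>x. x \<in> fls_ball M \<Longrightarrow> \<theta> x = 1"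
    using fls_char_trivial_on_ball[OF \<theta>] by blast
  have *: "\<theta> x = 1" if "x \<in> fls_ball (M - int n)" for n x using that
  proof (induction n arbitrary: x)
    case (Suc n)
    let ?k = "M - int (Suc n)"
    let ?m = "fls_const (x $$ ?k) * fls_X_intpow ?k"
    have "(x - ?m) $$ j = 0" if "j < M - int n" for j
    proof (cases "j = ?k")
      case False
      with that have "j < ?k" by simp
      with Suc.prems show ?thesis by (simp add: fls_ball_def)
    qed simp
    then have "x - ?m \<in> fls_ball (M - int n)" unfolding fls_ball_def by blast
    then have "\<theta> (x - ?m) = 1" by (rule Suc.IH)
    with fls_char_add[OF \<theta>, of "x - ?m" ?m] 1[of "x $$ ?k" ?k] show ?case by simp
  qed (use M in simp)
  obtain k where "x \<in> fls_ball k" using ex_fls_ball by blast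
  then have "x \<in> fls_ball (M - int (nat (M - k)))"
    using fls_ball_mono[of "M - int (nat (M - k))" k] by auto
  then show ?thesis by (rule *)
qed

text \<open>The standard additive character of the prime field, exp(2 pi i a / p) for the
  representative of \<open>a\<close> in [0, p).\<close>

definition mod_ring_exp :: "'p::prime_card mod_ring \<Rightarrow> complex" where
  "mod_ring_exp a = cis (2 * pi / real CARD('p)) ^ nat (to_int_mod_ring a)"

lemma cis_card_power_mod:
  "cis (2 * pi / real CARD('p)) ^ (n mod CARD('p::prime_card)) = cis (2 * pi / real CARD('p)) ^ n"
proof -
  have "cis (2 * pi / real CARD('p)) ^ CARD('p) = 1" by (simp add: Complex.DeMoivre)
  then show ?thesis
    by (metis mod_mult_div_eq mult.right_neutral power_add power_mult power_one)
qed

lemma mod_ring_exp_add: "mod_ring_exp (a + b) = mod_ring_exp a * mod_ring_exp b"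
  for a b :: "'p::prime_card mod_ring"
proof -
  have nn: "0 \<le> to_int_mod_ring c" for c :: "'p mod_ring" by transfer auto
  have "nat (to_int_mod_ring (a + b)) = (nat (to_int_mod_ring a) + nat (to_int_mod_ring b)) mod CARD('p)"
    using nn[of a] nn[of b] by (simp add: to_int_mod_ring_add nat_mod_distrib nat_add_distrib)
  then show ?thesis by (simp add: mod_ring_exp_def cis_card_power_mod power_add)
qed

lemma mod_ring_exp_0 [simp]: "mod_ring_exp 0 = 1"
proof -
  have "to_int_mod_ring (0 :: 'a mod_ring) = 0" by transfer simp
  then show ?thesis by (simp add: mod_ring_exp_def)
qed

lemma norm_mod_ring_exp [simp]: "cmod (mod_ring_exp a) = 1"
  by (simp add: mod_ring_exp_def norm_power)

lemma mod_ring_exp_of_nat_mult: "mod_ring_exp (of_nat n * a) = mod_ring_exp a ^ n"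
  by (induction n) (simp_all add: mod_ring_exp_add distrib_right)

lemma ex_mod_ring_exp:
  assumes "z ^ CARD('p) = 1"
  shows "\<exists>a :: 'p::prime_card mod_ring. mod_ring_exp a = z"
proof -
  have "z \<in> (\<lambda>k. cis (2 * pi * real k / real CARD('p))) ` {..<CARD('p)}"
    using Complex.bij_betw_roots_unity[of "CARD('p)"] assms unfolding bij_betw_def by auto
  then obtain k where k: "k < CARD('p)" "z = cis (2 * pi * real k / real CARD('p))" by auto
  have "mod_ring_exp (of_int_mod_ring (int k) :: 'p mod_ring) = z"
    using k by (simp add: mod_ring_exp_def Complex.DeMoivre mult_ac)
  then show ?thesis ..
qed

text \<open>The reference character for self-duality: at \<open>\<xi> * t^k\<close> it sees exactly
  the coefficient of \<open>\<xi>\<close> at \<open>- 1 - k\<close>.\<close>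

definition residue_char :: "'p::prime_card mod_ring fls \<Rightarrow> complex" where
  "residue_char x = mod_ring_exp (x $$ (-1))"

lemma fls_char_mult_left:
  fixes \<theta> :: "'a::idom fls \<Rightarrow> complex"
  assumes "fls_char \<theta>"
  shows "fls_char (\<lambda>x. \<theta> (a * x))"
  unfolding fls_char_def
proof (intro conjI allI)
  have "continuous_on UNIV (\<lambda>x. a * x)" by (intro continuous_intros)
  then show "continuous_on UNIV (\<lambda>x. \<theta> (a * x))"
    using continuous_on_compose2[OF fls_char_cont[OF assms]] by blast
qed (use assms in \<open>auto simp: fls_charD distrib_left\<close>)

lemma fls_char_residue_char: "fls_char residue_char"
  unfolding fls_char_def
proof (intro conjI allI)
  show "continuous_on UNIV (residue_char :: 'p::prime_card mod_ring fls \<Rightarrow> complex)"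
    unfolding continuous_on_def
  proof
    fix x :: "'p mod_ring fls"
    have "eventually (\<lambda>y. y - x \<in> fls_ball 0) (at x)"
      using tendsto_ident_at[of x UNIV] unfolding tendsto_fls_iff by blast
    then have "eventually (\<lambda>y. residue_char y = residue_char x) (at x)"
      by eventually_elim (simp add: residue_char_def fls_ball_def)
    then show "(residue_char \<longlongrightarrow> residue_char x) (at x)" by (rule tendsto_eventually)
  qed
qed (simp_all add: residue_char_def mod_ring_exp_add)

lemma fls_char_divide:
  assumes "fls_char \<theta>" "fls_char \<psi>"
  shows "fls_char (\<lambda>x. \<theta> x / \<psi> x)"
  using assms by (auto simp: fls_char_def norm_divide intro!: continuous_on_divide) (metis norm_zero zero_neq_one)

text \<open>Self-duality: the coefficients of \<open>\<xi>\<close> are read off the values of the character at the powers of \<open>t\<close>.\<close>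

lemma fls_char_eq_residue_char:
  fixes \<theta> :: "'p::prime_card mod_ring fls \<Rightarrow> complex"
  assumes \<theta>: "fls_char \<theta>"
  obtains \<xi> where "\<And>x. \<theta> x = residue_char (\<xi> * x)"
proof -
  obtain M where M: "\<And>x. x \<in> fls_ball M \<Longrightarrow> \<theta> x = 1"
    using fls_char_trivial_on_ball[OF \<theta>] by blast
  \<comment> \<open>From \<open>M\<close> on the character is 1 at \<open>t^k\<close>, so 0 is a
    correct value there. Fixing it makes the reflected coefficients vanish below \<open>- M\<close>,
    as a Laurent series requires.\<close>
  define a :: "int \<Rightarrow> 'p mod_ring" where
    "a k = (if k < M then (SOME a. mod_ring_exp a = \<theta> (fls_X_intpow k)) else 0)" for k
  have a: "mod_ring_exp (a k) = \<theta> (fls_X_intpow k)" for k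
  proof (cases "k < M")
    case True
    then show ?thesis
      unfolding a_def using someI_ex[OF ex_mod_ring_exp[OF fls_char_root[OF \<theta>]]] by simp
  next
    case False
    then show ?thesis by (simp add: a_def M fls_ball_def)
  qed
  have "\<exists>\<xi>. \<forall>j. \<xi> $$ j = a (- 1 - j)"
    by (rule fls_of_coeffs[of "- M" "\<lambda>j. a (- 1 - j)"]) (simp add: a_def)
  then obtain \<xi> where \<xi>: "\<And>j. \<xi> $$ j = a (- 1 - j)" by blast
  have "\<theta> x / residue_char (\<xi> * x) = 1" for x
  proof (rule fls_char_eq_1I[of "\<lambda>x. \<theta> x / residue_char (\<xi> * x)"])
    show "fls_char (\<lambda>x. \<theta> x / residue_char (\<xi> * x))"
      by (intro fls_char_divide \<theta> fls_char_mult_left fls_char_residue_char)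
    fix c :: "'p mod_ring" and k
    \<comment> \<open>Every element of the prime field is a multiple of 1, so the value at
      \<open>t^k\<close> determines the value at \<open>c * t^k\<close>.\<close>
    obtain n where n: "c = of_nat n" using surj_of_nat_mod_ring by blast
    have "\<theta> (fls_const c * fls_X_intpow k) = mod_ring_exp (a k) ^ n"
      using fls_char_of_nat_mult[OF \<theta>, of n "fls_X_intpow k"] by (simp add: n fls_of_nat a)
    moreover have "(\<xi> * (fls_const c * fls_X_intpow k)) $$ (-1) = of_nat n * a k"
    proof -
      have "\<xi> * (fls_const c * fls_X_intpow k) = fls_const c * (\<xi> * fls_X_intpow k)"
        by (simp add: algebra_simps)
      then show ?thesis by (simp add: fls_X_intpow_times_conv_shift \<xi> n)
    qed
    ultimately show "\<theta> (fls_const c * fls_X_intpow k) / residue_char (\<xi> * (fls_const c * fls_X_intpow k)) = 1"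
      by (simp add: residue_char_def mod_ring_exp_of_nat_mult) (metis norm_mod_ring_exp norm_zero zero_neq_one)
  qed
  then show ?thesis using that[of \<xi>] by (metis divide_eq_1_iff)
qed

text \<open>Both characters are the residue character precomposed with a multiplication. The factor
  belonging to \<open>\<psi>\<close> is nonzero because \<open>\<psi>\<close> is nontrivial, so it
  can be divided out in the field.\<close>

lemma fls_char_self_dual:
  fixes \<theta> \<psi> :: "'p::prime_card mod_ring fls \<Rightarrow> complex"
  assumes "fls_char \<theta>" "fls_char \<psi>" "\<psi> z \<noteq> 1"
  obtains \<xi> where "\<And>x. \<theta> x = \<psi> (\<xi> * x)"
proof -
  obtain a b where a: "\<And>x. \<theta> x = residue_char (a * x)" and b: "\<And>x. \<psi> x = residue_char (b * x)"
    using fls_char_eq_residue_char assms(1,2) by metis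
  have "b \<noteq> 0" using assms(3) b[of z] by (auto simp: residue_char_def)
  then show ?thesis by (intro that[of "a / b"]) (simp add: a b)
qed

lemma dot_add_right: "dot x (y + z) = dot x y + dot x z"
  by (simp add: dot_def distrib_left sum.distrib)
lemma dot_add_left: "dot (x + y) z = dot x z + dot y z"
  by (simp add: dot_def distrib_right sum.distrib)
lemma dot_zero [simp]: "dot x 0 = 0" "dot 0 x = 0"
  by (simp_all add: dot_def)
lemma dot_minus [simp]: "dot x (- y) = - dot x y" "dot (- x) y = - dot x y"
  by (simp_all add: dot_def sum_negf)

lemma fls_vec_char_self_dual:
  fixes \<theta> :: "'p::prime_card mod_ring fls ^ 'n::finite \<Rightarrow> complex"
  assumes \<theta>: "continuous_on UNIV \<theta>" "\<And>x. cmod (\<theta> x) = 1" "\<And>x y. \<theta> (x + y) = \<theta> x * \<theta> y"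
    and \<psi>: "fls_char \<psi>" "\<psi> z \<noteq> 1"
  obtains \<xi> where "\<And>x. \<theta> x = \<psi> (dot \<xi> x)"
proof -
  have "fls_char (\<lambda>x. \<theta> (axis i x))" for i
    unfolding fls_char_def
  proof (intro conjI allI)
    have "continuous_on UNIV (\<lambda>x :: 'p mod_ring fls. axis i x :: _ ^ 'n)"
      unfolding axis_def
    proof (rule continuous_on_vec_lambda)
      show "continuous_on UNIV (\<lambda>x :: 'p mod_ring fls. if j = i then x else 0)" for j
        by (cases "j = i") auto
    qed
    then show "continuous_on UNIV (\<lambda>x. \<theta> (axis i x))"
      using continuous_on_compose2[OF \<theta>(1)] by blast
    show "\<theta> (axis i (x + y)) = \<theta> (axis i x) * \<theta> (axis i y)" for x y
    proof -
      have "axis i (x + y) = axis i x + axis i y" by (simp add: axis_def vec_eq_iff)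
      then show ?thesis by (simp add: \<theta>(3))
    qed
  qed (simp add: \<theta>(2))
  then have "\<forall>i. \<exists>a. \<forall>x. \<theta> (axis i x) = \<psi> (a * x)"
    using fls_char_self_dual[OF _ \<psi>] by metis
  then obtain a where a: "\<And>i x. \<theta> (axis i x) = \<psi> (a i * x)" by metis
  have \<theta>0: "\<theta> 0 = 1" using \<theta>(3)[of 0 0] \<theta>(2)[of 0] by auto
  have \<theta>sum: "\<theta> (sum f A) = (\<Prod>i\<in>A. \<theta> (f i))" for A :: "'n set" and f
    by (induction A rule: infinite_finite_induct) (auto simp: \<theta>0 \<theta>(3))
  have \<psi>sum: "\<psi> (sum f A) = (\<Prod>i\<in>A. \<psi> (f i))" for A :: "'n set" and f
    by (induction A rule: infinite_finite_induct) (auto simp: fls_char_zero fls_char_add \<psi>(1))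
  have "\<theta> x = \<psi> (dot (\<chi> i. a i) x)" for x
  proof -
    have "x = (\<Sum>i\<in>UNIV. axis i (x $ i))"
      by (simp add: vec_eq_iff axis_def if_distrib cong: if_cong)
    then have "\<theta> x = (\<Prod>i\<in>UNIV. \<theta> (axis i (x $ i)))" by (metis \<theta>sum)
    then show ?thesis by (simp add: dot_def \<psi>sum a)
  qed
  then show ?thesis by (rule that)
qed

section \<open>The Heisenberg group\<close>

lemma heis_simps [simp]:
  "carrier heisenberg = UNIV"
  "\<one>\<^bsub>heisenberg\<^esub> = (0, 0, 0)"
  "(a, b, c) \<otimes>\<^bsub>heisenberg\<^esub> (a', b', c') = (a + a', b + b', c + c' + dot a b')"
  by (simp_all add: heisenberg_def)

lemma group_heisenberg: "group heisenberg"
proof (rule groupI)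
  show "\<exists>y\<in>carrier heisenberg. y \<otimes>\<^bsub>heisenberg\<^esub> x = \<one>\<^bsub>heisenberg\<^esub>" for x :: "('p::prime_card, 'n::finite) heis"
  proof (cases x)
    case (fields a b c)
    then have "(- a, - b, dot a b - c) \<otimes>\<^bsub>heisenberg\<^esub> x = \<one>\<^bsub>heisenberg\<^esub>" by simp
    then show ?thesis by (metis UNIV_I heis_simps(1))
  qed
qed (auto simp: dot_add_left dot_add_right algebra_simps)

lemma inv_heis [simp]: "inv\<^bsub>heisenberg\<^esub> (a, b, c) = (- a, - b, dot a b - c)"
proof -
  interpret group heisenberg by (rule group_heisenberg)
  show ?thesis by (rule inv_equality) auto
qed

section \<open>Orbits of characters of N\<close>

lemma heis_N_iff: "x \<in> heis_N \<longleftrightarrow> fst x = 0"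
  by (cases x) (auto simp: heis_N_def)

text \<open>The coordinates \<open>b\<close> and \<open>c\<close> drop out because
  \<open>(0, b, c)\<close> lies in the abelian group \<open>N\<close>; this is why the whole group
  and \<open>A\<close> have the same orbits.\<close>

lemma conj_act_heis:
  "conj_act heisenberg heis_N (a, b, c) \<phi> = (\<lambda>(u, v, z)\<in>heis_N. \<phi> (u, v, z + dot a v))"
  by (rule ext) (auto simp: conj_act_def restrict_def heis_N_iff algebra_simps)

lemma dual_orbit_heis_A:
  "dual_orbit heisenberg heis_N heis_A \<phi> = range (\<lambda>a. \<lambda>(u, v, z)\<in>heis_N. \<phi> (u, v, z + dot a v))"
  by (auto simp: dual_orbit_def heis_A_def conj_act_heis image_iff)

lemma dual_orbit_heis:
  "dual_orbit heisenberg heis_N (carrier heisenberg) \<phi> = dual_orbit heisenberg heis_N heis_A \<phi>"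
  unfolding dual_orbit_heis_A
  by (auto simp: dual_orbit_def conj_act_heis image_iff)

definition heis_dual :: "(('p::prime_card, 'n::finite) heis \<Rightarrow> complex) set" where
  "heis_dual = pontryagin_dual (heisenberg\<lparr>carrier := heis_N\<rparr>) (subtopology euclidean heis_N)"

lemma topspace_dual_topology: "topspace (dual_topology G T) = pontryagin_dual G T"
  unfolding dual_topology_def topology_generated_by_topspace by (auto intro!: exI[of _ "{}"])

text \<open>Singletons are compact, so point evaluations are continuous for the compact-open
  topology. The closed sets below are intersections of their fibres.\<close>

lemma openin_dual_topology_eval:
  assumes "x \<in> topspace T" "open U"
  shows "openin (dual_topology G T) {\<phi> \<in> pontryagin_dual G T. \<phi> x \<in> U}"
  unfolding dual_topology_def
proof (rule topology_generated_by_Basis)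
  show "{\<phi> \<in> pontryagin_dual G T. \<phi> x \<in> U}
    \<in> {{\<phi> \<in> pontryagin_dual G T. \<phi> ` K \<subseteq> U} |K U. compactin T K \<and> open U}"
    using assms by (intro CollectI exI[of _ "{x}"] exI[of _ U]) auto
qed

lemma closedin_dual_topology_eval:
  assumes "x \<in> topspace T"
  shows "closedin (dual_topology G T) {\<phi> \<in> pontryagin_dual G T. \<phi> x = c}"
proof -
  have "topspace (dual_topology G T) - {\<phi> \<in> pontryagin_dual G T. \<phi> x = c}
      = {\<phi> \<in> pontryagin_dual G T. \<phi> x \<in> - {c}}"
    by (auto simp: topspace_dual_topology)
  then show ?thesis
    unfolding closedin_def using openin_dual_topology_eval[OF assms, of "- {c}" G]
    by (auto simp: topspace_dual_topology)
qed

lemma closedin_dual_topology_evals: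
  assumes "A \<subseteq> topspace T"
  shows "closedin (dual_topology G T) {\<phi> \<in> pontryagin_dual G T. \<forall>x\<in>A. \<phi> x = f x}"
proof (cases "A = {}")
  case True
  then show ?thesis using closedin_topspace[of "dual_topology G T"] by (simp add: topspace_dual_topology)
next
  case False
  then have "{\<phi> \<in> pontryagin_dual G T. \<forall>x\<in>A. \<phi> x = f x}
      = (\<Inter>x\<in>A. {\<phi> \<in> pontryagin_dual G T. \<phi> x = f x})" by auto
  then show ?thesis
    using False assms closedin_dual_topology_eval[of _ T G] by (auto intro!: closedin_INT)
qed

lemma heis_dual_iff:
  "\<phi> \<in> heis_dual \<longleftrightarrow> \<phi> \<in> extensional heis_N \<and> continuous_on heis_N \<phi> \<and>
    (\<forall>x\<in>heis_N. cmod (\<phi> x) = 1) \<and> (\<forall>v z v' z'. \<phi> (0, v + v', z + z') = \<phi> (0, v, z) * \<phi> (0, v', z'))"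
proof -
  have "(\<forall>x\<in>heis_N. \<forall>y\<in>heis_N. \<phi> (x \<otimes>\<^bsub>heisenberg\<^esub> y) = \<phi> x * \<phi> y) \<longleftrightarrow>
    (\<forall>v z v' z'. \<phi> (0, v + v', z + z') = \<phi> (0, v, z) * \<phi> (0, v', z'))"
    unfolding heis_N_def by force
  then show ?thesis unfolding heis_dual_def pontryagin_dual_def by auto
qed

lemma heis_dualD:
  assumes "\<phi> \<in> heis_dual"
  shows "fls_char (\<lambda>z. \<phi> (0, 0, z))" "continuous_on UNIV (\<lambda>v. \<phi> (0, v, 0))"
    "cmod (\<phi> (0, v, z)) = 1" "\<phi> (0, v, z) = \<phi> (0, v, 0) * \<phi> (0, 0, z)"
    "\<phi> (0, v + v', z + z') = \<phi> (0, v, z) * \<phi> (0, v', z')"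
proof -
  have c: "continuous_on heis_N \<phi>" using assms by (simp add: heis_dual_iff)
  show *: "\<phi> (0, v + v', z + z') = \<phi> (0, v, z) * \<phi> (0, v', z')" for v v' z z'
    using assms by (simp add: heis_dual_iff)
  show n: "cmod (\<phi> (0, v, z)) = 1" for v z
    using assms by (simp add: heis_dual_iff heis_N_iff)
  show "\<phi> (0, v, z) = \<phi> (0, v, 0) * \<phi> (0, 0, z)" using *[of v 0 0 z] by simp
  show "continuous_on UNIV (\<lambda>v. \<phi> (0, v, 0))"
    by (rule continuous_on_compose2[OF c]) (auto simp: heis_N_iff intro!: continuous_intros)
  have "continuous_on UNIV (\<lambda>z. \<phi> (0, 0, z))"
    by (rule continuous_on_compose2[OF c]) (auto simp: heis_N_iff intro!: continuous_intros)
  then show "fls_char (\<lambda>z. \<phi> (0, 0, z))"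
    using n *[of 0 0] by (simp add: fls_char_def)
qed

lemma heis_dual_eqI:
  assumes "\<phi> \<in> heis_dual" "\<phi>' \<in> heis_dual" "\<And>v z. \<phi> (0, v, z) = \<phi>' (0, v, z)"
  shows "\<phi> = \<phi>'"
proof (rule extensionalityI)
  show "\<phi> x = \<phi>' x" if "x \<in> heis_N" for x
    using that assms(3) by (cases x) (auto simp: heis_N_iff)
qed (use assms in \<open>auto simp: heis_dual_iff\<close>)

lemma continuous_on_dot [continuous_intros]:
  fixes f g :: "'c::topological_space \<Rightarrow> 'a::idom fls ^ 'n::finite"
  assumes "continuous_on S f" "continuous_on S g"
  shows "continuous_on S (\<lambda>x. dot (f x) (g x))"
  unfolding dot_def by (intro continuous_on_sum continuous_on_mult' continuous_on_component assms)

lemma heis_orbit_in_dual: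
  fixes \<phi> :: "('p::prime_card, 'n::finite) heis \<Rightarrow> complex"
  assumes "\<phi> \<in> heis_dual"
  shows "(\<lambda>(u, v, z)\<in>heis_N. \<phi> (u, v, z + dot a v)) \<in> heis_dual" (is "?\<phi> \<in> _")
proof -
  have "continuous_on heis_N (\<lambda>x. \<phi> (fst x, fst (snd x), snd (snd x) + dot a (fst (snd x))))"
    by (rule continuous_on_compose2[of heis_N \<phi>])
      (use assms in \<open>auto simp: heis_dual_iff heis_N_iff intro!: continuous_intros\<close>)
  then have "continuous_on heis_N ?\<phi>"
    by (rule continuous_on_eq) (auto simp: heis_N_iff)
  moreover have "\<phi> (0, v + v', z + z' + dot a (v + v')) = \<phi> (0, v, z + dot a v) * \<phi> (0, v', z' + dot a v')" for z z' v v'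
    using heis_dualD(5)[OF assms, of v v' "z + dot a v" "z' + dot a v'"]
    by (simp add: dot_add_right algebra_simps)
  ultimately show ?thesis
    using heis_dualD(3)[OF assms] unfolding heis_dual_iff by (auto simp: heis_N_iff)
qed

lemma heis_orbit_trivial:
  assumes "\<phi> \<in> heis_dual" "\<And>z. \<phi> (0, 0, z) = 1"
  shows "dual_orbit heisenberg heis_N heis_A \<phi> = {\<phi>}"
proof -
  have "\<phi> (0, v, z) = \<phi> (0, v, 0)" for v z
    using heis_dualD(4)[OF assms(1), of v z] assms(2)[of z] by simp
  then have "\<phi> (0, v, z) = \<phi> (0, v, z')" for v z z' by metis
  then have "(\<lambda>(u, v, z)\<in>heis_N. \<phi> (u, v, z + dot a v)) = \<phi>" for a
    by (intro heis_dual_eqI[OF heis_orbit_in_dual[OF assms(1)] assms(1)]) (simp add: heis_N_iff)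
  then show ?thesis unfolding dual_orbit_heis_A by auto
qed

lemma heis_orbit_nontrivial:
  fixes \<phi> :: "('p::prime_card, 'n::finite) heis \<Rightarrow> complex"
  assumes \<phi>: "\<phi> \<in> heis_dual" and nt: "\<phi> (0, 0, z0) \<noteq> 1"
  shows "dual_orbit heisenberg heis_N heis_A \<phi> = {\<phi>' \<in> heis_dual. \<forall>z. \<phi>' (0, 0, z) = \<phi> (0, 0, z)}"
proof (intro equalityI subsetI)
  fix \<phi>' assume "\<phi>' \<in> dual_orbit heisenberg heis_N heis_A \<phi>"
  then show "\<phi>' \<in> {\<phi>' \<in> heis_dual. \<forall>z. \<phi>' (0, 0, z) = \<phi> (0, 0, z)}"
    unfolding dual_orbit_heis_A using heis_orbit_in_dual[OF \<phi>] by (auto simp: heis_N_iff)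
next
  fix \<phi>' :: "('p, 'n) heis \<Rightarrow> complex"
  assume "\<phi>' \<in> {\<phi>' \<in> heis_dual. \<forall>z. \<phi>' (0, 0, z) = \<phi> (0, 0, z)}"
  then have \<phi>': "\<phi>' \<in> heis_dual" and eq: "\<And>z. \<phi>' (0, 0, z) = \<phi> (0, 0, z)" by auto
  have nz: "\<phi> (0, v, z) \<noteq> 0" for v z using heis_dualD(3)[OF \<phi>, of v z] by auto
  \<comment> \<open>The quotient of the two characters in the coordinate \<open>v\<close> is a
    character of F^n. Self-duality relative to the central character of \<open>\<phi>\<close> turns
    it into a shift of \<open>z\<close> by \<open>dot \<xi> v\<close>, which is the action of
    \<open>\<xi>\<close>.\<close>
  obtain \<xi> :: "'p mod_ring fls ^ 'n" where \<xi>: "\<And>v. \<phi>' (0, v, 0) / \<phi> (0, v, 0) = \<phi> (0, 0, dot \<xi> v)"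
  proof (rule fls_vec_char_self_dual[of "\<lambda>v. \<phi>' (0, v, 0) / \<phi> (0, v, 0)" "\<lambda>z. \<phi> (0, 0, z)" z0])
    show "continuous_on UNIV (\<lambda>v. \<phi>' (0, v, 0) / \<phi> (0, v, 0))"
      by (intro continuous_on_divide heis_dualD(2) \<phi> \<phi>') (use nz in auto)
    show "\<phi>' (0, x + y, 0) / \<phi> (0, x + y, 0) = \<phi>' (0, x, 0) / \<phi> (0, x, 0) * (\<phi>' (0, y, 0) / \<phi> (0, y, 0))" for x y
      using heis_dualD(5)[OF \<phi>, of x y 0 0] heis_dualD(5)[OF \<phi>', of x y 0 0] by simp
    show "cmod (\<phi>' (0, x, 0) / \<phi> (0, x, 0)) = 1" for x
      by (simp add: norm_divide heis_dualD(3) \<phi> \<phi>')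
  qed (use nt heis_dualD(1)[OF \<phi>] in blast)+
  have "\<phi>' = (\<lambda>(u, v, z)\<in>heis_N. \<phi> (u, v, z + dot \<xi> v))"
  proof (rule heis_dual_eqI[OF \<phi>' heis_orbit_in_dual[OF \<phi>]])
    fix v z
    have "\<phi>' (0, v, z) = \<phi>' (0, v, 0) * \<phi> (0, 0, z)" using heis_dualD(4)[OF \<phi>', of v z] eq by simp
    also have "\<phi>' (0, v, 0) = \<phi> (0, 0, dot \<xi> v) * \<phi> (0, v, 0)" using \<xi>[of v] nz by (simp add: field_simps)
    also have "\<phi> (0, 0, dot \<xi> v) * \<phi> (0, v, 0) * \<phi> (0, 0, z) = \<phi> (0, v, z + dot \<xi> v)"
      using heis_dualD(5)[OF \<phi>, of v 0 z "dot \<xi> v"] heis_dualD(4)[OF \<phi>, of v z] by simp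
    finally show "\<phi>' (0, v, z) = (\<lambda>(u, v, z)\<in>heis_N. \<phi> (u, v, z + dot \<xi> v)) (0, v, z)"
      by (simp add: heis_N_iff)
  qed
  then show "\<phi>' \<in> dual_orbit heisenberg heis_N heis_A \<phi>"
    unfolding dual_orbit_heis_A by blast
qed

lemma subgroup_dual_heis:
  "subgroup_dual heisenberg euclidean heis_N
     = dual_topology (heisenberg\<lparr>carrier := heis_N\<rparr>) (subtopology euclidean heis_N)"
  by (simp add: subgroup_dual_def)

lemma topspace_heis_dual: "topspace (subgroup_dual heisenberg euclidean heis_N) = heis_dual"
  by (simp add: subgroup_dual_heis topspace_dual_topology heis_dual_def)

lemma closedin_heis_dual_evals:
  assumes "A \<subseteq> heis_N"
  shows "closedin (subgroup_dual heisenberg euclidean heis_N) {\<phi> \<in> heis_dual. \<forall>x\<in>A. \<phi> x = f x}"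
  unfolding subgroup_dual_heis heis_dual_def
  by (rule closedin_dual_topology_evals) (use assms in auto)

lemma closedin_heis_orbit:
  assumes \<phi>: "\<phi> \<in> heis_dual"
  shows "closedin (subgroup_dual heisenberg euclidean heis_N) (dual_orbit heisenberg heis_N heis_A \<phi>)"
proof (cases "\<forall>z. \<phi> (0, 0, z) = 1")
  case True
  have "{\<phi>} = {\<phi>' \<in> heis_dual. \<forall>x\<in>heis_N. \<phi>' x = \<phi> x}"
    using \<phi> heis_dual_eqI[OF _ \<phi>] by (auto simp: heis_N_iff)
  with True show ?thesis
    using closedin_heis_dual_evals[of heis_N \<phi>] by (simp add: heis_orbit_trivial[OF \<phi>])
next
  case False
  then obtain z0 where "\<phi> (0, 0, z0) \<noteq> 1" by blast
  then have "dual_orbit heisenberg heis_N heis_A \<phi>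
      = {\<phi>' \<in> heis_dual. \<forall>x\<in>range (\<lambda>z. (0, 0, z)). \<phi>' x = \<phi> x}"
    by (simp add: heis_orbit_nontrivial[OF \<phi>])
  then show ?thesis
    using closedin_heis_dual_evals[of "range (\<lambda>z. (0, 0, z))" \<phi>] by (simp add: heis_N_iff image_subset_iff)
qed

section \<open>Separation of the orbits by countably many Borel sets\<close>

lemma closedin_borel_of: "closedin X S \<Longrightarrow> S \<in> sets (borel_of X)"
proof -
  assume S: "closedin X S"
  have "topspace X - (topspace X - S) \<in> sets (borel_of X)"
  proof -
    have sub: "{U. openin X U} \<subseteq> Pow (topspace X)" by (auto dest: openin_subset)
    have "topspace X - S \<in> sets (borel_of X)"
      using S sub by (simp add: borel_of_def closedin_def sets_measure_of)
    from sets.compl_sets[OF this] show ?thesis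
      using sub by (simp add: borel_of_def space_measure_of)
  qed
  moreover have "topspace X - (topspace X - S) = S" using closedin_subset[OF S] by auto
  ultimately show ?thesis by simp
qed

lemma continuous_eq_on_dense:
  fixes f g :: "'a::topological_space \<Rightarrow> complex"
  assumes "continuous_on UNIV f" "continuous_on UNIV g" "closure D = UNIV" "\<And>d. d \<in> D \<Longrightarrow> f d = g d"
  shows "f = g"
proof -
  have "closed {x. f x = g x}" using assms(1,2) by (intro closed_Collect_eq)
  moreover have "D \<subseteq> {x. f x = g x}" using assms(4) by auto
  ultimately have "closure D \<subseteq> {x. f x = g x}" by (intro closure_minimal)
  then show ?thesis using assms(3) by auto
qed

lemma ex_countable_dense:
  obtains D :: "'a::{second_countable_topology} set" where "countable D" "closure D = UNIV"
proof -
  obtain D :: "'a set" where D: "countable D" "\<And>X. open X \<Longrightarrow> X \<noteq> {} \<Longrightarrow> \<exists>d\<in>D. d \<in> X"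
    using countable_dense_exists by blast
  have "closure D = UNIV"
    using D(2) by (auto simp: closure_iff_nhds_not_empty) blast
  with D(1) show ?thesis by (rule that)
qed

lemma regularly_embedded_heis_N:
  "regularly_embedded (heisenberg :: ('p::prime_card, 'n::finite) heis monoid) euclidean heis_N"
proof -
  let ?H = "heisenberg :: ('p, 'n) heis monoid"
  let ?O = "dual_orbit ?H heis_N heis_A"
  obtain D :: "'p mod_ring fls set" where D: "countable D" "closure D = UNIV" by (rule ex_countable_dense)
  obtain E :: "('p mod_ring fls ^ 'n) set" where E: "countable E" "closure E = UNIV" by (rule ex_countable_dense)
  \<comment> \<open>Characters of \<open>N\<close> take only these finitely many values, so
    prescribing values at countably many points gives a countable family.\<close>
  define R where "R = {z :: complex. z ^ CARD('p) = 1}"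
  have R: "countable R" unfolding R_def by (intro countable_finite finite_roots_unity) simp
  \<comment> \<open>\<open>P\<close> separates the central restrictions, which determine the orbits
    that are not points. \<open>Q\<close> separates the point orbits; its condition on the centre is
    needed because evaluation at \<open>(0, e, 0)\<close> need not be constant along an orbit
    otherwise.\<close>
  define P where "P = (\<lambda>(d, r). ?O ` {\<phi> \<in> heis_dual. \<phi> (0, 0, d) = r}) ` (D \<times> R)"
  define Q where "Q = (\<lambda>(e, c). ?O ` {\<phi> \<in> heis_dual. (\<forall>z. \<phi> (0, 0, z) = 1) \<and> \<phi> (0, e, 0) = c}) ` (E \<times> R)"
  have orb_self: "\<phi> \<in> ?O \<phi>" if "\<phi> \<in> heis_dual" for \<phi>
    using that heis_orbit_trivial[OF that] heis_orbit_nontrivial[OF that]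
    by (cases "\<forall>z. \<phi> (0, 0, z) = 1") auto
  have orb_z: "\<phi>' (0, 0, z) = \<phi> (0, 0, z)" if "\<phi> \<in> heis_dual" "\<phi>' \<in> heis_dual" "?O \<phi> = ?O \<phi>'" for \<phi> \<phi>' z
  proof -
    have "\<phi>' \<in> ?O \<phi>" using that orb_self by auto
    then show ?thesis
      using heis_orbit_trivial[OF that(1)] heis_orbit_nontrivial[OF that(1)]
      by (cases "\<forall>z. \<phi> (0, 0, z) = 1") auto
  qed
  have orb_triv: "\<phi>' = \<phi>" if "\<phi> \<in> heis_dual" "\<phi>' \<in> heis_dual" "?O \<phi> = ?O \<phi>'" "\<forall>z. \<phi> (0, 0, z) = 1" for \<phi> \<phi>'
    using orb_self[OF that(2)] heis_orbit_trivial[OF that(1)] that by auto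
  have root_v: "\<phi> (0, e, 0) \<in> R" if \<phi>: "\<phi> \<in> heis_dual" for \<phi> :: "('p, 'n) heis \<Rightarrow> complex" and e
  proof -
    have "\<phi> (0, \<chi> i. of_nat n * e $ i, 0) = \<phi> (0, e, 0) ^ n" for n
    proof (induction n)
      case 0
      have "\<phi> (0, 0, 0) = 1" using fls_char_zero[OF heis_dualD(1)[OF \<phi>]] by simp
      moreover have "(\<chi> i. of_nat 0 * e $ i) = 0" by (simp add: vec_eq_iff)
      ultimately show ?case by simp
    next
      case (Suc n)
      have "(\<chi> i. of_nat (Suc n) * e $ i) = e + (\<chi> i. of_nat n * e $ i)"
        by (simp add: vec_eq_iff distrib_right)
      then show ?case using heis_dualD(5)[OF \<phi>, of e "\<chi> i. of_nat n * e $ i" 0 0] Suc by simp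
    qed
    from this[of "CARD('p)"] have "\<phi> (0, e, 0) ^ CARD('p) = \<phi> (0, \<chi> i. 0 * e $ i, 0)"
      unfolding of_nat_card_fls by (rule sym)
    also have "(\<chi> i. 0 * e $ i) = 0" by (simp add: vec_eq_iff)
    finally show ?thesis using fls_char_zero[OF heis_dualD(1)[OF \<phi>]] by (simp add: R_def)
  qed
  have sub: "P \<union> Q \<subseteq> quotient_borel_sets ?H euclidean heis_N"
  proof (intro Un_least subsetI)
    fix U assume "U \<in> P"
    then obtain d r where U: "U = ?O ` {\<phi> \<in> heis_dual. \<phi> (0, 0, d) = r}" by (auto simp: P_def)
    have "{\<phi> \<in> heis_dual. ?O \<phi> \<in> U} = {\<phi> \<in> heis_dual. \<forall>x\<in>{(0, 0, d)}. \<phi> x = r}"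
      unfolding U using orb_z by (auto simp: image_iff)
    moreover have "{\<phi> \<in> heis_dual. \<forall>x\<in>{(0, 0, d)}. \<phi> x = r} \<in> sets (borel_of (subgroup_dual ?H euclidean heis_N))"
      by (intro closedin_borel_of closedin_heis_dual_evals) (auto simp: heis_N_iff)
    ultimately show "U \<in> quotient_borel_sets ?H euclidean heis_N"
      using U by (auto simp: quotient_borel_sets_def dual_orbit_space_def topspace_heis_dual dual_orbit_heis
          simp del: heis_simps(1))
  next
    fix U assume "U \<in> Q"
    then obtain e c where U: "U = ?O ` {\<phi> \<in> heis_dual. (\<forall>z. \<phi> (0, 0, z) = 1) \<and> \<phi> (0, e, 0) = c}"
      by (auto simp: Q_def)
    \<comment> \<open>For \<open>e = 0\<close> the point \<open>(0, e, 0)\<close> is central and the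
      conditional prescribes \<open>c\<close> there; the second set restores the requirement that
      the value be 1.\<close>
    have "{\<phi> \<in> heis_dual. ?O \<phi> \<in> U}
        = {\<phi> \<in> heis_dual. \<forall>x\<in>insert (0, e, 0) (range (\<lambda>z. (0, 0, z))). \<phi> x = (if x = (0, e, 0) then c else 1)}
        \<inter> {\<phi> \<in> heis_dual. \<forall>x\<in>range (\<lambda>z. (0, 0, z)). \<phi> x = 1}" (is "?L = ?M")
    proof (intro equalityI subsetI)
      fix \<phi> assume "\<phi> \<in> ?L"
      then obtain \<phi>' where *: "\<phi> \<in> heis_dual" "\<phi>' \<in> heis_dual" "?O \<phi>' = ?O \<phi>" "\<forall>z. \<phi>' (0, 0, z) = 1" "\<phi>' (0, e, 0) = c"
        unfolding U by auto
      then have "\<phi> = \<phi>'" using orb_triv by blast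
      with * show "\<phi> \<in> ?M" by auto
    next
      fix \<phi> assume "\<phi> \<in> ?M"
      then show "\<phi> \<in> ?L" unfolding U by auto
    qed
    moreover have "?M \<in> sets (borel_of (subgroup_dual ?H euclidean heis_N))"
      by (intro sets.Int closedin_borel_of closedin_heis_dual_evals) (auto simp: heis_N_iff)
    ultimately show "U \<in> quotient_borel_sets ?H euclidean heis_N"
      using U by (auto simp: quotient_borel_sets_def dual_orbit_space_def topspace_heis_dual dual_orbit_heis
          simp del: heis_simps(1))
  qed
  have sep: "dual_orbit_space ?H euclidean heis_N \<inter> \<Inter>{U \<in> P \<union> Q. X \<in> U} = {X}"
    if X: "X \<in> dual_orbit_space ?H euclidean heis_N" for X
  proof -
    obtain \<phi> where \<phi>: "\<phi> \<in> heis_dual" "X = ?O \<phi>"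
      using X by (auto simp: dual_orbit_space_def topspace_heis_dual dual_orbit_heis simp del: heis_simps(1))
    have "Y = X" if Y: "Y \<in> dual_orbit_space ?H euclidean heis_N" "\<And>U. U \<in> P \<union> Q \<Longrightarrow> X \<in> U \<Longrightarrow> Y \<in> U" for Y
    proof -
      obtain \<phi>' where \<phi>': "\<phi>' \<in> heis_dual" "Y = ?O \<phi>'"
        using Y(1) by (auto simp: dual_orbit_space_def topspace_heis_dual dual_orbit_heis simp del: heis_simps(1))
      have "\<phi>' (0, 0, d) = \<phi> (0, 0, d)" if "d \<in> D" for d
      proof -
        let ?U = "?O ` {\<phi>' \<in> heis_dual. \<phi>' (0, 0, d) = \<phi> (0, 0, d)}"
        have "\<phi> (0, 0, d) \<in> R" using fls_char_root[OF heis_dualD(1)[OF \<phi>(1)]] by (simp add: R_def)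
        then have "?U \<in> P" unfolding P_def using \<open>d \<in> D\<close> by (intro image_eqI[of _ _ "(d, \<phi> (0, 0, d))"]) auto
        then have "Y \<in> ?U" using Y(2)[of ?U] \<phi> by auto
        then obtain \<phi>2 where "\<phi>2 \<in> heis_dual" "?O \<phi>' = ?O \<phi>2" "\<phi>2 (0, 0, d) = \<phi> (0, 0, d)"
          using \<phi>' by auto
        then show ?thesis using orb_z[OF \<phi>'(1)] by metis
      qed
      then have "(\<lambda>z. \<phi>' (0, 0, z)) = (\<lambda>z. \<phi> (0, 0, z))"
        by (intro continuous_eq_on_dense[OF _ _ D(2)] fls_char_cont heis_dualD(1) \<phi> \<phi>')
      then have z: "\<phi>' (0, 0, z) = \<phi> (0, 0, z)" for z by metis
      show "Y = X"
      proof (cases "\<forall>z. \<phi> (0, 0, z) = 1")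
        case False
        then obtain z0 where "\<phi> (0, 0, z0) \<noteq> 1" by blast
        with z show ?thesis
          by (simp add: \<phi>(2) \<phi>'(2) heis_orbit_nontrivial[OF \<phi>(1), of z0] heis_orbit_nontrivial[OF \<phi>'(1), of z0])
      next
        case True
        have "\<phi>' (0, e, 0) = \<phi> (0, e, 0)" if "e \<in> E" for e
        proof -
          let ?U = "?O ` {\<phi>' \<in> heis_dual. (\<forall>z. \<phi>' (0, 0, z) = 1) \<and> \<phi>' (0, e, 0) = \<phi> (0, e, 0)}"
          have "?U \<in> Q" unfolding Q_def using \<open>e \<in> E\<close> root_v[OF \<phi>(1)]
            by (intro image_eqI[of _ _ "(e, \<phi> (0, e, 0))"]) auto
          then have "Y \<in> ?U" using Y(2)[of ?U] \<phi> True by auto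
          then obtain \<phi>2 where "\<phi>2 \<in> heis_dual" "?O \<phi>' = ?O \<phi>2" "\<phi>2 (0, e, 0) = \<phi> (0, e, 0)"
            using \<phi>' by auto
          then show ?thesis using orb_triv[OF \<phi>'(1)] True z by metis
        qed
        then have "(\<lambda>v. \<phi>' (0, v, 0)) = (\<lambda>v. \<phi> (0, v, 0))"
          by (intro continuous_eq_on_dense[OF _ _ E(2)] heis_dualD(2) \<phi> \<phi>')
        then have "\<phi>' (0, v, 0) = \<phi> (0, v, 0)" for v by metis
        then have "\<phi>' = \<phi>"
          using heis_dualD(4)[OF \<phi>(1)] heis_dualD(4)[OF \<phi>'(1)] z by (intro heis_dual_eqI \<phi> \<phi>') metis
        then show ?thesis by (simp add: \<phi> \<phi>')
      qed
    qed
    with X show ?thesis by auto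
  qed
  have "countable (P \<union> Q)" unfolding P_def Q_def by (intro countable_Un countable_image countable_SIGMA D E R)
  with sub sep show ?thesis
    unfolding regularly_embedded_def countably_separated_def
    by (intro exI[of _ "P \<union> Q"] conjI ballI)
qed

section \<open>Haar measure on totally disconnected torsion groups\<close>

text \<open>The features of the Heisenberg group on which the analytic part rests: a decreasing
  neighbourhood basis of compact open subgroups, and torsion, which gives both unimodularity and
  eigenvectors.\<close>

locale td_group = group G for G :: "'g::{second_countable_topology,t2_space} monoid" (structure) +
  fixes K :: "nat \<Rightarrow> 'g set" and \<mu> :: "'g measure"
  assumes carrier_UNIV [simp]: "carrier G = UNIV"
    and cont_mult: "continuous_on UNIV (\<lambda>(x, y). x \<otimes> y)"
    and cont_inv: "continuous_on UNIV (\<lambda>x. inv x)"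
    and K_one [simp]: "\<one> \<in> K m"
    and K_mult: "x \<in> K m \<Longrightarrow> y \<in> K m \<Longrightarrow> x \<otimes> y \<in> K m"
    and K_inv: "x \<in> K m \<Longrightarrow> inv x \<in> K m"
    and K_open: "open (K m)" and K_compact: "compact (K m)"
    and K_Suc: "K (Suc m) \<subseteq> K m"
    and K_basis: "open U \<Longrightarrow> \<one> \<in> U \<Longrightarrow> \<exists>m. K m \<subseteq> U"
    and torsion: "\<exists>n>0. x [^] (n::nat) = \<one>"
    and haar: "left_haar_measure G euclidean \<mu>"
begin

lemma K_mono: "m \<le> n \<Longrightarrow> K n \<subseteq> K m"
  by (rule lift_Suc_antimono_le) (use K_Suc in auto)

lemma inv_mult_eq: "inv (x \<otimes> y) = inv y \<otimes> inv x"
  by (simp add: inv_mult_group)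

lemma mult_cancel [simp]: "inv x \<otimes> (x \<otimes> y) = y" "x \<otimes> (inv x \<otimes> y) = y"
  "y \<otimes> inv x \<otimes> x = y" "y \<otimes> x \<otimes> inv x = y"
  by (simp_all add: inv_solve_left' flip: m_assoc) (simp_all add: m_assoc)

lemma continuous_on_group_mult [continuous_intros]:
  fixes f g :: "'c::topological_space \<Rightarrow> 'g"
  shows "continuous_on A f \<Longrightarrow> continuous_on A g \<Longrightarrow> continuous_on A (\<lambda>x. f x \<otimes> g x)"
  using continuous_on_compose2[OF cont_mult, of A "\<lambda>x. (f x, g x)"]
  by (auto intro: continuous_on_Pair)

lemma continuous_on_group_inv [continuous_intros]:
  fixes f :: "'c::topological_space \<Rightarrow> 'g"
  shows "continuous_on A f \<Longrightarrow> continuous_on A (\<lambda>x. inv (f x))"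
  using continuous_on_compose2[OF cont_inv, of A f] by auto

lemma sets_haar [measurable_cong, simp]: "sets \<mu> = sets borel"
  using haar by (simp add: left_haar_measure_def borel_of_def borel_def)

lemma space_haar [simp]: "space \<mu> = UNIV"
  using sets_eq_imp_space_eq[OF sets_haar] by simp

lemma haar_UNIV: "emeasure \<mu> UNIV \<noteq> 0"
  using haar unfolding left_haar_measure_def by (metis space_haar)

lemma haar_compact: "compact Q \<Longrightarrow> emeasure \<mu> Q < \<infinity>"
  using haar by (simp add: left_haar_measure_def)

lemma measurable_haar_continuous:
  fixes f :: "'g \<Rightarrow> 'b::topological_space"
  shows "continuous_on UNIV f \<Longrightarrow> f \<in> borel_measurable \<mu>"
  using borel_measurable_continuous_onI measurable_cong_sets[OF sets_haar refl] by blast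

lemma measurable_group_mult_left [measurable]: "(\<lambda>x. g \<otimes> x) \<in> borel \<rightarrow>\<^sub>M borel"
  by (intro borel_measurable_continuous_onI continuous_intros)

lemma measurable_group_mult_right [measurable]: "(\<lambda>x. x \<otimes> g) \<in> borel \<rightarrow>\<^sub>M borel"
  by (intro borel_measurable_continuous_onI continuous_intros)

lemma measurable_group_inv [measurable]: "(\<lambda>x. inv x) \<in> borel \<rightarrow>\<^sub>M borel"
  by (intro borel_measurable_continuous_onI continuous_intros)

lemma haar_left:
  assumes "B \<in> sets borel"
  shows "emeasure \<mu> ((\<lambda>x. g \<otimes> x) -` B) = emeasure \<mu> B"
proof -
  have "(\<lambda>x. g \<otimes> x) -` B = (\<lambda>x. inv g \<otimes> x) ` B"
    by (auto simp: image_iff) (metis mult_cancel(1))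
  then show ?thesis using haar assms by (simp add: left_haar_measure_def)
qed

section \<open>Left cosets of the compact open subgroups\<close>

definition coset :: "'g \<Rightarrow> nat \<Rightarrow> 'g set" where
  "coset x m = {y. inv x \<otimes> y \<in> K m}"

lemma coset_one: "coset \<one> m = K m"
  by (auto simp: coset_def)

lemma mem_coset_self [simp]: "x \<in> coset x m"
  by (simp add: coset_def)

lemma open_coset: "open (coset x m)"
proof -
  have "coset x m = (\<lambda>y. inv x \<otimes> y) -` K m" by (auto simp: coset_def)
  then show ?thesis by (auto intro!: open_vimage K_open continuous_intros)
qed

lemma coset_eq: "y \<in> coset x m \<Longrightarrow> coset y m = coset x m"
proof -
  assume y: "y \<in> coset x m"
  have "inv x \<otimes> z = (inv x \<otimes> y) \<otimes> (inv y \<otimes> z)" "inv y \<otimes> z = inv (inv x \<otimes> y) \<otimes> (inv x \<otimes> z)" for z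
    by (simp_all add: m_assoc inv_mult_eq)
  then show ?thesis using y K_mult K_inv unfolding coset_def by (metis (no_types, lifting) mem_Collect_eq subset_antisym subsetI)
qed

lemma coset_disjoint: "coset x m \<noteq> coset y m \<Longrightarrow> coset x m \<inter> coset y m = {}"
  using coset_eq by blast

lemma coset_subset: "m \<le> n \<Longrightarrow> coset x n \<subseteq> coset x m"
  using K_mono by (auto simp: coset_def)

lemma coset_image: "coset x m = (\<lambda>k. x \<otimes> k) ` K m"
  by (auto simp: coset_def image_iff) (metis mult_cancel(2))

lemma coset_basis:
  assumes "open U" "x \<in> U"
  obtains m where "coset x m \<subseteq> U"
proof -
  have "open ((\<lambda>y. x \<otimes> y) -` U)" using assms(1) by (intro open_vimage continuous_intros)
  then obtain m where "K m \<subseteq> (\<lambda>y. x \<otimes> y) -` U" using K_basis[of "(\<lambda>y. x \<otimes> y) -` U"] assms(2) by auto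
  then have "coset x m \<subseteq> U" unfolding coset_image by auto
  then show ?thesis by (rule that)
qed

definition all_cosets :: "'g set set" where
  "all_cosets = (\<lambda>(x, m). coset x m) ` UNIV"

text \<open>Every coset is open and so meets a countable dense set; a point of that set in the coset
  represents it.\<close>

lemma countable_all_cosets: "countable all_cosets"
proof -
  obtain D :: "'g set" where D: "countable D" "\<And>X. open X \<Longrightarrow> X \<noteq> {} \<Longrightarrow> \<exists>d\<in>D. d \<in> X"
    using countable_dense_exists by blast
  have "coset x m \<in> (\<lambda>(x, m). coset x m) ` (D \<times> UNIV)" for x m
  proof -
    have "coset x m \<noteq> {}" using mem_coset_self by blast
    then obtain d where "d \<in> D" "d \<in> coset x m" using D(2)[OF open_coset] by blast
    then show ?thesis using coset_eq by (intro image_eqI[of _ _ "(d, m)"]) auto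
  qed
  then have "all_cosets \<subseteq> (\<lambda>(x, m). coset x m) ` (D \<times> UNIV)"
    by (auto simp: all_cosets_def)
  then show ?thesis
    by (rule countable_subset) (intro countable_image countable_SIGMA D(1) countableI_type)
qed

lemma topological_basis_all_cosets: "topological_basis all_cosets"
proof (rule topological_basisI)
  fix U and x :: 'g assume "open U" "x \<in> U"
  then obtain m where "coset x m \<subseteq> U" by (rule coset_basis)
  then show "\<exists>V\<in>all_cosets. x \<in> V \<and> V \<subseteq> U"
    by (intro bexI[of _ "coset x m"]) (auto simp: all_cosets_def)
qed (auto simp: all_cosets_def open_coset)

text \<open>Two cosets are disjoint or nested, so together with the empty set they form a generator
  stable under intersection, and the uniqueness theorem for measures applies.\<close>

lemma measure_eqI_cosets:
  assumes M: "sets M = sets borel" "sets N = sets borel"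
    and eq: "\<And>x m. emeasure M (coset x m) = emeasure N (coset x m)"
    and fin: "\<And>x m. emeasure M (coset x m) \<noteq> \<infinity>"
  shows "M = N"
proof (rule measure_eqI_generator_eq_countable[of "insert {} all_cosets" UNIV M N all_cosets])
  have nested: "coset x m \<inter> coset y n \<in> insert {} all_cosets" if "m \<le> n" for x y m n
  proof (cases "coset x m \<inter> coset y n = {}")
    case False
    then obtain z where z: "z \<in> coset x m" "z \<in> coset y n" by blast
    then have "coset y n \<subseteq> coset x m" using coset_subset[OF that, of z] coset_eq[OF z(1)] coset_eq[OF z(2)] by simp
    then have "coset x m \<inter> coset y n = coset y n" by auto
    then show ?thesis by (auto simp: all_cosets_def)
  qed simp
  have "coset x m \<inter> coset y n \<in> insert {} all_cosets" for x y m n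
    using nested[of m n x y] nested[of n m y x] by (cases "m \<le> n") (auto simp: Int_commute)
  then show "Int_stable (insert {} all_cosets)"
    by (auto simp: Int_stable_def all_cosets_def)
  have "(borel :: 'g measure) = sigma UNIV all_cosets"
    by (rule borel_eq_countable_basis) (fact countable_all_cosets topological_basis_all_cosets)+
  then have "sets (borel :: 'g measure) = sigma_sets UNIV all_cosets"
    using sets_measure_of[of all_cosets UNIV] by (metis Pow_UNIV subset_UNIV)
  also have "\<dots> = sigma_sets UNIV (insert {} all_cosets)"
    by (intro antisym sigma_sets_mono' sigma_sets_mono) (auto intro: sigma_sets.Empty sigma_sets.Basic)
  finally show "sets M = sigma_sets UNIV (insert {} all_cosets)" "sets N = sigma_sets UNIV (insert {} all_cosets)"
    using M by auto
  show "\<Union> all_cosets = UNIV" using mem_coset_self by (fastforce simp: all_cosets_def)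
qed (use eq fin countable_all_cosets in \<open>auto simp: all_cosets_def\<close>)

lemma emeasure_coset_left_invariant:
  assumes "\<And>g B. B \<in> sets borel \<Longrightarrow> emeasure M ((\<lambda>x. g \<otimes> x) -` B) = emeasure M B"
  shows "emeasure M (coset x m) = emeasure M (K m)"
proof -
  have "coset x m = (\<lambda>y. inv x \<otimes> y) -` K m" by (auto simp: coset_def)
  then show ?thesis using assms[of "K m" "inv x"] K_open by simp
qed

lemma emeasure_coset: "emeasure \<mu> (coset x m) = emeasure \<mu> (K m)"
  by (rule emeasure_coset_left_invariant) (rule haar_left)

text \<open>Otherwise countably many null cosets would cover the group.\<close>

lemma emeasure_K_pos: "emeasure \<mu> (K m) \<noteq> 0"
proof
  assume 0: "emeasure \<mu> (K m) = 0"
  define C where "C = range (\<lambda>x. coset x m)"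
  have "C \<subseteq> all_cosets" by (auto simp: C_def all_cosets_def)
  then have C: "countable C" using countable_all_cosets countable_subset by blast
  have "(\<Union>A\<in>C. A) \<in> null_sets \<mu>"
    by (rule null_sets_UN'[OF C]) (use 0 open_coset in \<open>auto simp: C_def emeasure_coset intro!: null_setsI\<close>)
  moreover have "(\<Union>A\<in>C. A) = UNIV" using mem_coset_self by (fastforce simp: C_def)
  ultimately show False using haar_UNIV by (simp add: null_sets_def)
qed

definition vol :: "nat \<Rightarrow> real" where "vol m = measure \<mu> (K m)"

lemma emeasure_K: "emeasure \<mu> (K m) = ennreal (vol m)"
  using haar_compact[OF K_compact, of m] by (simp add: vol_def emeasure_eq_ennreal_measure)

lemma vol_pos: "vol m > 0"
  using emeasure_K_pos[of m] emeasure_K[of m] by (metis ennreal_0 measure_nonneg order_le_less vol_def)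

sublocale sigma_finite_measure \<mu>
proof
  show "\<exists>A. countable A \<and> A \<subseteq> sets \<mu> \<and> \<Union> A = space \<mu> \<and> (\<forall>a\<in>A. emeasure \<mu> a \<noteq> \<infinity>)"
  proof (intro exI[of _ all_cosets] conjI countable_all_cosets)
    show "\<Union> all_cosets = space \<mu>" using mem_coset_self by (fastforce simp: all_cosets_def)
  qed (auto simp: all_cosets_def open_coset emeasure_coset emeasure_K)
qed

lemma finite_disjoint_cosets:
  assumes "compact Q"
  obtains X where "finite X" "X \<subseteq> Q" "Q \<subseteq> (\<Union>x\<in>X. coset x m)" "disjoint_family_on (\<lambda>x. coset x m) X"
proof -
  obtain Y where Y: "Y \<subseteq> Q" "finite Y" "Q \<subseteq> (\<Union>x\<in>Y. coset x m)"
  proof (rule compactE_image[OF assms, of Q "\<lambda>x. coset x m"])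
    show "Q \<subseteq> (\<Union>x\<in>Q. coset x m)" using mem_coset_self by blast
  qed (use open_coset in auto)
  \<comment> \<open>The finite subcover may list a coset twice; keeping one representative of each
    coset makes the family disjoint.\<close>
  define rep where "rep C = (SOME x. x \<in> Y \<and> coset x m = C)" for C
  have rep: "rep C \<in> Y \<and> coset (rep C) m = C" if "C \<in> (\<lambda>x. coset x m) ` Y" for C
    unfolding rep_def using someI_ex[of "\<lambda>x. x \<in> Y \<and> coset x m = C"] that by blast
  let ?X = "rep ` (\<lambda>x. coset x m) ` Y"
  show ?thesis
  proof (rule that[of ?X])
    show "Q \<subseteq> (\<Union>x\<in>?X. coset x m)" using Y(3) rep by fastforce
    have "coset x m \<noteq> coset y m" if "x \<in> ?X" "y \<in> ?X" "x \<noteq> y" for x y using that rep by fastforce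
    then show "disjoint_family_on (\<lambda>x. coset x m) ?X"
      unfolding disjoint_family_on_def using coset_disjoint by blast
  qed (use Y rep in auto)
qed

text \<open>Uniqueness of Haar measure by counting: \<open>K 0\<close> is a disjoint union of
  finitely many cosets of \<open>K m\<close>, and the number is the same for both measures. Hence
  the ratio of the two masses of \<open>K m\<close> does not depend on \<open>m\<close>.\<close>

lemma left_invariant_eq_scale:
  assumes M: "sets M = sets borel"
    and inv: "\<And>g B. B \<in> sets borel \<Longrightarrow> emeasure M ((\<lambda>x. g \<otimes> x) -` B) = emeasure M B"
    and fin: "emeasure M (K 0) \<noteq> \<infinity>"
  shows "\<exists>c\<ge>0. \<forall>B\<in>sets borel. emeasure M B = ennreal c * emeasure \<mu> B"
proof -
  define c where "c = measure M (K 0) / vol 0"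
  have finm: "emeasure M (K m) < \<infinity>" for m
  proof -
    have "emeasure M (K m) \<le> emeasure M (K 0)" by (rule emeasure_mono) (use K_mono K_open M in auto)
    then show ?thesis using fin by (simp add: less_top order_le_less_trans)
  qed
  then have em: "emeasure M (K m) = ennreal (measure M (K m))" for m
    by (intro emeasure_eq_ennreal_measure) (simp add: less_top)
  have Km: "emeasure M (K m) = ennreal (c * vol m)" for m
  proof -
    obtain X where X: "finite X" "X \<subseteq> K 0" "K 0 \<subseteq> (\<Union>x\<in>X. coset x m)" "disjoint_family_on (\<lambda>x. coset x m) X"
      by (rule finite_disjoint_cosets[OF K_compact])
    have "coset x m \<subseteq> K 0" if "x \<in> X" for x
      using coset_subset[of 0 m x] coset_eq[of x \<one> 0] that X(2) by (auto simp: coset_one)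
    then have U: "K 0 = (\<Union>x\<in>X. coset x m)" using X(3) by auto
    have sum: "emeasure N (K 0) = of_nat (card X) * emeasure N (K m)"
      if "sets N = sets borel" "\<And>x. emeasure N (coset x m) = emeasure N (K m)" for N
    proof -
      have "emeasure N (K 0) = (\<Sum>x\<in>X. emeasure N (coset x m))"
        unfolding U by (rule sum_emeasure[symmetric]) (use that X open_coset in auto)
      then show ?thesis using that(2) by simp
    qed
    have 1: "ennreal (vol 0) = of_nat (card X) * ennreal (vol m)"
      using sum[of \<mu>] emeasure_coset by (simp add: emeasure_K)
    have 2: "ennreal (measure M (K 0)) = of_nat (card X) * ennreal (measure M (K m))"
      using sum[of M] M emeasure_coset_left_invariant[of M] inv by (simp add: em)
    have v: "vol 0 = card X * vol m" "measure M (K 0) = card X * measure M (K m)"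
      using 1 2 vol_pos[of m] vol_pos[of 0] by (simp_all add: ennreal_of_nat_eq_real_of_nat ennreal_mult'[symmetric] less_imp_le)
    then have "card X \<noteq> 0" using vol_pos[of 0] by (intro notI) simp
    then have "c * vol m = measure M (K m)" using v vol_pos[of m] by (simp add: c_def)
    then show ?thesis by (simp add: em)
  qed
  have c: "c \<ge> 0" using vol_pos[of 0] by (simp add: c_def)
  have "M = scale_measure (ennreal c) \<mu>"
  proof (rule measure_eqI_cosets)
    fix x m
    have "emeasure M (coset x m) = emeasure M (K m)" by (rule emeasure_coset_left_invariant) (rule inv)
    then show "emeasure M (coset x m) \<noteq> \<infinity>"
      "emeasure M (coset x m) = emeasure (scale_measure (ennreal c) \<mu>) (coset x m)"
      using finm[of m] c vol_pos[of m] by (simp_all add: Km emeasure_coset emeasure_K ennreal_mult less_imp_le)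
  qed (use M in auto)
  then have "emeasure M B = ennreal c * emeasure \<mu> B" for B by simp
  with c show ?thesis by blast
qed

text \<open>Right translation by \<open>g\<close> produces another left invariant measure, hence
  multiplies \<open>\<mu>\<close> by a constant \<open>c\<close>. Some power of \<open>g\<close> is
  trivial, so \<open>c ^ n = 1\<close> and the positive mass of \<open>K 0\<close> gives
  \<open>c = 1\<close>.\<close>

lemma haar_right:
  assumes "B \<in> sets borel"
  shows "emeasure \<mu> ((\<lambda>x. x \<otimes> g) -` B) = emeasure \<mu> B"
proof -
  let ?M = "distr \<mu> borel (\<lambda>x. x \<otimes> g)"
  have em: "emeasure ?M B = emeasure \<mu> ((\<lambda>x. x \<otimes> g) -` B)" if "B \<in> sets borel" for B
    by (subst emeasure_distr) (use that in auto)
  have "\<exists>c\<ge>0. \<forall>B\<in>sets borel. emeasure ?M B = ennreal c * emeasure \<mu> B"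
  proof (rule left_invariant_eq_scale)
    fix h and B :: "'g set" assume B: "B \<in> sets borel"
    have "(\<lambda>x. h \<otimes> x) -` B \<in> sets borel" using measurable_sets[OF measurable_group_mult_left B, of h] by simp
    then have "emeasure ?M ((\<lambda>x. h \<otimes> x) -` B) = emeasure \<mu> ((\<lambda>x. x \<otimes> g) -` ((\<lambda>x. h \<otimes> x) -` B))"
      by (rule em)
    also have "(\<lambda>x. x \<otimes> g) -` ((\<lambda>x. h \<otimes> x) -` B) = (\<lambda>x. h \<otimes> x) -` ((\<lambda>x. x \<otimes> g) -` B)"
      by (auto simp: m_assoc)
    also have "emeasure \<mu> \<dots> = emeasure \<mu> ((\<lambda>x. x \<otimes> g) -` B)"
      using measurable_sets[OF measurable_group_mult_right B, of g] by (intro haar_left) simp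
    finally show "emeasure ?M ((\<lambda>x. h \<otimes> x) -` B) = emeasure ?M B" using em[OF B] by simp
  next
    have "(\<lambda>x. x \<otimes> g) -` K 0 = (\<lambda>x. x \<otimes> inv g) ` K 0" by (auto simp: image_iff) (metis mult_cancel(4))
    moreover have "compact ((\<lambda>x. x \<otimes> inv g) ` K 0)"
      by (intro compact_continuous_image continuous_intros K_compact)
    ultimately have "emeasure \<mu> ((\<lambda>x. x \<otimes> g) -` K 0) < \<infinity>" using haar_compact by simp
    then show "emeasure ?M (K 0) \<noteq> \<infinity>" using em[of "K 0"] K_open by simp
  qed simp
  then obtain c where c: "c \<ge> 0" "\<And>B. B \<in> sets borel \<Longrightarrow> emeasure \<mu> ((\<lambda>x. x \<otimes> g) -` B) = ennreal c * emeasure \<mu> B"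
    using em by auto
  have pow: "emeasure \<mu> ((\<lambda>x. x \<otimes> g [^] (n::nat)) -` B) = ennreal (c ^ n) * emeasure \<mu> B" if "B \<in> sets borel" for n B
  proof (induction n)
    case (Suc n)
    have "(\<lambda>x. x \<otimes> g [^] Suc n) -` B = (\<lambda>x. x \<otimes> g) -` ((\<lambda>x. x \<otimes> g [^] n) -` B)"
      using nat_pow_Suc2[of g n] by (auto simp: m_assoc)
    moreover have "(\<lambda>x. x \<otimes> g [^] n) -` B \<in> sets borel"
      using measurable_sets[OF measurable_group_mult_right that, of "g [^] n"] by simp
    ultimately show ?case using c Suc by (simp add: ennreal_mult mult.assoc)
  qed simp
  obtain n where n: "n > 0" "g [^] (n::nat) = \<one>" using torsion by blast
  have "ennreal (vol 0) = ennreal (c ^ n * vol 0)"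
    using pow[of "K 0" n] n K_open c(1) vol_pos[of 0] by (simp add: emeasure_K ennreal_mult' less_imp_le)
  then have "c ^ n = 1" using vol_pos[of 0] c(1) by (subst (asm) ennreal_inj) auto
  then have "c = 1" using c(1) n(1) using power_eq_iff_eq_base[of n c 1] by simp
  then show ?thesis using c(2)[OF assms] by simp
qed

text \<open>Inversion exchanges left and right translations, so by right invariance the image
  measure is left invariant too. The constant is 1 because inversion maps \<open>K 0\<close> onto
  itself.\<close>

lemma haar_inv:
  assumes "B \<in> sets borel"
  shows "emeasure \<mu> ((\<lambda>x. inv x) -` B) = emeasure \<mu> B"
proof -
  let ?M = "distr \<mu> borel (\<lambda>x. inv x)"
  have em: "emeasure ?M B = emeasure \<mu> ((\<lambda>x. inv x) -` B)" if "B \<in> sets borel" for B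
    by (subst emeasure_distr) (use that in auto)
  have K: "(\<lambda>x. inv x) -` K 0 = K 0" using K_inv[of _ 0] by (auto, metis carrier_UNIV inv_inv UNIV_I)
  have "\<exists>c\<ge>0. \<forall>B\<in>sets borel. emeasure ?M B = ennreal c * emeasure \<mu> B"
  proof (rule left_invariant_eq_scale)
    fix h and B :: "'g set" assume B: "B \<in> sets borel"
    have "(\<lambda>x. h \<otimes> x) -` B \<in> sets borel" using measurable_sets[OF measurable_group_mult_left B, of h] by simp
    then have "emeasure ?M ((\<lambda>x. h \<otimes> x) -` B) = emeasure \<mu> ((\<lambda>x. inv x) -` ((\<lambda>x. h \<otimes> x) -` B))"
      by (rule em)
    also have "(\<lambda>x. inv x) -` ((\<lambda>x. h \<otimes> x) -` B) = (\<lambda>x. x \<otimes> inv h) -` ((\<lambda>x. inv x) -` B)"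
      by (auto simp: inv_mult_eq)
    also have "emeasure \<mu> \<dots> = emeasure \<mu> ((\<lambda>x. inv x) -` B)"
      using measurable_sets[OF measurable_group_inv B] by (intro haar_right) simp
    finally show "emeasure ?M ((\<lambda>x. h \<otimes> x) -` B) = emeasure ?M B" using em[OF B] by simp
  next
    show "emeasure ?M (K 0) \<noteq> \<infinity>" using em[of "K 0"] K_open K by (simp add: emeasure_K)
  qed simp
  then obtain c where c: "c \<ge> 0" "\<And>B. B \<in> sets borel \<Longrightarrow> emeasure \<mu> ((\<lambda>x. inv x) -` B) = ennreal c * emeasure \<mu> B"
    using em by auto
  have "ennreal (vol 0) = ennreal (c * vol 0)"
    using c(2)[of "K 0"] K_open K c(1) vol_pos[of 0] by (simp add: emeasure_K ennreal_mult' less_imp_le)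
  then have "c = 1" using vol_pos[of 0] c(1) by (subst (asm) ennreal_inj) auto
  then show ?thesis using c(2)[OF assms] by simp
qed

lemma modular_function_eq_1: "modular_function G \<mu> g = 1"
  unfolding modular_function_def
proof (rule the_equality)
  have *: "emeasure \<mu> ((\<lambda>x. x \<otimes> g) ` B) = emeasure \<mu> B" if "B \<in> sets borel" for B
  proof -
    have "(\<lambda>x. x \<otimes> g) ` B = (\<lambda>x. x \<otimes> inv g) -` B" by (auto simp: image_iff) (metis mult_cancel(3))
    then show ?thesis using haar_right[OF that] by simp
  qed
  then show "0 < (1::real) \<and> (\<forall>B\<in>sets \<mu>. emeasure \<mu> ((\<lambda>x. x \<otimes> g) ` B) = ennreal 1 * emeasure \<mu> B)"
    by simp
  fix c assume c: "0 < c \<and> (\<forall>B\<in>sets \<mu>. emeasure \<mu> ((\<lambda>x. x \<otimes> g) ` B) = ennreal c * emeasure \<mu> B)"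
  then have "ennreal (vol 0) = ennreal c * ennreal (vol 0)" using *[of "K 0"] K_open by (simp add: emeasure_K)
  also have "\<dots> = ennreal (c * vol 0)" using c vol_pos[of 0] by (simp add: ennreal_mult less_imp_le)
  finally show "c = 1" using c vol_pos[of 0] by (subst (asm) ennreal_inj) auto
qed

lemma integral_transform:
  fixes f :: "'g \<Rightarrow> 'b::{banach,second_countable_topology}"
  assumes T: "T \<in> borel \<rightarrow>\<^sub>M borel" "\<And>B. B \<in> sets borel \<Longrightarrow> emeasure \<mu> (T -` B) = emeasure \<mu> B"
    and f: "f \<in> borel_measurable borel"
  shows "(LINT x|\<mu>. f (T x)) = (LINT x|\<mu>. f x)"
proof -
  have "distr \<mu> borel T = \<mu>"
    by (rule measure_eqI) (use T in \<open>auto simp: emeasure_distr\<close>)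
  moreover have "integral\<^sup>L (distr \<mu> borel T) f = (LINT x|\<mu>. f (T x))"
    by (rule integral_distr) (use T f in auto)
  ultimately show ?thesis by simp
qed

lemma
  fixes f :: "'g \<Rightarrow> 'b::{banach,second_countable_topology}"
  assumes "f \<in> borel_measurable borel"
  shows integral_left: "(LINT x|\<mu>. f (g \<otimes> x)) = (LINT x|\<mu>. f x)"
    and integral_right: "(LINT x|\<mu>. f (x \<otimes> g)) = (LINT x|\<mu>. f x)"
    and integral_inv: "(LINT x|\<mu>. f (inv x)) = (LINT x|\<mu>. f x)"
  using integral_transform[OF measurable_group_mult_left haar_left assms]
    integral_transform[OF measurable_group_mult_right haar_right assms]
    integral_transform[OF measurable_group_inv haar_inv assms] by blast+

end

section \<open>Compactly supported functions\<close>

context td_group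
begin

abbreviation "Cc \<equiv> compactly_supported_functions G euclidean"
abbreviation "conv \<equiv> convolution G \<mu>"
abbreviation "star \<equiv> involution G \<mu>"

lemma Cc_iff: "f \<in> Cc \<longleftrightarrow> continuous_on UNIV f \<and> (\<exists>Q. compact Q \<and> (\<forall>x. x \<notin> Q \<longrightarrow> f x = 0))"
  by (auto simp: compactly_supported_functions_def)

lemma CcE:
  assumes "f \<in> Cc"
  obtains Q where "continuous_on UNIV f" "compact Q" "\<And>x. x \<notin> Q \<Longrightarrow> f x = 0"
  using assms unfolding Cc_iff by blast

lemma CcI: "continuous_on UNIV f \<Longrightarrow> compact Q \<Longrightarrow> (\<And>x. x \<notin> Q \<Longrightarrow> f x = 0) \<Longrightarrow> f \<in> Cc"
  unfolding Cc_iff by blast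

lemma Cc_continuous: "f \<in> Cc \<Longrightarrow> continuous_on UNIV f"
  by (simp add: Cc_iff)

lemma Cc_measurable: "f \<in> Cc \<Longrightarrow> f \<in> borel_measurable borel"
  by (intro borel_measurable_continuous_onI Cc_continuous)

lemma compact_group_mult: "compact A \<Longrightarrow> compact B \<Longrightarrow> compact ((\<lambda>(x, y). x \<otimes> y) ` (A \<times> B))"
  by (intro compact_continuous_image compact_Times continuous_on_subset[OF cont_mult]) auto

lemma bounded_off_compact:
  fixes f :: "'c::topological_space \<Rightarrow> complex"
  assumes "continuous_on UNIV f" "compact Q" "\<And>x. x \<notin> Q \<Longrightarrow> f x = 0"
  obtains B where "B \<ge> 0" "\<And>x. cmod (f x) \<le> B"
proof -
  have "bounded (f ` Q)"
    using assms by (intro compact_imp_bounded compact_continuous_image continuous_on_subset[OF assms(1)]) auto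
  then obtain B where B: "B > 0" "\<And>x. x \<in> Q \<Longrightarrow> cmod (f x) \<le> B" by (auto simp: bounded_pos)
  then have "cmod (f x) \<le> B" for x by (cases "x \<in> Q") (auto simp: assms(3))
  with B(1) show ?thesis by (intro that[of B]) auto
qed

definition L1 :: "('g \<Rightarrow> complex) \<Rightarrow> real" where
  "L1 f = (LINT x|\<mu>. cmod (f x))"

lemma L1_nonneg: "L1 f \<ge> 0"
  by (simp add: L1_def)

lemma compact_in_borel: "compact Q \<Longrightarrow> Q \<in> sets borel" for Q :: "'g set"
  by (simp add: compact_imp_closed)

lemma L1_bound:
  assumes f: "continuous_on UNIV f" and Q: "compact Q" and 0: "\<And>x. x \<notin> Q \<Longrightarrow> f x = 0"
    and B: "\<And>x. cmod (f x) \<le> B"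
  shows "integrable \<mu> f" "L1 f \<le> B * measure \<mu> Q"
proof -
  have int: "integrable \<mu> (\<lambda>x. B * indicator Q x)"
    using haar_compact[OF Q] compact_in_borel[OF Q] by (intro integrable_mult_right integrable_real_indicator) auto
  have le: "cmod (f x) \<le> B * indicator Q x" for x
    using 0[of x] B[of x] by (cases "x \<in> Q") auto
  show i: "integrable \<mu> f"
  proof (rule Bochner_Integration.integrable_bound[OF int measurable_haar_continuous[OF f]])
    have "cmod (f x) \<le> norm (B * indicator Q x)" for x
      using le[of x] by (simp add: order.trans[OF _ abs_ge_self])
    then show "AE x in \<mu>. cmod (f x) \<le> norm (B * indicator Q x)" by simp
  qed
  have "L1 f \<le> (LINT x|\<mu>. B * indicator Q x)"
    unfolding L1_def by (rule integral_mono[OF integrable_norm[OF i] int le])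
  also have "\<dots> = B * measure \<mu> Q" using compact_in_borel[OF Q] by simp
  finally show "L1 f \<le> B * measure \<mu> Q" .
qed

lemma Cc_integrable: "f \<in> Cc \<Longrightarrow> integrable \<mu> f"
  by (elim CcE) (metis L1_bound(1) bounded_off_compact)

lemma Cc_mult_continuous:
  assumes "f \<in> Cc" "continuous_on UNIV \<phi>"
  shows "(\<lambda>x. f x * \<phi> x) \<in> Cc"
  using assms(1)
proof (elim CcE)
  fix Q assume "continuous_on UNIV f" "compact Q" "\<And>x. x \<notin> Q \<Longrightarrow> f x = 0"
  then show ?thesis using assms(2) by (intro CcI[of _ Q] continuous_on_mult) auto
qed

lemma Cc_scale: "f \<in> Cc \<Longrightarrow> (\<lambda>x. c * f x) \<in> Cc"
  using Cc_mult_continuous[of f "\<lambda>_. c"] by (simp add: mult.commute)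

lemma Cc_zero: "(\<lambda>x. 0) \<in> Cc"
  by (rule CcI[of _ "{}"]) auto

lemma Cc_add:
  assumes "f \<in> Cc" "h \<in> Cc"
  shows "(\<lambda>x. f x + h x) \<in> Cc"
  using assms
proof (elim CcE)
  fix P Q assume "continuous_on UNIV f" "compact P" "\<And>x. x \<notin> P \<Longrightarrow> f x = 0"
    "continuous_on UNIV h" "compact Q" "\<And>x. x \<notin> Q \<Longrightarrow> h x = 0"
  then show ?thesis by (intro CcI[of _ "P \<union> Q"] continuous_on_add compact_Un) auto
qed

lemma Cc_diff: "f \<in> Cc \<Longrightarrow> h \<in> Cc \<Longrightarrow> (\<lambda>x. f x - h x) \<in> Cc"
  using Cc_add[of f "\<lambda>x. - 1 * h x"] Cc_scale[of h "- 1"] by simp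

lemma Cc_sum: "(\<And>i. i \<in> A \<Longrightarrow> f i \<in> Cc) \<Longrightarrow> (\<lambda>x. \<Sum>i\<in>A. f i x) \<in> Cc"
  by (induction A rule: infinite_finite_induct) (auto intro: Cc_zero Cc_add)

definition shift :: "'g \<Rightarrow> ('g \<Rightarrow> complex) \<Rightarrow> 'g \<Rightarrow> complex" where
  "shift g f = (\<lambda>x. f (inv g \<otimes> x))"

lemma shift_shift: "shift g (shift h f) = shift (g \<otimes> h) f"
  by (simp add: shift_def inv_mult_eq m_assoc)

lemma shift_one: "shift \<one> f = f"
  by (simp add: shift_def)

text \<open>\<open>S\<close> carries a compact support of \<open>f\<close> to one of the
  composition, because it inverts \<open>T\<close> on the left.\<close>

lemma Cc_compose:
  assumes f: "f \<in> Cc" and T: "continuous_on UNIV T" "continuous_on UNIV S" "\<And>x. S (T x) = x"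
  shows "(\<lambda>x. f (T x)) \<in> Cc"
  using f
proof (elim CcE)
  fix Q assume Q: "continuous_on UNIV f" "compact Q" "\<And>x. x \<notin> Q \<Longrightarrow> f x = 0"
  show ?thesis
  proof (rule CcI)
    show "continuous_on UNIV (\<lambda>x. f (T x))" using continuous_on_compose2[OF Q(1) T(1)] by simp
    show "compact (S ` Q)" by (intro compact_continuous_image Q continuous_on_subset[OF T(2)]) auto
    show "f (T x) = 0" if "x \<notin> S ` Q" for x
      using that T(3)[of x] by (intro Q(3)) (metis imageI)
  qed
qed

lemma Cc_shift: "f \<in> Cc \<Longrightarrow> shift g f \<in> Cc"
  unfolding shift_def
  by (rule Cc_compose[of f _ "\<lambda>x. g \<otimes> x"]) (auto intro!: continuous_intros)

lemma star_eq: "star f = (\<lambda>x. cnj (f (inv x)))"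
  by (simp add: involution_def fun_eq_iff modular_function_eq_1)

lemma Cc_star:
  assumes "f \<in> Cc"
  shows "star f \<in> Cc"
proof -
  have f: "(\<lambda>x. f (inv x)) \<in> Cc"
    by (rule Cc_compose[OF assms, of _ "\<lambda>x. inv x"]) (auto intro!: continuous_intros)
  then obtain Q where Q: "continuous_on UNIV (\<lambda>x. f (inv x))" "compact Q" "\<And>x. x \<notin> Q \<Longrightarrow> f (inv x) = 0"
    unfolding Cc_iff by blast
  then show ?thesis unfolding star_eq by (intro CcI[of _ Q] continuous_on_cnj) auto
qed

text \<open>In the usual finite-cover argument the subgroup property replaces the shrinking of
  neighbourhoods: multiplying by \<open>k\<close> in a deep enough \<open>K M\<close> never leaves
  the coset that contains \<open>x\<close>.\<close>

lemma Cc_uniform_right: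
  assumes f: "f \<in> Cc" and e: "e > 0"
  shows "\<exists>M. \<forall>k\<in>K M. \<forall>x. cmod (f (x \<otimes> k) - f x) < e"
proof -
  obtain Q where Q: "continuous_on UNIV f" "compact Q" "\<And>x. x \<notin> Q \<Longrightarrow> f x = 0"
    using f unfolding Cc_iff by blast
  have "\<exists>m. \<forall>y\<in>coset x m. cmod (f y - f x) < e / 2" for x
  proof -
    have "open (f -` ball (f x) (e / 2))" using Q(1) by (intro open_vimage) auto
    moreover have "x \<in> f -` ball (f x) (e / 2)" using e by simp
    ultimately obtain m where "coset x m \<subseteq> f -` ball (f x) (e / 2)" by (rule coset_basis)
    then show ?thesis by (intro exI[of _ m]) (auto simp: dist_norm norm_minus_commute)
  qed
  then obtain m where m: "\<And>x y. y \<in> coset x (m x) \<Longrightarrow> cmod (f y - f x) < e / 2" by metis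
  obtain Y where Y: "finite Y" "Q \<subseteq> (\<Union>x\<in>Y. coset x (m x))"
  proof (rule compactE_image[OF Q(2), of Q "\<lambda>x. coset x (m x)"])
    show "Q \<subseteq> (\<Union>x\<in>Q. coset x (m x))" using mem_coset_self by blast
  qed (use open_coset in auto)
  define M where "M = Max (insert 0 (m ` Y))"
  have mM: "m x \<le> M" if "x \<in> Y" for x unfolding M_def using that Y(1) by (intro Max_ge) auto
  have *: "cmod (f (x \<otimes> k) - f x) < e" if x: "x \<in> Q" and k: "k \<in> K M" for x k
  proof -
    obtain y where y: "y \<in> Y" "x \<in> coset y (m y)" using Y x by blast
    have "k \<in> K (m y)" using K_mono[OF mM[OF y(1)]] k by blast
    then have "x \<otimes> k \<in> coset y (m y)" using y(2) K_mult by (auto simp: coset_def m_assoc[symmetric])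
    from m[OF this] m[OF y(2)] show ?thesis
      using norm_triangle_ineq4[of "f (x \<otimes> k) - f y" "f x - f y"] by simp
  qed
  have "cmod (f (x \<otimes> k) - f x) < e" if k: "k \<in> K M" for x k
  \<comment> \<open>If only \<open>x \<otimes> k\<close> lies in \<open>Q\<close>, the estimate is
    applied at \<open>x \<otimes> k\<close> with \<open>inv k\<close>.\<close>
  proof (cases "x \<in> Q \<or> x \<otimes> k \<in> Q")
    case True
    then show ?thesis
      using *[of x k] *[of "x \<otimes> k" "inv k"] k K_inv[OF k] by (auto simp: norm_minus_commute)
  next
    case False
    then show ?thesis using Q(3) e by simp
  qed
  then show ?thesis by blast
qed

lemma Cc_uniform_left:
  assumes f: "f \<in> Cc" and e: "e > 0"
  shows "\<exists>M. \<forall>k\<in>K M. \<forall>x. cmod (f (k \<otimes> x) - f x) < e"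
proof -
  have "(\<lambda>x. f (inv x)) \<in> Cc"
    by (rule Cc_compose[OF f, of _ "\<lambda>x. inv x"]) (auto intro!: continuous_intros)
  from Cc_uniform_right[OF this e]
  obtain M where M: "\<And>k x. k \<in> K M \<Longrightarrow> cmod (f (inv (x \<otimes> k)) - f (inv x)) < e" by blast
  have "cmod (f (k \<otimes> x) - f x) < e" if "k \<in> K M" for k x
    using M[OF K_inv[OF that], of "inv x"] by (simp add: inv_mult_eq)
  then show ?thesis by blast
qed

lemma continuous_on_cosetI:
  fixes \<phi> :: "'g \<Rightarrow> complex"
  assumes "\<And>e. e > 0 \<Longrightarrow> \<exists>M. \<forall>k\<in>K M. \<forall>x. cmod (\<phi> (x \<otimes> k) - \<phi> x) < e"
  shows "continuous_on UNIV \<phi>"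
  unfolding continuous_on_def
proof
  fix x
  show "(\<phi> \<longlongrightarrow> \<phi> x) (at x)"
  proof (rule tendstoI)
    fix e :: real assume "e > 0"
    then obtain M where M: "\<And>k x. k \<in> K M \<Longrightarrow> cmod (\<phi> (x \<otimes> k) - \<phi> x) < e" using assms by blast
    have "dist (\<phi> y) (\<phi> x) < e" if "y \<in> coset x M" for y
      using M[of "inv x \<otimes> y" x] that by (simp add: coset_def dist_norm)
    then show "eventually (\<lambda>y. dist (\<phi> y) (\<phi> x) < e) (at x)"
      unfolding eventually_at_topological using open_coset[of x M] mem_coset_self by blast
  qed
qed

section \<open>Convolution\<close>

lemma conv_integrand:
  assumes "f \<in> Cc" "h \<in> Cc"
  shows "(\<lambda>y. f y * h (inv y \<otimes> x)) \<in> Cc"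
proof (rule Cc_mult_continuous[OF assms(1)])
  show "continuous_on UNIV (\<lambda>y. h (inv y \<otimes> x))"
    by (rule continuous_on_compose2[OF Cc_continuous[OF assms(2)]]) (auto intro!: continuous_intros)
qed

lemma Cc_conv:
  assumes f: "f \<in> Cc" and h: "h \<in> Cc"
  shows "conv f h \<in> Cc"
proof -
  obtain P where P: "compact P" "\<And>x. x \<notin> P \<Longrightarrow> f x = 0" using f unfolding Cc_iff by blast
  obtain Q where Q: "compact Q" "\<And>x. x \<notin> Q \<Longrightarrow> h x = 0" using h unfolding Cc_iff by blast
  show ?thesis
  proof (rule CcI[OF _ compact_group_mult[OF P(1) Q(1)]])
    show "continuous_on UNIV (conv f h)"
    proof (rule continuous_on_cosetI)
      fix e :: real assume e: "e > 0"
      define d where "d = e / (L1 f + 1)"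
      have d: "d > 0" using e L1_nonneg[of f] by (simp add: d_def add_nonneg_pos)
      from Cc_uniform_right[OF h this]
      obtain M where M: "\<And>k x. k \<in> K M \<Longrightarrow> cmod (h (x \<otimes> k) - h x) < d" by blast
      have "cmod (conv f h (x \<otimes> k) - conv f h x) < e" if k: "k \<in> K M" for x k
      proof -
        let ?g = "\<lambda>y. f y * h (inv y \<otimes> (x \<otimes> k)) - f y * h (inv y \<otimes> x)"
        have int: "integrable \<mu> (\<lambda>y. f y * h (inv y \<otimes> z))" for z
          by (intro Cc_integrable conv_integrand f h)
        have "conv f h (x \<otimes> k) - conv f h x = (LINT y|\<mu>. ?g y)"
          unfolding convolution_def by (rule Bochner_Integration.integral_diff[OF int int, symmetric])
        also have "cmod \<dots> \<le> (LINT y|\<mu>. cmod (?g y))" by (rule integral_norm_bound)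
        also have "\<dots> \<le> (LINT y|\<mu>. d * cmod (f y))"
        proof (rule integral_mono)
          show "integrable \<mu> (\<lambda>y. cmod (?g y))" by (intro integrable_norm Bochner_Integration.integrable_diff int)
          show "integrable \<mu> (\<lambda>y. d * cmod (f y))" by (intro integrable_mult_right integrable_norm Cc_integrable f)
          fix y
          have "?g y = f y * (h (inv y \<otimes> x \<otimes> k) - h (inv y \<otimes> x))" by (simp add: algebra_simps m_assoc)
          then show "cmod (?g y) \<le> d * cmod (f y)"
            using M[OF k, of "inv y \<otimes> x"] by (simp add: norm_mult mult.commute[of d] mult_left_mono less_imp_le)
        qed
        also have "\<dots> = d * L1 f" by (simp add: L1_def)
        also have "\<dots> < e" using e L1_nonneg[of f] by (simp add: d_def field_simps)
        finally show ?thesis .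
      qed
      then show "\<exists>M. \<forall>k\<in>K M. \<forall>x. cmod (conv f h (x \<otimes> k) - conv f h x) < e" by blast
    qed
    fix x assume x: "x \<notin> (\<lambda>(x, y). x \<otimes> y) ` (P \<times> Q)"
    have 0: "f y * h (inv y \<otimes> x) = 0" for y
    proof (rule ccontr)
      assume "f y * h (inv y \<otimes> x) \<noteq> 0"
      then have "y \<in> P" "inv y \<otimes> x \<in> Q" using P Q by auto
      then have "x \<in> (\<lambda>(x, y). x \<otimes> y) ` (P \<times> Q)" by (intro image_eqI[of _ _ "(y, inv y \<otimes> x)"]) auto
      with x show False by simp
    qed
    then show "conv f h x = 0" by (simp only: convolution_def 0) simp
  qed
qed

lemma conv_diff_left:
  assumes "f \<in> Cc" "f' \<in> Cc" "h \<in> Cc"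
  shows "conv (\<lambda>x. f x - f' x) h = (\<lambda>x. conv f h x - conv f' h x)"
  unfolding convolution_def left_diff_distrib
  by (intro ext Bochner_Integration.integral_diff Cc_integrable conv_integrand assms)

lemma conv_diff_right:
  assumes "f \<in> Cc" "h \<in> Cc" "h' \<in> Cc"
  shows "conv f (\<lambda>x. h x - h' x) = (\<lambda>x. conv f h x - conv f h' x)"
  unfolding convolution_def right_diff_distrib
  by (intro ext Bochner_Integration.integral_diff Cc_integrable conv_integrand assms)

text \<open>Fubini followed by left invariance in the inner integral. With \<open>\<phi>\<close> a
  matrix coefficient of a representation, this is what turns convolution into composition of
  operators.\<close>

lemma conv_integral:
  assumes f: "f \<in> Cc" and h: "h \<in> Cc" and \<phi>: "continuous_on UNIV \<phi>"
  shows "(LINT x|\<mu>. conv f h x * \<phi> x) = (LINT y|\<mu>. f y * (LINT x|\<mu>. h x * \<phi> (y \<otimes> x)))"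
proof -
  interpret P: pair_sigma_finite \<mu> \<mu> ..
  obtain P where P: "compact P" "\<And>x. x \<notin> P \<Longrightarrow> f x = 0" using f unfolding Cc_iff by blast
  obtain Q where Q: "compact Q" "\<And>x. x \<notin> Q \<Longrightarrow> h x = 0" using h unfolding Cc_iff by blast
  define A where "A = (\<lambda>(x, y). x \<otimes> y) ` (P \<times> Q)"
  have A: "compact A" unfolding A_def by (rule compact_group_mult[OF P(1) Q(1)])
  define F where "F x y = f y * h (inv y \<otimes> x) * \<phi> x" for x y
  have F0: "case_prod F z = 0" if "z \<notin> A \<times> P" for z
  proof (rule ccontr)
    assume *: "case_prod F z \<noteq> 0"
    obtain x y where z: "z = (x, y)" by force
    with * P Q have "y \<in> P" "inv y \<otimes> x \<in> Q" by (auto simp: F_def)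
    then have "x \<in> A" unfolding A_def by (intro image_eqI[of _ _ "(y, inv y \<otimes> x)"]) auto
    with \<open>y \<in> P\<close> z that show False by simp
  qed
  have Fc: "continuous_on UNIV (case_prod F)"
  proof -
    have "continuous_on UNIV (\<lambda>z. f (snd z))" "continuous_on UNIV (\<lambda>z. h (inv (snd z) \<otimes> fst z))"
      "continuous_on UNIV (\<lambda>z. \<phi> (fst z))"
      by (rule continuous_on_compose2[OF Cc_continuous[OF f]] continuous_on_compose2[OF Cc_continuous[OF h]]
          continuous_on_compose2[OF \<phi>]; auto intro!: continuous_intros)+
    then show ?thesis unfolding F_def case_prod_beta by (intro continuous_on_mult)
  qed
  obtain B where B: "B \<ge> 0" "\<And>z. cmod (case_prod F z) \<le> B"
    using bounded_off_compact[OF Fc compact_Times[OF A P(1)] F0] by blast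
  have meas: "case_prod F \<in> borel_measurable (\<mu> \<Otimes>\<^sub>M \<mu>)"
  proof -
    \<comment> \<open>Second countability identifies the product of the two Borel structures with
      that of the product space, so continuity of \<open>F\<close> gives joint
      measurability.\<close>
    have "sets (\<mu> \<Otimes>\<^sub>M \<mu>) = sets (borel \<Otimes>\<^sub>M borel)" by (intro sets_pair_measure_cong sets_haar)
    also have "\<dots> = sets (borel :: ('g \<times> 'g) measure)" by (rule arg_cong[OF borel_prod])
    finally show ?thesis using borel_measurable_continuous_onI[OF Fc] measurable_cong_sets by blast
  qed
  have int: "integrable (\<mu> \<Otimes>\<^sub>M \<mu>) (case_prod F)"
  proof (rule Bochner_Integration.integrable_bound[OF _ meas])
    have "emeasure (\<mu> \<Otimes>\<^sub>M \<mu>) (A \<times> P) = emeasure \<mu> A * emeasure \<mu> P"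
      by (rule emeasure_pair_measure_Times) (use A P compact_in_borel in auto)
    also have "\<dots> < \<infinity>" using haar_compact[OF A] haar_compact[OF P(1)] by (simp add: ennreal_mult_less_top)
    finally show "integrable (\<mu> \<Otimes>\<^sub>M \<mu>) (\<lambda>z. B * indicator (A \<times> P) z)"
      using A P compact_in_borel by (intro integrable_mult_right integrable_real_indicator pair_measureI) auto
    have "cmod (case_prod F z) \<le> norm (B * indicator (A \<times> P) z)" for z
      using B(2)[of z] F0[of z] by (cases "z \<in> A \<times> P") auto
    then show "AE z in \<mu> \<Otimes>\<^sub>M \<mu>. cmod (case_prod F z) \<le> norm (B * indicator (A \<times> P) z)" by simp
  qed
  have inner: "(LINT x|\<mu>. F x y) = f y * (LINT x|\<mu>. h x * \<phi> (y \<otimes> x))" for y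
  proof -
    have "(\<lambda>x. F x y) \<in> borel_measurable borel"
    proof (rule borel_measurable_continuous_onI)
      show "continuous_on UNIV (\<lambda>x. F x y)"
        by (rule continuous_on_compose2[OF Fc, where f = "\<lambda>x. (x, y)", simplified])
          (auto intro!: continuous_intros)
    qed
    from integral_left[OF this, of y] show ?thesis by (auto simp: F_def mult.assoc)
  qed
  have "(LINT x|\<mu>. conv f h x * \<phi> x) = (LINT x|\<mu>. (LINT y|\<mu>. F x y))"
    unfolding convolution_def F_def
    by (intro Bochner_Integration.integral_cong refl) (simp add: integral_mult_left_zero)
  also have "\<dots> = (LINT y|\<mu>. (LINT x|\<mu>. F x y))" by (rule P.Fubini_integral[OF int, symmetric])
  also have "\<dots> = (LINT y|\<mu>. f y * (LINT x|\<mu>. h x * \<phi> (y \<otimes> x)))" by (simp only: inner)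
  finally show ?thesis .
qed

subsection \<open>Approximate units and step functions\<close>

definition bump :: "nat \<Rightarrow> 'g \<Rightarrow> complex" where
  "bump m x = (if x \<in> K m then complex_of_real (1 / vol m) else 0)"

lemma bump_mult_left: "bump m (k \<otimes> x) = bump m x" if "k \<in> K m"
proof -
  have "k \<otimes> x \<in> K m \<longleftrightarrow> x \<in> K m" using K_mult[of k m x] K_mult[OF K_inv[OF that], of "k \<otimes> x"] that by auto
  then show ?thesis by (simp add: bump_def)
qed

lemma bump_mult_right: "bump m (x \<otimes> k) = bump m x" if "k \<in> K m"
proof -
  have "x \<otimes> k \<in> K m \<longleftrightarrow> x \<in> K m" using K_mult[of x m k] K_mult[OF _ K_inv[OF that], of "x \<otimes> k"] that by auto
  then show ?thesis by (simp add: bump_def)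
qed

lemma Cc_bump: "bump m \<in> Cc"
proof (rule CcI[OF _ K_compact[of m]])
  show "continuous_on UNIV (bump m)"
  proof (rule continuous_on_cosetI)
    fix e :: real assume "e > 0"
    then show "\<exists>M. \<forall>k\<in>K M. \<forall>x. cmod (bump m (x \<otimes> k) - bump m x) < e"
      by (intro exI[of _ m]) (simp add: bump_mult_right)
  qed
qed (simp add: bump_def)

lemma integral_bump: "(LINT x|\<mu>. bump m x) = 1"
proof -
  have "(LINT x|\<mu>. bump m x) = (LINT x|\<mu>. complex_of_real (1 / vol m * indicator (K m) x))"
    by (intro Bochner_Integration.integral_cong) (auto simp: bump_def)
  also have "\<dots> = complex_of_real (1 / vol m * measure \<mu> (K m))"
    using K_open by (subst integral_complex_of_real) simp
  also have "\<dots> = 1" using vol_pos[of m] by (simp add: vol_def)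
  finally show ?thesis .
qed

lemma L1_bump: "L1 (bump m) = 1"
proof -
  have "cmod (bump m x) = Re (bump m x)" for x using vol_pos[of m] by (simp add: bump_def norm_divide)
  then have "L1 (bump m) = Re (LINT x|\<mu>. bump m x)"
    unfolding L1_def using integral_Re[OF Cc_integrable[OF Cc_bump]] by simp
  then show ?thesis by (simp add: integral_bump)
qed

lemma conv_bump_diff: 
  assumes "f \<in> Cc"
  shows "conv (bump m) f x - f x = (LINT y|\<mu>. bump m y * (f (inv y \<otimes> x) - f x))"
proof -
  have "(LINT y|\<mu>. bump m y * (f (inv y \<otimes> x) - f x))
      = (LINT y|\<mu>. bump m y * f (inv y \<otimes> x)) - (LINT y|\<mu>. bump m y * f x)"
    unfolding right_diff_distrib
    by (intro Bochner_Integration.integral_diff Cc_integrable conv_integrand Cc_bump assms integrable_mult_left)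
  then show ?thesis by (simp add: convolution_def integral_bump)
qed

lemma conv_bump_bump: "conv (bump m) (bump m) = bump m"
proof
  fix x
  have 0: "bump m y * (bump m (inv y \<otimes> x) - bump m x) = 0" for y
    using bump_mult_left[OF K_inv, of y m x] by (auto simp: bump_def)
  then show "conv (bump m) (bump m) x = bump m x"
    using conv_bump_diff[OF Cc_bump, of m m x] by (simp only: 0) simp
qed

lemma conv_shift_left:
  assumes "f \<in> Cc" "h \<in> Cc"
  shows "conv (shift g f) h = shift g (conv f h)"
proof
  fix x
  have "(\<lambda>y. shift g f y * h (inv y \<otimes> x)) \<in> borel_measurable borel"
    by (intro Cc_measurable conv_integrand Cc_shift assms)
  from integral_left[OF this, of g] show "conv (shift g f) h x = shift g (conv f h) x"
    by (simp add: convolution_def shift_def inv_mult_eq m_assoc)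
qed

text \<open>Right invariance moves the translation onto the bump, which absorbs elements of
  \<open>K m\<close> from either side. On the operator side this becomes \<open>P_u\<close>.\<close>

lemma conv_bump_shift:
  assumes f: "f \<in> Cc" and k: "k \<in> K m"
  shows "conv (bump m) (shift k f) = conv (bump m) f"
proof
  fix x
  have "(\<lambda>y. bump m y * shift k f (inv y \<otimes> x)) \<in> borel_measurable borel"
    by (intro Cc_measurable conv_integrand Cc_bump Cc_shift f)
  from integral_right[OF this, of "inv k"] show "conv (bump m) (shift k f) x = conv (bump m) f x"
    by (simp add: convolution_def shift_def inv_mult_eq m_assoc bump_mult_right[OF K_inv[OF k]])
qed

lemma shift_bump: "k \<in> K m \<Longrightarrow> shift k (bump m) = bump m"
  by (simp add: shift_def bump_mult_left[OF K_inv])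

lemma L1_shift: "f \<in> Cc \<Longrightarrow> L1 (shift g f) = L1 f"
  unfolding L1_def shift_def
  by (rule integral_left) (intro borel_measurable_continuous_onI continuous_on_norm Cc_continuous)

lemma L1_conv_bump_tendsto:
  assumes f: "f \<in> Cc"
  shows "(\<lambda>m. L1 (\<lambda>x. conv (bump m) f x - f x)) \<longlonglongrightarrow> 0"
proof (rule LIMSEQ_I)
  fix e :: real assume e: "e > 0"
  obtain Q where Q: "continuous_on UNIV f" "compact Q" "\<And>x. x \<notin> Q \<Longrightarrow> f x = 0" using f unfolding Cc_iff by blast
  \<comment> \<open>One compact set supports all the differences, since every \<open>K m\<close> is
    contained in \<open>K 0\<close>; thus a uniform estimate yields an L1 estimate with a factor
    independent of \<open>m\<close>.\<close>
  define A where "A = (\<lambda>(x, y). x \<otimes> y) ` (K 0 \<times> Q)"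
  have A: "compact A" unfolding A_def by (rule compact_group_mult[OF K_compact Q(2)])
  define d where "d = e / (measure \<mu> A + 1)"
  have d: "d > 0" using e by (simp add: d_def add_nonneg_pos)
  obtain M where M: "\<And>k x. k \<in> K M \<Longrightarrow> cmod (f (k \<otimes> x) - f x) < d"
    using Cc_uniform_left[OF f d] by blast
  have "norm (L1 (\<lambda>x. conv (bump m) f x - f x) - 0) < e" if m: "m \<ge> M" for m
  proof -
    let ?g = "\<lambda>x. conv (bump m) f x - f x"
    have 0: "?g x = 0" if "x \<notin> A" for x
    proof -
      have 1: "f (k \<otimes> x) = 0" if k: "k \<in> K 0" for k
      proof (rule ccontr)
        assume "f (k \<otimes> x) \<noteq> 0"
        then have "k \<otimes> x \<in> Q" using Q(3) by blast
        then have "x \<in> A" unfolding A_def using K_inv[OF k] by (intro image_eqI[of _ _ "(inv k, k \<otimes> x)"]) auto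
        with \<open>x \<notin> A\<close> show False ..
      qed
      have 0: "bump m y * (f (inv y \<otimes> x) - f x) = 0" for y
        using 1[OF subsetD[OF K_mono[of 0 m] K_inv, of y]] 1[of \<one>] by (auto simp: bump_def)
      then show ?thesis by (simp only: conv_bump_diff[OF f] 0) simp
    qed
    have le: "cmod (?g x) \<le> d" for x
    proof -
      have "cmod (?g x) \<le> (LINT y|\<mu>. cmod (bump m y * (f (inv y \<otimes> x) - f x)))"
        unfolding conv_bump_diff[OF f] by (rule integral_norm_bound)
      also have "\<dots> \<le> (LINT y|\<mu>. d * cmod (bump m y))"
      proof (rule integral_mono)
        show "integrable \<mu> (\<lambda>y. cmod (bump m y * (f (inv y \<otimes> x) - f x)))"
          unfolding right_diff_distrib
          by (intro integrable_norm Bochner_Integration.integrable_diff Cc_integrable conv_integrand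
              Cc_mult_continuous Cc_bump f continuous_on_const)
        show "integrable \<mu> (\<lambda>y. d * cmod (bump m y))"
          by (intro integrable_mult_right integrable_norm Cc_integrable Cc_bump)
        show "cmod (bump m y * (f (inv y \<otimes> x) - f x)) \<le> d * cmod (bump m y)" for y
        proof (cases "y \<in> K m")
          case True
          then have "inv y \<in> K M" using K_inv K_mono[OF m] by blast
          from M[OF this, of x] show ?thesis
            by (simp add: norm_mult mult.commute[of d] mult_left_mono less_imp_le)
        qed (simp add: bump_def)
      qed
      also have "\<dots> = d * L1 (bump m)" by (simp add: L1_def)
      finally show ?thesis by (simp add: L1_bump)
    qed
    have "L1 ?g \<le> d * measure \<mu> A"
    proof (rule L1_bound(2))
      show "continuous_on UNIV ?g" by (intro Cc_continuous Cc_diff Cc_conv Cc_bump f)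
    qed (use A 0 le in auto)
    also have "\<dots> < e" using e by (simp add: d_def field_simps add_pos_nonneg)
    finally show ?thesis using L1_nonneg[of ?g] by simp
  qed
  then show "\<exists>M. \<forall>m\<ge>M. norm (L1 (\<lambda>x. conv (bump m) f x - f x) - 0) < e" by blast
qed

text \<open>The bound \<open>C\<close> on the coefficients is chosen before \<open>e\<close> and
  \<open>m\<close>: \<open>card X * vol m\<close> never exceeds the measure of a fixed compact set.
  This uniformity is what later allows \<open>P m v\<close> to be replaced by \<open>v\<close>
  inside the sums.\<close>

lemma step_approximation:
  assumes f: "f \<in> Cc"
  shows "\<exists>C. \<forall>e>0. \<exists>M. \<forall>m\<ge>M. \<exists>X c. finite X \<and> (\<Sum>x\<in>X. cmod (c x)) \<le> C \<and>
    L1 (\<lambda>y. f y - (\<Sum>x\<in>X. c x * shift x (bump m) y)) < e"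
proof -
  obtain Q where Q: "continuous_on UNIV f" "compact Q" "\<And>x. x \<notin> Q \<Longrightarrow> f x = 0" using f unfolding Cc_iff by blast
  obtain B where B: "B \<ge> 0" "\<And>x. cmod (f x) \<le> B" using bounded_off_compact[OF Q] by blast
  define A where "A = (\<lambda>(x, y). x \<otimes> y) ` (Q \<times> K 0)"
  have A: "compact A" unfolding A_def by (rule compact_group_mult[OF Q(2) K_compact])
  have "\<exists>M. \<forall>m\<ge>M. \<exists>X c. finite X \<and> (\<Sum>x\<in>X. cmod (c x)) \<le> B * measure \<mu> A \<and>
    L1 (\<lambda>y. f y - (\<Sum>x\<in>X. c x * shift x (bump m) y)) < e" if e: "e > 0" for e :: real
  proof -
    define d where "d = e / (measure \<mu> A + 1)"
    have d: "d > 0" using e by (simp add: d_def add_nonneg_pos)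
    obtain M where M: "\<And>k x. k \<in> K M \<Longrightarrow> cmod (f (x \<otimes> k) - f x) < d"
      using Cc_uniform_right[OF f d] by blast
    have "\<exists>X c. finite X \<and> (\<Sum>x\<in>X. cmod (c x)) \<le> B * measure \<mu> A \<and>
        L1 (\<lambda>y. f y - (\<Sum>x\<in>X. c x * shift x (bump m) y)) < e" if m: "m \<ge> M" for m
    proof -
      obtain X where X: "finite X" "X \<subseteq> Q" "Q \<subseteq> (\<Union>x\<in>X. coset x m)" "disjoint_family_on (\<lambda>x. coset x m) X"
        by (rule finite_disjoint_cosets[OF Q(2)])
      \<comment> \<open>The factor \<open>vol m\<close> undoes the normalization of the bump, so the
        combination takes the value \<open>f x\<close> on \<open>coset x m\<close>.\<close>
      define c where "c x = f x * complex_of_real (vol m)" for x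
      have sub: "coset x m \<subseteq> A" if "x \<in> X" for x
        using that X(2) K_mono[of 0 m] unfolding A_def coset_image by force
      have "real (card X) * vol m = (\<Sum>x\<in>X. measure \<mu> (coset x m))"
        by (simp add: measure_def emeasure_coset vol_def)
      also have "\<dots> = measure \<mu> (\<Union>x\<in>X. coset x m)"
        by (rule measure_finite_Union[symmetric]) (use X open_coset in \<open>auto simp: emeasure_coset emeasure_K\<close>)
      also have "\<dots> \<le> measure \<mu> A"
      proof (rule measure_mono_fmeasurable)
        have "open (\<Union>x\<in>X. coset x m)" using open_coset by blast
        then show "(\<Union>x\<in>X. coset x m) \<in> sets \<mu>" by simp
        show "A \<in> fmeasurable \<mu>" using haar_compact[OF A] compact_in_borel[OF A] by (intro fmeasurableI) auto
      qed (use sub in auto)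
      finally have card: "real (card X) * vol m \<le> measure \<mu> A" .
      have "(\<Sum>x\<in>X. cmod (c x)) \<le> (\<Sum>x\<in>X. B * vol m)"
        using B vol_pos[of m] by (intro sum_mono) (simp add: c_def norm_mult mult_right_mono)
      also have "\<dots> = B * (real (card X) * vol m)" by simp
      also have "\<dots> \<le> B * measure \<mu> A" using card B(1) by (intro mult_left_mono)
      finally have c: "(\<Sum>x\<in>X. cmod (c x)) \<le> B * measure \<mu> A" .
      let ?g = "\<lambda>y. f y - (\<Sum>x\<in>X. c x * shift x (bump m) y)"
      have term_eq: "c x * shift x (bump m) y = (if y \<in> coset x m then f x else 0)" for x y
        using vol_pos[of m] by (simp add: c_def shift_def bump_def coset_def)
      have g: "?g y = f y - f x" if "x \<in> X" "y \<in> coset x m" for x y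
      proof -
        have "(\<Sum>x'\<in>X. c x' * shift x' (bump m) y) = (\<Sum>x'\<in>X. if x' = x then f x else 0)"
        proof (rule sum.cong)
          fix x' assume "x' \<in> X"
          then show "c x' * shift x' (bump m) y = (if x' = x then f x else 0)"
            using that X(4) unfolding term_eq disjoint_family_on_def by auto
        qed simp
        then show ?thesis using X(1) that(1) by simp
      qed
      have out: "?g y = 0" if "\<And>x. x \<in> X \<Longrightarrow> y \<notin> coset x m" for y
      proof -
        have "y \<notin> Q" using X(3) that by blast
        then show ?thesis using that Q(3) by (simp add: term_eq)
      qed
      have "L1 ?g \<le> d * measure \<mu> A"
      proof (rule L1_bound(2)[OF _ A])
        show "continuous_on UNIV ?g"
          by (intro Cc_continuous Cc_diff f Cc_sum Cc_scale Cc_shift Cc_bump)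
        show "?g y = 0" if "y \<notin> A" for y using out sub that by blast
        show "cmod (?g y) \<le> d" for y
        proof (cases "\<exists>x\<in>X. y \<in> coset x m")
          case True
          then obtain x where x: "x \<in> X" "y \<in> coset x m" by blast
          have "inv x \<otimes> y \<in> K M" using x(2) K_mono[OF m] by (auto simp: coset_def)
          from M[OF this, of x] show ?thesis unfolding g[OF x] by simp
        next
          case False
          then have "?g y = 0" by (intro out) auto
          then show ?thesis using d by simp
        qed
      qed
      also have "\<dots> < e" using e by (simp add: d_def field_simps add_pos_nonneg)
      finally show ?thesis using X(1) c by blast
    qed
    then show ?thesis by blast
  qed
  then show ?thesis by blast
qed

end

section \<open>Complex Hilbert spaces\<close>

lemma scaleC_one [simp]: "scaleC 1 x = (x :: 'a::complex_hilbert)"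
  using scaleC_of_real[of 1 x] by simp

global_interpretation complex_vector: vector_space "scaleC :: complex \<Rightarrow> 'a \<Rightarrow> 'a::complex_hilbert"
  by standard (simp_all add: scaleC_add_right scaleC_add_left scaleC_scaleC)

lemmas scaleC_simps [simp] = complex_vector.scale_zero_left complex_vector.scale_zero_right

lemma cinner_add_right: "cinner x (y + z) = cinner x y + cinner x (z :: 'a::complex_hilbert)"
  by (metis cinner_add_left cinner_commute complex_cnj_add)

lemma cinner_scaleC_right: "cinner x (scaleC a y) = cnj a * cinner x (y :: 'a::complex_hilbert)"
  by (metis cinner_scaleC_left cinner_commute complex_cnj_mult)

lemma cinner_zero [simp]: "cinner 0 x = 0" "cinner x (0 :: 'a::complex_hilbert) = 0"
  using cinner_scaleC_left[of 0 x x] cinner_scaleC_right[of x 0 x] by simp_all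

lemma cinner_diff: "cinner (x - y) z = cinner x z - cinner y z"
  "cinner z (x - y) = cinner z x - cinner z (y :: 'a::complex_hilbert)"
  using cinner_add_left[of "x - y" y z] cinner_add_right[of z "x - y" y] by simp_all

lemma norm_scaleC: "norm (scaleC a x) = cmod a * norm (x :: 'a::complex_hilbert)"
proof -
  have "complex_of_real ((norm (scaleC a x))\<^sup>2) = a * (cnj a * complex_of_real ((norm x)\<^sup>2))"
    by (simp only: cinner_self[symmetric] cinner_scaleC_left cinner_scaleC_right mult.left_commute)
  also have "\<dots> = complex_of_real ((cmod a * norm x)\<^sup>2)"
    by (simp only: power_mult_distrib of_real_mult complex_norm_square mult.assoc)
  finally have "(norm (scaleC a x))\<^sup>2 = (cmod a * norm x)\<^sup>2" by (simp only: of_real_eq_iff)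
  then show ?thesis by (simp add: power2_eq_iff_nonneg)
qed

lemma norm_sq_cinner: "(norm x)\<^sup>2 = Re (cinner x (x :: 'a::complex_hilbert))"
  by (simp add: cinner_self)

lemma Cauchy_Schwarz_cinner: "cmod (cinner x y) \<le> norm x * norm (y :: 'a::complex_hilbert)"
proof (cases "y = 0")
  case False
  define c where "c = cinner x y / complex_of_real ((norm y)\<^sup>2)"
  have ny: "norm y > 0" using False by simp
  have "cinner (x - scaleC c y) y = 0"
    using ny by (simp add: cinner_diff cinner_scaleC_left c_def cinner_self)
  then have "cinner (x - scaleC c y) (x - scaleC c y) = cinner (x - scaleC c y) x"
    by (simp add: cinner_diff(2) cinner_scaleC_right)
  also have "\<dots> = cinner x x - c * cnj (cinner x y)"
    by (simp add: cinner_diff(1) cinner_scaleC_left cinner_commute[of y x])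
  also have "c * cnj (cinner x y) = complex_of_real ((cmod (cinner x y))\<^sup>2 / (norm y)\<^sup>2)"
    unfolding c_def of_real_divide complex_norm_square by simp
  finally have "complex_of_real ((norm (x - scaleC c y))\<^sup>2)
      = complex_of_real ((norm x)\<^sup>2 - (cmod (cinner x y))\<^sup>2 / (norm y)\<^sup>2)"
    by (simp only: cinner_self of_real_diff)
  then have "(norm (x - scaleC c y))\<^sup>2 = (norm x)\<^sup>2 - (cmod (cinner x y))\<^sup>2 / (norm y)\<^sup>2"
    by (simp only: of_real_eq_iff)
  then have "(cmod (cinner x y))\<^sup>2 / (norm y)\<^sup>2 \<le> (norm x)\<^sup>2"
    by (metis diff_ge_0_iff_ge zero_le_power2)
  then have "(cmod (cinner x y))\<^sup>2 \<le> (norm x * norm y)\<^sup>2"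
    using ny by (simp add: field_simps)
  then show ?thesis by (rule power2_le_imp_le) simp
qed simp

lemma bounded_linear_cinner_left: "bounded_linear (\<lambda>x. cinner x (w :: 'a::complex_hilbert))"
proof (rule bounded_linear_intro)
  show "cinner (r *\<^sub>R x) w = r *\<^sub>R cinner x w" for r x
    by (simp add: scaleC_of_real[symmetric] cinner_scaleC_left scaleR_conv_of_real)
  show "norm (cinner x w) \<le> norm x * norm w" for x by (rule Cauchy_Schwarz_cinner)
qed (simp add: cinner_add_left)

subsection \<open>The Riesz representation theorem for square-summable families\<close>

lift_definition ell2_unit :: "'i \<Rightarrow> 'i ell2" is "\<lambda>i j. if j = i then 1 else 0"
  by (rule finite_nonzero_values_imp_summable_on, rule finite_subset[of _ "{i}" for i]) auto

definition ell2_trunc :: "'i set \<Rightarrow> 'i ell2 \<Rightarrow> 'i ell2" where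
  "ell2_trunc F x = (\<Sum>i\<in>F. scaleC (ell2_nth x i) (ell2_unit i))"

lemma ell2_nth_sum: "ell2_nth (sum f A) j = (\<Sum>i\<in>A. ell2_nth (f i) j)"
  by (induction A rule: infinite_finite_induct) (simp_all add: zero_ell2.rep_eq plus_ell2.rep_eq)

lemma ell2_nth_combination:
  assumes "finite F"
  shows "ell2_nth (\<Sum>i\<in>F. scaleC (a i) (ell2_unit i)) j = (if j \<in> F then a j else 0)"
  using assms by (simp add: ell2_nth_sum scaleC_ell2.rep_eq ell2_unit.rep_eq if_distrib sum.delta cong: if_cong)

lemma norm_ell2_sq: "(norm x)\<^sup>2 = (\<Sum>\<^sub>\<infinity>i. (cmod (ell2_nth x i))\<^sup>2)"
  by (simp add: norm_ell2_def infsum_nonneg)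

lemma infsum_finite_support:
  fixes f :: "'a \<Rightarrow> 'b::{topological_comm_monoid_add,t2_space}"
  assumes "finite F" "\<And>i. i \<notin> F \<Longrightarrow> f i = 0"
  shows "infsum f UNIV = sum f F"
proof -
  have "infsum f UNIV = infsum f F" by (rule infsum_cong_neutral) (use assms in auto)
  then show ?thesis using assms by simp
qed

lemma ell2_trunc_approx:
  assumes "e > 0"
  obtains F where "finite F" "norm (x - ell2_trunc F x) < e"
proof -
  let ?f = "\<lambda>i. (cmod (ell2_nth x i))\<^sup>2"
  obtain F where F: "finite F" "dist (sum ?f F) (infsum ?f UNIV) \<le> e\<^sup>2 / 2"
    using infsum_finite_approximation[OF ell2_summable, of "e\<^sup>2 / 2" x] assms by auto
  let ?g = "\<lambda>i. if i \<in> F then ?f i else 0"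
  have g: "?g summable_on UNIV" "infsum ?g UNIV = sum ?f F"
    using F(1) by (auto intro!: finite_nonzero_values_imp_summable_on simp: infsum_finite_support[of F])
  have "(norm (x - ell2_trunc F x))\<^sup>2 = (\<Sum>\<^sub>\<infinity>i. ?f i + - ?g i)"
    unfolding norm_ell2_sq ell2_trunc_def minus_ell2.rep_eq ell2_nth_combination[OF F(1)]
    by (intro infsum_cong) auto
  also have "\<dots> = infsum ?f UNIV + - infsum ?g UNIV"
    using g(1) by (subst infsum_add) (auto intro!: ell2_summable simp: infsum_uminus summable_on_uminus)
  also have "\<dots> \<le> e\<^sup>2 / 2" using F(2) g(2) unfolding dist_real_def by linarith
  also have "\<dots> < e\<^sup>2" using assms by simp
  finally show ?thesis using assms by (intro that[OF F(1)]) (rule power2_less_imp_less, auto)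
qed

text \<open>The coordinates of \<open>r\<close> are the values of \<open>B\<close> on the unit
  vectors. Testing \<open>B\<close> on a finite truncation of that family gives
  \<open>S \<le> C * sqrt S\<close> for the partial sum \<open>S\<close> of squares, hence square
  summability and the norm bound; density of truncations does the rest. \<open>B\<close> is
  conjugate linear since it stands for a matrix coefficient as a function of its second
  vector.\<close>

lemma ell2_riesz:
  fixes B :: "'i ell2 \<Rightarrow> complex"
  assumes add: "\<And>x y. B (x + y) = B x + B y" and scale: "\<And>c x. B (scaleC c x) = cnj c * B x"
    and bound: "\<And>x. cmod (B x) \<le> C * norm x"
  obtains r where "\<And>w. B w = cinner r w" "norm r \<le> C"
proof -
  have B0: "B 0 = 0" using scale[of 0 0] by simp
  have Bsum: "B (sum f A) = (\<Sum>i\<in>A. B (f i))" for f and A :: "'i set"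
    by (induction A rule: infinite_finite_induct) (simp_all add: B0 add)
  define a where "a i = B (ell2_unit i)" for i
  have C: "0 \<le> C"
  proof -
    have "norm (ell2_unit undefined :: 'i ell2) > 0"
    proof -
      have "ell2_nth (ell2_unit undefined :: 'i ell2) undefined \<noteq> ell2_nth 0 undefined"
        by (simp add: ell2_unit.rep_eq zero_ell2.rep_eq)
      then show ?thesis by auto
    qed
    moreover have "0 \<le> C * norm (ell2_unit undefined :: 'i ell2)" using bound norm_ge_zero order_trans by blast
    ultimately show ?thesis by (simp add: zero_le_mult_iff)
  qed
  have le: "(\<Sum>i\<in>F. (cmod (a i))\<^sup>2) \<le> C\<^sup>2" if F: "finite F" for F
  proof -
    have sq: "cnj z * z = complex_of_real ((cmod z)\<^sup>2)" for z by (metis complex_norm_square mult.commute)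
    let ?S = "\<Sum>i\<in>F. (cmod (a i))\<^sup>2"
    let ?v = "\<Sum>i\<in>F. scaleC (a i) (ell2_unit i)"
    have S0: "?S \<ge> 0" by (intro sum_nonneg) auto
    have "(norm ?v)\<^sup>2 = ?S"
      unfolding norm_ell2_sq ell2_nth_combination[OF F] using F
      by (subst infsum_finite_support[of F]) auto
    then have nv: "norm ?v = sqrt ?S" by (simp add: real_sqrt_unique)
    have "B ?v = complex_of_real ?S"
      by (simp only: Bsum scale a_def[symmetric] sq of_real_sum)
    then have "cmod (B ?v) = ?S" using S0 by (simp only: norm_of_real abs_of_nonneg)
    then have "?S \<le> C * sqrt ?S" using bound[of ?v] unfolding nv by simp
    then have "sqrt ?S * sqrt ?S \<le> C * sqrt ?S" using S0 by simp
    then have "sqrt ?S \<le> C"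
      using C S0 mult_right_le_imp_le[of "sqrt ?S" "sqrt ?S" C] by (cases "sqrt ?S = 0") force+
    then show ?thesis using S0 by (metis real_sqrt_le_iff real_sqrt_abs abs_of_nonneg C)
  qed
  define r where "r = Abs_ell2 a"
  have r: "ell2_nth r = a"
    unfolding r_def using ell2_bdd_summable[OF le] by (simp add: Abs_ell2_inverse)
  have nr: "norm r \<le> C"
  proof (rule ell2_norm_le)
    fix F :: "'i set" assume "finite F"
    from le[OF this] show "L2_set (\<lambda>i. cmod (ell2_nth r i)) F \<le> C"
      unfolding L2_set_def r using C by (simp add: real_le_lsqrt sum_nonneg)
  qed
  have unit: "cinner r (ell2_unit i) = B (ell2_unit i)" for i
  proof -
    have "cinner r (ell2_unit i) = (\<Sum>j\<in>{i}. a j * cnj (ell2_nth (ell2_unit i) j))"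
      unfolding cinner_ell2_def r by (rule infsum_finite_support) (auto simp: ell2_unit.rep_eq)
    then show ?thesis by (simp add: ell2_unit.rep_eq a_def)
  qed
  have csum: "cinner r (sum f A) = (\<Sum>i\<in>A. cinner r (f i))" for f and A :: "'i set"
    by (induction A rule: infinite_finite_induct) (simp_all add: cinner_add_right)
  have trunc: "B (ell2_trunc F w) = cinner r (ell2_trunc F w)" for F w
    unfolding ell2_trunc_def by (simp add: Bsum csum scale cinner_scaleC_right unit)
  have "B w = cinner r w" for w
  proof -
    have "cmod (B w - cinner r w) \<le> 0 + e" if e: "e > 0" for e
    proof -
      \<comment> \<open>\<open>B\<close> and \<open>cinner r\<close> contribute \<open>C\<close>
        each; the added 1 covers \<open>C = 0\<close>.\<close>
      have e': "e / (2 * C + 1) > 0" using e C by (simp add: add_nonneg_pos)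
      obtain F where F: "finite F" "norm (w - ell2_trunc F w) < e / (2 * C + 1)"
        by (rule ell2_trunc_approx[OF e'])
      let ?d = "w - ell2_trunc F w"
      have "B w = B ?d + B (ell2_trunc F w)" by (simp flip: add)
      moreover have "cinner r w = cinner r ?d + cinner r (ell2_trunc F w)" by (simp flip: cinner_add_right)
      ultimately have "cmod (B w - cinner r w) = cmod (B ?d - cinner r ?d)" by (simp add: trunc)
      also have "\<dots> \<le> cmod (B ?d) + cmod (cinner r ?d)" by (rule norm_triangle_ineq4)
      also have "\<dots> \<le> C * norm ?d + C * norm ?d"
        using bound[of ?d] Cauchy_Schwarz_cinner[of r ?d] mult_right_mono[OF nr norm_ge_zero, of ?d] by linarith
      also have "\<dots> \<le> (2 * C + 1) * norm ?d" by (simp add: distrib_right)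
      also have "\<dots> \<le> e" using F(2) C by (simp add: field_simps)
      finally show ?thesis by simp
    qed
    then have "cmod (B w - cinner r w) \<le> 0" by (rule field_le_epsilon)
    then show ?thesis by simp
  qed
  with nr show ?thesis using that by blast
qed

section \<open>The universal norm\<close>

context td_group
begin

abbreviation "un \<equiv> universal_norm G euclidean \<mu>"

text \<open>A matrix coefficient of the integrated operator of \<open>f\<close>. The image of
  \<open>v\<close> under that operator is recovered by Riesz where a vector is required, in
  \<open>un_conv\<close>.\<close>

definition coef :: "('g \<Rightarrow> 'h::complex_hilbert \<Rightarrow> 'h) \<Rightarrow> ('g \<Rightarrow> complex) \<Rightarrow> 'h \<Rightarrow> 'h \<Rightarrow> complex" where
  "coef u f v w = (LINT x|\<mu>. f x * cinner (u x v) w)"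

lemma unitary_repD:
  assumes "unitary_rep G euclidean u"
  shows unitary_rep_mult: "u (x \<otimes> y) v = u x (u y v)"
    and unitary_rep_cinner: "cinner (u x v) (u x w) = cinner v w"
    and unitary_rep_add: "u x (v + w) = u x v + u x w"
    and unitary_rep_scale: "u x (scaleC c v) = scaleC c (u x v)"
    and unitary_rep_cont: "continuous_on UNIV (\<lambda>x. u x v)"
  using assms by (auto simp: unitary_rep_def unitary_map_def clinear_map_def)

lemma unitary_rep_norm:
  assumes "unitary_rep G euclidean u"
  shows "norm (u x v) = norm v"
proof -
  have "(norm (u x v))\<^sup>2 = (norm v)\<^sup>2" by (simp add: norm_sq_cinner unitary_repD[OF assms])
  then show ?thesis by (simp add: power2_eq_iff_nonneg)
qed

text \<open>\<open>u \<one>\<close> is idempotent, linear and isometric, hence the identity.\<close>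

lemma unitary_rep_one:
  assumes u: "unitary_rep G euclidean u"
  shows "u \<one> v = v"
proof -
  have diff: "u x (a - b) = u x a - u x b" for x a b
    using unitary_rep_add[OF u, of x "a - b" b] by simp
  have "u \<one> (u \<one> v) = u \<one> v" using unitary_rep_mult[OF u, of \<one> \<one> v] by simp
  then have "norm (u \<one> v - v) = 0" using unitary_rep_norm[OF u, of \<one> "u \<one> v - v"] by (simp add: diff)
  then show ?thesis by simp
qed

lemma unitary_rep_adjoint:
  assumes u: "unitary_rep G euclidean u"
  shows "cinner (u x v) w = cinner v (u (inv x) w)"
proof -
  have "w = u x (u (inv x) w)" using unitary_rep_mult[OF u, of x "inv x" w] by (simp add: unitary_rep_one[OF u])
  then show ?thesis by (metis unitary_rep_cinner[OF u])
qed

lemma continuous_coef_function: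
  assumes u: "unitary_rep G euclidean u"
  shows "continuous_on UNIV (\<lambda>x. cinner (u x v) w)"
  by (rule bounded_linear.continuous_on[OF bounded_linear_cinner_left unitary_rep_cont[OF u]])

lemma coef_integrand:
  assumes "unitary_rep G euclidean u" "f \<in> Cc"
  shows "(\<lambda>x. f x * cinner (u x v) w) \<in> Cc"
  by (rule Cc_mult_continuous[OF assms(2) continuous_coef_function[OF assms(1)]])

lemma coef_le_L1:
  assumes u: "unitary_rep G euclidean u" and f: "f \<in> Cc"
  shows "cmod (coef u f v w) \<le> L1 f * norm v * norm w"
proof -
  have "cmod (coef u f v w) \<le> (LINT x|\<mu>. cmod (f x * cinner (u x v) w))"
    unfolding coef_def by (rule integral_norm_bound)
  also have "\<dots> \<le> (LINT x|\<mu>. cmod (f x) * (norm v * norm w))"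
  proof (rule integral_mono)
    show "integrable \<mu> (\<lambda>x. cmod (f x * cinner (u x v) w))"
      by (intro integrable_norm Cc_integrable coef_integrand u f)
    show "integrable \<mu> (\<lambda>x. cmod (f x) * (norm v * norm w))"
      by (intro integrable_mult_left integrable_norm Cc_integrable f)
    show "cmod (f x * cinner (u x v) w) \<le> cmod (f x) * (norm v * norm w)" for x
      using Cauchy_Schwarz_cinner[of "u x v" w] unitary_rep_norm[OF u, of x v]
      by (simp add: norm_mult mult_left_mono)
  qed
  also have "\<dots> = L1 f * norm v * norm w" by (simp add: L1_def)
  finally show ?thesis .
qed

lemma universal_norm_coef:
  "un f = (SUP (u, v, w) \<in> {(u :: 'g \<Rightarrow> ('g \<Rightarrow> complex) ell2 \<Rightarrow> ('g \<Rightarrow> complex) ell2, v, w).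
    unitary_rep G euclidean u \<and> norm v \<le> 1 \<and> norm w \<le> 1}. cmod (coef u f v w))"
  by (simp add: universal_norm_def coef_def)

lemma unitary_rep_trivial: "unitary_rep G euclidean (\<lambda>x v. v)"
  by (auto simp: unitary_rep_def unitary_map_def clinear_map_def)

lemma un_least:
  assumes "\<And>(u :: 'g \<Rightarrow> ('g \<Rightarrow> complex) ell2 \<Rightarrow> _) v w.
    unitary_rep G euclidean u \<Longrightarrow> norm v \<le> 1 \<Longrightarrow> norm w \<le> 1 \<Longrightarrow> cmod (coef u f v w) \<le> c"
  shows "un f \<le> c"
  unfolding universal_norm_coef
proof (rule cSUP_least)
  show "{(u :: 'g \<Rightarrow> ('g \<Rightarrow> complex) ell2 \<Rightarrow> ('g \<Rightarrow> complex) ell2, v, w).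
    unitary_rep G euclidean u \<and> norm v \<le> 1 \<and> norm w \<le> 1} \<noteq> {}"
    using unitary_rep_trivial by (auto intro!: exI[of _ "\<lambda>x v. v"] exI[of _ 0])
qed (use assms in auto)

lemma un_upper_unit:
  fixes u :: "'g \<Rightarrow> ('g \<Rightarrow> complex) ell2 \<Rightarrow> ('g \<Rightarrow> complex) ell2"
  assumes f: "f \<in> Cc" and u: "unitary_rep G euclidean u" "norm v \<le> 1" "norm w \<le> 1"
  shows "cmod (coef u f v w) \<le> un f"
proof -
  let ?S = "{(u :: 'g \<Rightarrow> ('g \<Rightarrow> complex) ell2 \<Rightarrow> ('g \<Rightarrow> complex) ell2, v, w).
    unitary_rep G euclidean u \<and> norm v \<le> 1 \<and> norm w \<le> 1}"
  have "bdd_above ((\<lambda>(u, v, w). cmod (coef u f v w)) ` ?S)"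
  proof (rule bdd_aboveI[of _ "L1 f"])
    fix y assume "y \<in> (\<lambda>(u, v, w). cmod (coef u f v w)) ` ?S"
    then obtain u :: "'g \<Rightarrow> ('g \<Rightarrow> complex) ell2 \<Rightarrow> ('g \<Rightarrow> complex) ell2" and v w
      where *: "unitary_rep G euclidean u" "norm v \<le> 1" "norm w \<le> 1" "y = cmod (coef u f v w)" by auto
    have "y \<le> L1 f * norm v * norm w" using coef_le_L1[OF *(1) f] *(4) by simp
    also have "\<dots> \<le> L1 f * 1 * 1" using * L1_nonneg[of f] by (intro mult_mono) auto
    finally show "y \<le> L1 f" by simp
  qed
  from cSUP_upper[OF _ this, of "(u, v, w)"] u show ?thesis
    unfolding universal_norm_coef by auto
qed

lemma coef_scale:
  assumes u: "unitary_rep G euclidean u"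
  shows "coef u f (scaleC a v) (scaleC b w) = a * cnj b * coef u f v w"
proof -
  have "coef u f (scaleC a v) (scaleC b w) = (LINT x|\<mu>. (a * cnj b) * (f x * cinner (u x v) w))"
    unfolding coef_def
    by (intro Bochner_Integration.integral_cong refl)
      (simp add: unitary_rep_scale[OF u] cinner_scaleC_left cinner_scaleC_right)
  then show ?thesis by (simp add: coef_def)
qed

lemma un_upper:
  fixes u :: "'g \<Rightarrow> ('g \<Rightarrow> complex) ell2 \<Rightarrow> ('g \<Rightarrow> complex) ell2"
  assumes f: "f \<in> Cc" and u: "unitary_rep G euclidean u"
  shows "cmod (coef u f v w) \<le> un f * norm v * norm w"
proof (cases "v = 0 \<or> w = 0")
  case True
  have "u x 0 = 0" for x using unitary_rep_norm[OF u, of x 0] by simp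
  with True show ?thesis by (auto simp: coef_def)
next
  case False
  let ?v = "scaleC (complex_of_real (1 / norm v)) v" and ?w = "scaleC (complex_of_real (1 / norm w)) w"
  have "cmod (coef u f v w) = (norm v * norm w) * cmod (coef u f ?v ?w)"
    using False by (simp add: coef_scale[OF u] norm_mult norm_divide)
  also have "\<dots> \<le> (norm v * norm w) * un f"
    using False by (intro mult_left_mono un_upper_unit f u) (simp_all add: norm_scaleC norm_divide)
  finally show ?thesis by (simp add: mult_ac)
qed

lemma un_nonneg: "f \<in> Cc \<Longrightarrow> un f \<ge> 0"
  using order_trans[OF norm_ge_zero un_upper_unit[OF _ unitary_rep_trivial, of f 0 0]] by simp

lemma un_le_L1: "f \<in> Cc \<Longrightarrow> un f \<le> L1 f"
proof (rule un_least)
  fix u :: "'g \<Rightarrow> ('g \<Rightarrow> complex) ell2 \<Rightarrow> ('g \<Rightarrow> complex) ell2" and v w :: "('g \<Rightarrow> complex) ell2"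
  assume f: "f \<in> Cc" and *: "unitary_rep G euclidean u" "norm v \<le> 1" "norm w \<le> 1"
  have "cmod (coef u f v w) \<le> L1 f * norm v * norm w" by (rule coef_le_L1[OF *(1) f])
  also have "\<dots> \<le> L1 f * 1 * 1" using * L1_nonneg[of f] by (intro mult_mono) auto
  finally show "cmod (coef u f v w) \<le> L1 f" by simp
qed

lemma un_add:
  assumes f: "f \<in> Cc" and h: "h \<in> Cc"
  shows "un (\<lambda>x. f x + h x) \<le> un f + un h"
proof (rule un_least)
  fix u :: "'g \<Rightarrow> ('g \<Rightarrow> complex) ell2 \<Rightarrow> ('g \<Rightarrow> complex) ell2" and v w :: "('g \<Rightarrow> complex) ell2"
  assume *: "unitary_rep G euclidean u" "norm v \<le> 1" "norm w \<le> 1"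
  have "coef u (\<lambda>x. f x + h x) v w = coef u f v w + coef u h v w"
    unfolding coef_def distrib_right
    by (intro Bochner_Integration.integral_add Cc_integrable coef_integrand * f h)
  then have "cmod (coef u (\<lambda>x. f x + h x) v w) \<le> cmod (coef u f v w) + cmod (coef u h v w)"
    by (simp add: norm_triangle_ineq)
  also have "\<dots> \<le> un f + un h" by (intro add_mono un_upper_unit f h *)
  finally show "cmod (coef u (\<lambda>x. f x + h x) v w) \<le> un f + un h" .
qed

lemma un_scale_le:
  assumes f: "f \<in> Cc"
  shows "un (\<lambda>x. c * f x) \<le> cmod c * un f"
proof (rule un_least)
  fix u :: "'g \<Rightarrow> ('g \<Rightarrow> complex) ell2 \<Rightarrow> ('g \<Rightarrow> complex) ell2" and v w :: "('g \<Rightarrow> complex) ell2"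
  assume *: "unitary_rep G euclidean u" "norm v \<le> 1" "norm w \<le> 1"
  have "coef u (\<lambda>x. c * f x) v w = c * coef u f v w"
    by (simp add: coef_def mult.assoc)
  then show "cmod (coef u (\<lambda>x. c * f x) v w) \<le> cmod c * un f"
    using un_upper_unit[OF f *] by (simp add: norm_mult mult_left_mono)
qed

lemma un_zero: "un (\<lambda>x. 0) = 0"
  using un_le_L1[OF Cc_zero] un_nonneg[OF Cc_zero] by (simp add: L1_def)

lemma un_minus_commute: "f \<in> Cc \<Longrightarrow> h \<in> Cc \<Longrightarrow> un (\<lambda>x. f x - h x) = un (\<lambda>x. h x - f x)"
  using un_scale_le[OF Cc_diff, of f h "-1"] un_scale_le[OF Cc_diff, of h f "-1"] by simp

lemma un_triangle:
  assumes "f \<in> Cc" "h \<in> Cc" "k \<in> Cc"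
  shows "un (\<lambda>x. f x - k x) \<le> un (\<lambda>x. f x - h x) + un (\<lambda>x. h x - k x)"
  using un_add[OF Cc_diff[OF assms(1,2)] Cc_diff[OF assms(2,3)]] by simp

text \<open>The Riesz vector \<open>r\<close> is the integrated operator of \<open>h\<close> applied
  to \<open>v\<close>. The coefficient of the convolution at \<open>v\<close>, \<open>w\<close> is
  then the coefficient of \<open>f\<close> at \<open>r\<close>, \<open>w\<close>.\<close>

lemma un_conv:
  assumes f: "f \<in> Cc" and h: "h \<in> Cc"
  shows "un (conv f h) \<le> un f * un h"
proof (rule un_least)
  fix u :: "'g \<Rightarrow> ('g \<Rightarrow> complex) ell2 \<Rightarrow> ('g \<Rightarrow> complex) ell2" and v w :: "('g \<Rightarrow> complex) ell2"
  assume u: "unitary_rep G euclidean u" and v: "norm v \<le> 1" and w: "norm w \<le> 1"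
  obtain r where r: "\<And>w. coef u h v w = cinner r w" "norm r \<le> un h * norm v"
  proof (rule ell2_riesz[of "coef u h v" "un h * norm v"])
    show "coef u h v (x + y) = coef u h v x + coef u h v y" for x y
      unfolding coef_def cinner_add_right distrib_left
      by (intro Bochner_Integration.integral_add Cc_integrable coef_integrand u h)
    show "coef u h v (scaleC c x) = cnj c * coef u h v x" for c x
      using coef_scale[OF u, of h 1 v c x] by simp
  qed (use un_upper[OF h u] in auto)
  have "coef u (conv f h) v w = (LINT y|\<mu>. f y * (LINT x|\<mu>. h x * cinner (u (y \<otimes> x) v) w))"
    unfolding coef_def by (rule conv_integral[OF f h continuous_coef_function[OF u]])
  also have "\<dots> = (LINT y|\<mu>. f y * coef u h v (u (inv y) w))"
    by (simp add: coef_def unitary_rep_mult[OF u] unitary_rep_adjoint[OF u, of _ "u _ v"])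
  also have "\<dots> = coef u f r w"
    unfolding r by (simp add: coef_def unitary_rep_adjoint[OF u])
  finally have "cmod (coef u (conv f h) v w) \<le> un f * norm r * norm w"
    using un_upper[OF f u] by simp
  also have "\<dots> \<le> un f * (un h * 1) * 1"
    using r(2) v w un_nonneg[OF f] un_nonneg[OF h] mult_left_mono[OF v un_nonneg[OF h]]
    by (intro mult_mono) auto
  finally show "cmod (coef u (conv f h) v w) \<le> un f * un h" by simp
qed

lemma un_star:
  assumes f: "f \<in> Cc"
  shows "un (star f) \<le> un f"
proof (rule un_least)
  fix u :: "'g \<Rightarrow> ('g \<Rightarrow> complex) ell2 \<Rightarrow> ('g \<Rightarrow> complex) ell2" and v w :: "('g \<Rightarrow> complex) ell2"
  assume u: "unitary_rep G euclidean u" and v: "norm v \<le> 1" and w: "norm w \<le> 1"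
  have "coef u (star f) v w = (LINT x|\<mu>. star f (inv x) * cinner (u (inv x) v) w)"
    unfolding coef_def
    by (rule integral_inv[symmetric]) (intro Cc_measurable coef_integrand u Cc_star f)
  also have "\<dots> = (LINT x|\<mu>. cnj (f x * cinner (u x w) v))"
  proof (intro Bochner_Integration.integral_cong refl)
    fix x
    have "cinner (u (inv x) v) w = cnj (cinner (u x w) v)"
      using unitary_rep_adjoint[OF u, of x w v] cinner_commute[of w] by simp
    then show "star f (inv x) * cinner (u (inv x) v) w = cnj (f x * cinner (u x w) v)"
      by (simp add: star_eq)
  qed
  also have "\<dots> = cnj (coef u f w v)" unfolding coef_def by (rule Bochner_Integration.integral_cnj)
  finally show "cmod (coef u (star f) v w) \<le> un f" using un_upper_unit[OF f u w v] by simp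
qed

lemma star_star: "star (star f) = f"
  by (simp add: star_eq)

lemma star_diff: "star (\<lambda>x. f x - h x) = (\<lambda>x. star f x - star h x)"
  by (simp add: star_eq)

lemma star_conv:
  assumes f: "f \<in> Cc" and h: "h \<in> Cc"
  shows "star (conv f h) = conv (star h) (star f)"
proof
  fix x
  have "conv (star h) (star f) x = (LINT y|\<mu>. star h (x \<otimes> y) * star f (inv (x \<otimes> y) \<otimes> x))"
    unfolding convolution_def
    by (rule integral_left[symmetric]) (intro Cc_measurable conv_integrand Cc_star f h)
  also have "\<dots> = (LINT y|\<mu>. cnj (f y * h (inv y \<otimes> inv x)))"
    by (simp add: star_eq inv_mult_eq m_assoc mult.commute)
  also have "\<dots> = star (conv f h) x" unfolding star_eq convolution_def by (rule Bochner_Integration.integral_cnj)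
  finally show "star (conv f h) x = conv (star h) (star f) x" by simp
qed

end

section \<open>The group C*-algebra\<close>

text \<open>The operations of \<open>group_cstar\<close> take the image of a whole set of results
  computed from representatives. If all of these are equivalent to one of them, the image is the
  class of that one.\<close>

lemma Image_eq_classI:
  assumes "equiv A R" "a \<in> S" "\<And>b. b \<in> S \<Longrightarrow> (a, b) \<in> R"
  shows "R `` S = R `` {a}"
  using assms equivE[OF assms(1)] by (auto elim: transE symE dest: transD symD)

context td_group
begin

abbreviation "CS \<equiv> cauchy_sequences G euclidean \<mu>"
abbreviation "CE \<equiv> cauchy_equiv G euclidean \<mu>"
abbreviation "CA \<equiv> group_cstar G euclidean \<mu>"

lemma CS_iff: "F \<in> CS \<longleftrightarrow> (\<forall>k. F k \<in> Cc) \<and> (\<forall>e>0. \<exists>M. \<forall>i\<ge>M. \<forall>j\<ge>M. un (\<lambda>x. F i x - F j x) < e)"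
  by (simp add: cauchy_sequences_def)

lemma CS_Cc: "F \<in> CS \<Longrightarrow> F k \<in> Cc"
  by (simp add: CS_iff)

lemma CS_cauchy: "F \<in> CS \<Longrightarrow> e > 0 \<Longrightarrow> \<exists>M. \<forall>i\<ge>M. \<forall>j\<ge>M. un (\<lambda>x. F i x - F j x) < e"
  by (simp add: CS_iff)

lemma CE_iff: "(F, H) \<in> CE \<longleftrightarrow> F \<in> CS \<and> H \<in> CS \<and> (\<lambda>k. un (\<lambda>x. F k x - H k x)) \<longlonglongrightarrow> 0"
  by (simp add: cauchy_equiv_def)

lemma tendsto_zero_sandwich:
  assumes "\<And>k. 0 \<le> a k" "\<And>k. a k \<le> b k" "b \<longlonglongrightarrow> (0::real)"
  shows "a \<longlonglongrightarrow> 0"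
  by (rule tendsto_sandwich[OF _ _ tendsto_const assms(3)]) (use assms in auto)

lemma equiv_CE: "equiv CS CE"
proof (rule equivI)
  show "CE \<subseteq> CS \<times> CS" by (auto simp: CE_iff)
  show "refl_on CS CE"
    by (rule refl_onI) (auto simp: CE_iff un_zero)
  show "sym CE"
  proof (rule symI)
    fix F H assume *: "(F, H) \<in> CE"
    then have "(\<lambda>k. un (\<lambda>x. H k x - F k x)) = (\<lambda>k. un (\<lambda>x. F k x - H k x))"
      by (intro ext un_minus_commute) (auto simp: CE_iff CS_Cc)
    with * show "(H, F) \<in> CE" by (simp add: CE_iff)
  qed
  show "trans CE"
  proof (rule transI)
    fix F H L assume *: "(F, H) \<in> CE" "(H, L) \<in> CE"
    then have c: "F \<in> CS" "H \<in> CS" "L \<in> CS" by (auto simp: CE_iff)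
    have "(\<lambda>k. un (\<lambda>x. F k x - L k x)) \<longlonglongrightarrow> 0"
    proof (rule tendsto_zero_sandwich)
      show "0 \<le> un (\<lambda>x. F k x - L k x)" for k by (intro un_nonneg Cc_diff CS_Cc c)
      show "un (\<lambda>x. F k x - L k x) \<le> un (\<lambda>x. F k x - H k x) + un (\<lambda>x. H k x - L k x)" for k
        by (intro un_triangle CS_Cc c)
      show "(\<lambda>k. un (\<lambda>x. F k x - H k x) + un (\<lambda>x. H k x - L k x)) \<longlonglongrightarrow> 0"
        using * by (auto simp: CE_iff intro: tendsto_add_zero)
    qed
    with c show "(F, L) \<in> CE" by (simp add: CE_iff)
  qed
qed

lemma CS_const: "f \<in> Cc \<Longrightarrow> (\<lambda>_. f) \<in> CS"
  by (auto simp: CS_iff un_zero)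

lemma CS_offset: "F \<in> CS \<Longrightarrow> (\<lambda>k. F (k + M)) \<in> CS"
  unfolding CS_iff by (meson trans_le_add1)

text \<open>Discarding initial terms does not change the class, so an estimate that holds from some
  index on may be assumed for every index.\<close>

lemma CE_offset:
  assumes F: "F \<in> CS"
  shows "(F, \<lambda>k. F (k + M)) \<in> CE"
proof -
  have "(\<lambda>k. un (\<lambda>x. F k x - F (k + M) x)) \<longlonglongrightarrow> 0"
  proof (rule LIMSEQ_I)
    fix e :: real assume "e > 0"
    from CS_cauchy[OF F this] obtain L where L: "\<And>i j. i \<ge> L \<Longrightarrow> j \<ge> L \<Longrightarrow> un (\<lambda>x. F i x - F j x) < e" by blast
    have "norm (un (\<lambda>x. F k x - F (k + M) x) - 0) < e" if "k \<ge> L" for k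
      using L[of k "k + M"] that un_nonneg[OF Cc_diff[OF CS_Cc[OF F] CS_Cc[OF F]], of k "k + M"] by simp
    then show "\<exists>L. \<forall>k\<ge>L. norm (un (\<lambda>x. F k x - F (k + M) x) - 0) < e" by blast
  qed
  then show ?thesis using F CS_offset[OF F] by (simp add: CE_iff)
qed

lemma CS_bounded:
  assumes F: "F \<in> CS"
  shows "\<exists>B>0. \<forall>k. un (F k) \<le> B"
proof -
  obtain M where M: "\<And>i j. i \<ge> M \<Longrightarrow> j \<ge> M \<Longrightarrow> un (\<lambda>x. F i x - F j x) < 1"
    using CS_cauchy[OF F, of 1] by auto
  define B where "B = (\<Sum>k\<le>M. un (F k)) + 1"
  have nn: "0 \<le> un (F k)" for k by (intro un_nonneg CS_Cc F)
  have S: "un (F k) \<le> (\<Sum>k\<le>M. un (F k))" if "k \<le> M" for k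
    using that nn by (intro member_le_sum) auto
  have "un (F k) \<le> B" for k
  proof (cases "k \<le> M")
    case False
    have "un (\<lambda>x. (F k x - F M x) + F M x) \<le> un (\<lambda>x. F k x - F M x) + un (F M)"
      by (intro un_add Cc_diff CS_Cc F)
    then show ?thesis using M[of k M] False S[of M] by (simp add: B_def)
  qed (use S[of k] in \<open>simp add: B_def\<close>)
  moreover have "B > 0" unfolding B_def using nn by (intro add_nonneg_pos sum_nonneg) auto
  ultimately show ?thesis by blast
qed

text \<open>Lipschitz estimates carry operations on functions over to Cauchy sequences, and
  \<open>CE_opI\<close> does the same for equivalence. Unary operations are the case
  \<open>H = F\<close>.\<close>

lemma CS_opI:
  assumes "F \<in> CS" "H \<in> CS" "\<And>k. L k \<in> Cc" "C \<ge> 0"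
    and "\<And>i j. un (\<lambda>x. L i x - L j x) \<le> C * (un (\<lambda>x. F i x - F j x) + un (\<lambda>x. H i x - H j x))"
  shows "L \<in> CS"
  unfolding CS_iff
proof (intro conjI allI impI)
  fix e :: real assume e: "e > 0"
  define d where "d = e / (2 * C + 1)"
  have d: "d > 0" using e assms(4) by (simp add: d_def add_nonneg_pos)
  obtain M where M: "\<And>i j. i \<ge> M \<Longrightarrow> j \<ge> M \<Longrightarrow> un (\<lambda>x. F i x - F j x) < d"
    using CS_cauchy[OF assms(1) d] by blast
  obtain N where N: "\<And>i j. i \<ge> N \<Longrightarrow> j \<ge> N \<Longrightarrow> un (\<lambda>x. H i x - H j x) < d"
    using CS_cauchy[OF assms(2) d] by blast
  have "un (\<lambda>x. L i x - L j x) < e" if "i \<ge> max M N" "j \<ge> max M N" for i j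
  proof -
    have "un (\<lambda>x. L i x - L j x) \<le> C * (d + d)"
      using assms(5)[of i j] M[of i j] N[of i j] that
      by (intro order_trans[OF assms(5)] mult_left_mono assms(4) add_mono) auto
    also have "\<dots> = 2 * C * d" by simp
    also have "\<dots> < (2 * C + 1) * d" using d by (simp add: distrib_right)
    also have "\<dots> = e" using assms(4) by (simp add: d_def)
    finally show ?thesis .
  qed
  then show "\<exists>M. \<forall>i\<ge>M. \<forall>j\<ge>M. un (\<lambda>x. L i x - L j x) < e" by blast
qed (rule assms)

lemma CE_opI:
  assumes "(F, F') \<in> CE" "(H, H') \<in> CE" "L \<in> CS" "L' \<in> CS"
    and "\<And>k. un (\<lambda>x. L k x - L' k x) \<le> C * (un (\<lambda>x. F k x - F' k x) + un (\<lambda>x. H k x - H' k x))"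
  shows "(L, L') \<in> CE"
proof -
  have "(\<lambda>k. un (\<lambda>x. L k x - L' k x)) \<longlonglongrightarrow> 0"
  proof (rule tendsto_zero_sandwich[OF _ assms(5)])
    show "0 \<le> un (\<lambda>x. L k x - L' k x)" for k by (intro un_nonneg Cc_diff CS_Cc assms)
    have "(\<lambda>k. un (\<lambda>x. F k x - F' k x) + un (\<lambda>x. H k x - H' k x)) \<longlonglongrightarrow> 0 + 0"
      using assms(1,2) by (intro tendsto_add) (auto simp: CE_iff)
    from tendsto_mult[OF tendsto_const this, of C]
    show "(\<lambda>k. C * (un (\<lambda>x. F k x - F' k x) + un (\<lambda>x. H k x - H' k x))) \<longlonglongrightarrow> 0" by simp
  qed
  with assms show ?thesis by (simp add: CE_iff)
qed

lemma un_add_diff: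
  assumes "f \<in> Cc" "f' \<in> Cc" "h \<in> Cc" "h' \<in> Cc"
  shows "un (\<lambda>x. (f x + h x) - (f' x + h' x)) \<le> 1 * (un (\<lambda>x. f x - f' x) + un (\<lambda>x. h x - h' x))"
  using un_add[OF Cc_diff[OF assms(1,2)] Cc_diff[OF assms(3,4)]] by (simp add: algebra_simps)

lemma un_scale_diff:
  assumes "f \<in> Cc" "f' \<in> Cc"
  shows "un (\<lambda>x. c * f x - c * f' x) \<le> cmod c * (un (\<lambda>x. f x - f' x) + un (\<lambda>x. f x - f' x))"
proof -
  have "un (\<lambda>x. c * f x - c * f' x) \<le> cmod c * un (\<lambda>x. f x - f' x)"
    using un_scale_le[OF Cc_diff[OF assms], of c] by (simp add: algebra_simps)
  also have "\<dots> \<le> cmod c * (un (\<lambda>x. f x - f' x) + un (\<lambda>x. f x - f' x))"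
    using un_nonneg[OF Cc_diff[OF assms]] by (intro mult_left_mono) auto
  finally show ?thesis .
qed

lemma un_conv_diff:
  assumes c: "f \<in> Cc" "f' \<in> Cc" "h \<in> Cc" "h' \<in> Cc" and B: "un f \<le> B" "un h' \<le> B"
  shows "un (\<lambda>x. conv f h x - conv f' h' x) \<le> B * (un (\<lambda>x. f x - f' x) + un (\<lambda>x. h x - h' x))"
proof -
  have "un (\<lambda>x. conv f h x - conv f' h' x)
      = un (\<lambda>x. conv f (\<lambda>x. h x - h' x) x + conv (\<lambda>x. f x - f' x) h' x)"
    by (simp add: conv_diff_left conv_diff_right c)
  also have "\<dots> \<le> un (conv f (\<lambda>x. h x - h' x)) + un (conv (\<lambda>x. f x - f' x) h')"
    by (intro un_add Cc_conv Cc_diff c)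
  also have "\<dots> \<le> un f * un (\<lambda>x. h x - h' x) + un (\<lambda>x. f x - f' x) * un h'"
    by (intro add_mono un_conv Cc_diff c)
  also have "\<dots> \<le> B * un (\<lambda>x. h x - h' x) + un (\<lambda>x. f x - f' x) * B"
    by (intro add_mono mult_right_mono mult_left_mono B un_nonneg Cc_diff c)
  finally show ?thesis by (simp add: algebra_simps)
qed

lemma un_star_diff:
  assumes "f \<in> Cc" "f' \<in> Cc"
  shows "un (\<lambda>x. star f x - star f' x) \<le> 1 * (un (\<lambda>x. f x - f' x) + un (\<lambda>x. f x - f' x))"
  using un_star[OF Cc_diff[OF assms]] un_nonneg[OF Cc_diff[OF assms]] by (simp add: star_diff)

lemma CS_add: "F \<in> CS \<Longrightarrow> H \<in> CS \<Longrightarrow> (\<lambda>k x. F k x + H k x) \<in> CS"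
  by (rule CS_opI[where C = 1 and F = F and H = H]) (simp_all only: Cc_add CS_Cc un_add_diff zero_le_one)

lemma CS_scale: "F \<in> CS \<Longrightarrow> (\<lambda>k x. c * F k x) \<in> CS"
  by (rule CS_opI[where C = "cmod c" and F = F and H = F]) (simp_all only: Cc_scale CS_Cc un_scale_diff norm_ge_zero)

lemma CS_conv:
  assumes "F \<in> CS" "H \<in> CS"
  shows "(\<lambda>k. conv (F k) (H k)) \<in> CS"
proof -
  obtain B where B: "B > 0" "\<And>k. un (F k) \<le> B" using CS_bounded[OF assms(1)] by blast
  obtain B' where B': "B' > 0" "\<And>k. un (H k) \<le> B'" using CS_bounded[OF assms(2)] by blast
  have m: "un (F k) \<le> max B B'" "un (H k) \<le> max B B'" for k
    using B(2)[of k] B'(2)[of k] by auto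
  show ?thesis
  proof (rule CS_opI[OF assms, where C = "max B B'"])
    show "conv (F k) (H k) \<in> Cc" for k by (rule Cc_conv[OF CS_Cc[OF assms(1)] CS_Cc[OF assms(2)]])
    show "un (\<lambda>x. conv (F i) (H i) x - conv (F j) (H j) x)
        \<le> max B B' * (un (\<lambda>x. F i x - F j x) + un (\<lambda>x. H i x - H j x))" for i j
      by (rule un_conv_diff[OF _ _ _ _ m]) (rule CS_Cc[OF assms(1)] CS_Cc[OF assms(2)])+
  qed (use B in simp)
qed

lemma CS_star: "F \<in> CS \<Longrightarrow> (\<lambda>k. star (F k)) \<in> CS"
  by (rule CS_opI[where C = 1 and F = F and H = F]) (simp_all only: Cc_star CS_Cc un_star_diff zero_le_one)

section \<open>The algebra operations on classes\<close>

definition cls :: "(nat \<Rightarrow> 'g \<Rightarrow> complex) \<Rightarrow> (nat \<Rightarrow> 'g \<Rightarrow> complex) set" where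
  "cls F = CE `` {F}"

lemma cls_eq: "(F, H) \<in> CE \<Longrightarrow> cls F = cls H"
  unfolding cls_def by (rule equiv_class_eq[OF equiv_CE])

lemma mem_cls: "H \<in> cls F \<longleftrightarrow> (F, H) \<in> CE"
  by (simp add: cls_def)

lemma CE_refl: "F \<in> CS \<Longrightarrow> (F, F) \<in> CE"
  using equiv_CE by (auto simp: equiv_def refl_on_def)

lemma carrier_CA: "carrier CA = cls ` CS"
  by (auto simp: group_cstar_def Let_def quotient_def cls_def)

lemma CA_add:
  assumes "F \<in> CS" "H \<in> CS"
  shows "sa_add CA (cls F) (cls H) = cls (\<lambda>k x. F k x + H k x)"
proof -
  have "CE `` {(\<lambda>k x. F' k x + H' k x) | F' H'. F' \<in> cls F \<and> H' \<in> cls H} = CE `` {(\<lambda>k x. F k x + H k x)}"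
  proof (rule Image_eq_classI[OF equiv_CE])
    show "(\<lambda>k x. F k x + H k x) \<in> {(\<lambda>k x. F' k x + H' k x) | F' H'. F' \<in> cls F \<and> H' \<in> cls H}"
      using CE_refl assms by (auto simp: mem_cls)
    fix L assume "L \<in> {(\<lambda>k x. F' k x + H' k x) | F' H'. F' \<in> cls F \<and> H' \<in> cls H}"
    then obtain F' H' where *: "(F, F') \<in> CE" "(H, H') \<in> CE" "L = (\<lambda>k x. F' k x + H' k x)" by (auto simp: mem_cls)
    then have c: "F' \<in> CS" "H' \<in> CS" by (auto simp: CE_iff)
    show "(\<lambda>k x. F k x + H k x, L) \<in> CE"
      unfolding *(3) by (rule CE_opI[OF *(1,2) CS_add CS_add un_add_diff]) (intro assms c CS_Cc)+
  qed
  then show ?thesis by (simp add: group_cstar_def Let_def cls_def)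
qed

lemma CA_scale:
  assumes "F \<in> CS"
  shows "sa_scale CA c (cls F) = cls (\<lambda>k x. c * F k x)"
proof -
  have "CE `` {(\<lambda>k x. c * F' k x) | F'. F' \<in> cls F} = CE `` {(\<lambda>k x. c * F k x)}"
  proof (rule Image_eq_classI[OF equiv_CE])
    show "(\<lambda>k x. c * F k x) \<in> {(\<lambda>k x. c * F' k x) | F'. F' \<in> cls F}"
      using CE_refl assms by (auto simp: mem_cls)
    fix L assume "L \<in> {(\<lambda>k x. c * F' k x) | F'. F' \<in> cls F}"
    then obtain F' where *: "(F, F') \<in> CE" "L = (\<lambda>k x. c * F' k x)" by (auto simp: mem_cls)
    then have c: "F' \<in> CS" by (auto simp: CE_iff)
    show "(\<lambda>k x. c * F k x, L) \<in> CE"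
      unfolding *(2) by (rule CE_opI[OF *(1,1) CS_scale CS_scale un_scale_diff]) (intro assms c CS_Cc)+
  qed
  then show ?thesis by (simp add: group_cstar_def Let_def cls_def)
qed

lemma CA_mult:
  assumes "F \<in> CS" "H \<in> CS"
  shows "sa_mult CA (cls F) (cls H) = cls (\<lambda>k. conv (F k) (H k))"
proof -
  have "CE `` {(\<lambda>k. conv (F' k) (H' k)) | F' H'. F' \<in> cls F \<and> H' \<in> cls H} = CE `` {(\<lambda>k. conv (F k) (H k))}"
  proof (rule Image_eq_classI[OF equiv_CE])
    show "(\<lambda>k. conv (F k) (H k)) \<in> {(\<lambda>k. conv (F' k) (H' k)) | F' H'. F' \<in> cls F \<and> H' \<in> cls H}"
      using CE_refl assms by (auto simp: mem_cls)
    fix L assume "L \<in> {(\<lambda>k. conv (F' k) (H' k)) | F' H'. F' \<in> cls F \<and> H' \<in> cls H}"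
    then obtain F' H' where *: "(F, F') \<in> CE" "(H, H') \<in> CE" "L = (\<lambda>k. conv (F' k) (H' k))" by (auto simp: mem_cls)
    then have c: "F' \<in> CS" "H' \<in> CS" by (auto simp: CE_iff)
    obtain B where B: "B > 0" "\<And>k. un (F k) \<le> B" using CS_bounded[OF assms(1)] by blast
    obtain B' where B': "B' > 0" "\<And>k. un (H' k) \<le> B'" using CS_bounded[OF c(2)] by blast
    have m: "un (F k) \<le> max B B'" "un (H' k) \<le> max B B'" for k
      using B(2)[of k] B'(2)[of k] by auto
    show "(\<lambda>k. conv (F k) (H k), L) \<in> CE"
      unfolding *(3) by (rule CE_opI[OF *(1,2) CS_conv CS_conv un_conv_diff[OF _ _ _ _ m]]) (intro assms c CS_Cc)+
  qed
  then show ?thesis by (simp add: group_cstar_def Let_def cls_def)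
qed

lemma CA_star:
  assumes "F \<in> CS"
  shows "sa_star CA (cls F) = cls (\<lambda>k. star (F k))"
proof -
  have "CE `` {(\<lambda>k. star (F' k)) | F'. F' \<in> cls F} = CE `` {(\<lambda>k. star (F k))}"
  proof (rule Image_eq_classI[OF equiv_CE])
    show "(\<lambda>k. star (F k)) \<in> {(\<lambda>k. star (F' k)) | F'. F' \<in> cls F}"
      using CE_refl assms by (auto simp: mem_cls)
    fix L assume "L \<in> {(\<lambda>k. star (F' k)) | F'. F' \<in> cls F}"
    then obtain F' where *: "(F, F') \<in> CE" "L = (\<lambda>k. star (F' k))" by (auto simp: mem_cls)
    then have c: "F' \<in> CS" by (auto simp: CE_iff)
    show "(\<lambda>k. star (F k), L) \<in> CE"
      unfolding *(2) by (rule CE_opI[OF *(1,1) CS_star CS_star un_star_diff]) (intro assms c CS_Cc)+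
  qed
  then show ?thesis by (simp add: group_cstar_def Let_def cls_def)
qed

subsection \<open>Star-representations are contractive\<close>

text \<open>
  The iterates of \<open>b \<mapsto> (h + b\<^sup>2) / 2\<close> converge to a solution of
  \<open>h = 2 b - b\<^sup>2\<close>, that is \<open>1 - h = (1 - b)\<^sup>2\<close>, whenever the norm of \<open>h\<close> is less than 1.
\<close>

primrec root_iter :: "('g \<Rightarrow> complex) \<Rightarrow> nat \<Rightarrow> 'g \<Rightarrow> complex" where
  "root_iter h 0 = (\<lambda>x. 0)"
| "root_iter h (Suc k) = (\<lambda>x. 1 / 2 * (h x + conv (root_iter h k) (root_iter h k) x))"

lemma Cc_root_iter: "h \<in> Cc \<Longrightarrow> root_iter h k \<in> Cc"
  by (induction k) (auto intro!: Cc_zero Cc_scale[of _ "1 / 2", simplified] Cc_add Cc_conv)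

lemma star_root_iter:
  assumes "h \<in> Cc" "star h = h"
  shows "star (root_iter h k) = root_iter h k"
proof (induction k)
  case (Suc k)
  have "star (conv (root_iter h k) (root_iter h k)) = conv (root_iter h k) (root_iter h k)"
    by (simp add: star_conv Cc_root_iter assms Suc)
  then show ?case using assms(2) by (simp add: star_eq fun_eq_iff)
qed (simp add: star_eq)

context
  fixes r :: real
  assumes r: "0 \<le> r" "r < 1"
begin

text \<open>Squaring keeps the ball of radius \<open>r\<close> because \<open>r < 1\<close>, and the
  iteration averages \<open>h\<close> with such a square.\<close>

lemma un_root_iter:
  assumes h: "h \<in> Cc" "un h \<le> r"
  shows "un (root_iter h k) \<le> r"
proof (induction k)
  case (Suc k)
  let ?b = "root_iter h k"
  have b: "?b \<in> Cc" by (rule Cc_root_iter[OF h(1)])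
  have "un (root_iter h (Suc k)) \<le> cmod (1 / 2) * un (\<lambda>x. h x + conv ?b ?b x)"
    unfolding root_iter.simps by (intro un_scale_le Cc_add Cc_conv b h)
  also have "\<dots> \<le> 1 / 2 * (un h + un (conv ?b ?b))"
    using un_add[OF h(1) Cc_conv[OF b b]] by (simp add: norm_divide)
  also have "\<dots> \<le> 1 / 2 * (r + r * 1)"
  proof -
    have "un (conv ?b ?b) \<le> un ?b * un ?b" by (rule un_conv[OF b b])
    also have "\<dots> \<le> r * 1" using Suc r un_nonneg[OF b] by (intro mult_mono) auto
    finally show ?thesis using h(2) by simp
  qed
  finally show ?case by simp
qed (use r in \<open>simp add: un_zero\<close>)

text \<open>The factor 1/2 cancels the 2 in the Lipschitz constant \<open>2 * r\<close> of squaring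
  on the ball of radius \<open>r\<close>, so the iteration is a contraction with factor
  \<open>r\<close>.\<close>

lemma un_root_iter_Suc_diff:
  assumes c: "f \<in> Cc" "f' \<in> Cc" "h \<in> Cc" "h' \<in> Cc" and "un f \<le> r" "un f' \<le> r"
  shows "un (\<lambda>x. 1 / 2 * (h x + conv f f x) - 1 / 2 * (h' x + conv f' f' x))
    \<le> 1 / 2 * un (\<lambda>x. h x - h' x) + r * un (\<lambda>x. f x - f' x)"
proof -
  have "un (\<lambda>x. 1 / 2 * ((h x + conv f f x) - (h' x + conv f' f' x)))
      \<le> cmod (1 / 2) * un (\<lambda>x. (h x + conv f f x) - (h' x + conv f' f' x))"
    by (intro un_scale_le Cc_diff Cc_add Cc_conv c)
  also have "\<dots> \<le> 1 / 2 * (un (\<lambda>x. h x - h' x) + un (\<lambda>x. conv f f x - conv f' f' x))"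
    using un_add_diff[of h h' "conv f f" "conv f' f'"] by (simp add: Cc_conv c norm_divide)
  also have "\<dots> \<le> 1 / 2 * (un (\<lambda>x. h x - h' x) + r * (un (\<lambda>x. f x - f' x) + un (\<lambda>x. f x - f' x)))"
    using un_conv_diff[OF c(1,2) c(1,2), of r] assms by simp
  finally show ?thesis by (simp add: algebra_simps)
qed

lemma un_root_iter_step:
  assumes h: "h \<in> Cc" "un h \<le> r"
  shows "un (\<lambda>x. root_iter h (Suc k) x - root_iter h k x) \<le> r ^ Suc k"
proof (induction k)
  case 0
  have "un (\<lambda>x. 1 / 2 * h x) \<le> cmod (1 / 2) * un h" by (rule un_scale_le[OF h(1)])
  moreover have "conv (\<lambda>x. 0) (\<lambda>x. 0) = (\<lambda>x. 0)" by (simp add: convolution_def fun_eq_iff)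
  ultimately show ?case using h r by (simp add: norm_divide)
next
  case (Suc k)
  have iter: "root_iter h (Suc k) x = 1 / 2 * (h x + conv (root_iter h k) (root_iter h k) x)" for k x
    by simp
  have "un (\<lambda>x. root_iter h (Suc (Suc k)) x - root_iter h (Suc k) x)
      \<le> 1 / 2 * un (\<lambda>x. h x - h x) + r * un (\<lambda>x. root_iter h (Suc k) x - root_iter h k x)"
    using un_root_iter_Suc_diff[OF Cc_root_iter[OF h(1), of "Suc k"] Cc_root_iter[OF h(1), of k]
        h(1) h(1) un_root_iter[OF h] un_root_iter[OF h]]
    unfolding iter[symmetric] .
  also have "\<dots> \<le> r * r ^ Suc k" using Suc r by (simp add: un_zero mult_left_mono del: root_iter.simps)
  finally show ?case by simp
qed

text \<open>The geometric series of the steps from \<open>j\<close> to \<open>i\<close>, multiplied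
  through by \<open>1 - r\<close> so that it telescopes.\<close>

lemma un_root_iter_tail:
  assumes h: "h \<in> Cc" "un h \<le> r" and "j \<le> i"
  shows "un (\<lambda>x. root_iter h i x - root_iter h j x) * (1 - r) \<le> r ^ Suc j - r ^ Suc i"
  using \<open>j \<le> i\<close>
proof (induction i rule: dec_induct)
  case base
  then show ?case by (simp add: un_zero)
next
  case (step i)
  have "un (\<lambda>x. root_iter h (Suc i) x - root_iter h j x)
      \<le> un (\<lambda>x. root_iter h (Suc i) x - root_iter h i x) + un (\<lambda>x. root_iter h i x - root_iter h j x)"
    by (intro un_triangle Cc_root_iter h)
  also have "\<dots> \<le> r ^ Suc i + un (\<lambda>x. root_iter h i x - root_iter h j x)"
    using un_root_iter_step[OF h, of i] by simp
  finally have "un (\<lambda>x. root_iter h (Suc i) x - root_iter h j x) * (1 - r)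
      \<le> (r ^ Suc i + un (\<lambda>x. root_iter h i x - root_iter h j x)) * (1 - r)"
    using r by (intro mult_right_mono) auto
  also have "\<dots> = r ^ Suc i * (1 - r) + un (\<lambda>x. root_iter h i x - root_iter h j x) * (1 - r)"
    by (rule distrib_right)
  also have "\<dots> \<le> r ^ Suc i * (1 - r) + (r ^ Suc j - r ^ Suc i)" using step.IH by simp
  finally show ?case by (simp add: algebra_simps)
qed

text \<open>The estimate must be uniform in \<open>k\<close>, since \<open>CS_root_iter\<close>
  compares diagonal terms. It is preserved because (1 - r)/2 + r is at most 1.\<close>

lemma un_root_iter_diff:
  assumes h: "h \<in> Cc" "un h \<le> r" and h': "h' \<in> Cc" "un h' \<le> r"
  shows "un (\<lambda>x. root_iter h k x - root_iter h' k x) * (1 - r) \<le> un (\<lambda>x. h x - h' x)"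
proof (induction k)
  case 0
  then show ?case using un_nonneg[OF Cc_diff[OF h(1) h'(1)]] by (simp add: un_zero)
next
  case (Suc k)
  let ?d = "un (\<lambda>x. root_iter h k x - root_iter h' k x)" and ?D = "un (\<lambda>x. h x - h' x)"
  have D: "?D \<ge> 0" by (intro un_nonneg Cc_diff h h')
  have "un (\<lambda>x. root_iter h (Suc k) x - root_iter h' (Suc k) x) \<le> 1 / 2 * ?D + r * ?d"
    unfolding root_iter.simps by (intro un_root_iter_Suc_diff Cc_root_iter un_root_iter h h')
  then have "un (\<lambda>x. root_iter h (Suc k) x - root_iter h' (Suc k) x) * (1 - r) \<le> (1 / 2 * ?D + r * ?d) * (1 - r)"
    using r by (intro mult_right_mono) auto
  also have "\<dots> = 1 / 2 * ?D * (1 - r) + r * (?d * (1 - r))" by (simp add: algebra_simps)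
  also have "\<dots> \<le> 1 / 2 * ?D * (1 - r) + r * ?D" using Suc r by (intro add_left_mono mult_left_mono) auto
  also have "\<dots> = 1 / 2 * (1 + r) * ?D" by (simp add: field_simps)
  also have "\<dots> \<le> 1 * ?D" using r D by (intro mult_right_mono) auto
  finally show ?case by simp
qed

text \<open>An element of the completion is given by approximants, so the iteration is run
  diagonally, with \<open>k\<close> steps on the \<open>k\<close>-th one. Tails of the iteration and
  changes of the starting datum are controlled separately.\<close>

lemma CS_root_iter:
  assumes H: "H \<in> CS" "\<And>k. un (H k) \<le> r"
  shows "(\<lambda>k. root_iter (H k) k) \<in> CS"
  unfolding CS_iff
proof (intro conjI allI impI)
  show "root_iter (H k) k \<in> Cc" for k by (intro Cc_root_iter CS_Cc H)
  fix e :: real assume e: "e > 0"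
  define d where "d = e * (1 - r) / 2"
  have d: "d > 0" using e r by (simp add: d_def)
  obtain M where M: "\<And>i j. i \<ge> M \<Longrightarrow> j \<ge> M \<Longrightarrow> un (\<lambda>x. H i x - H j x) < d"
    using CS_cauchy[OF H(1) d] by blast
  obtain N where N: "r ^ N < d" using real_arch_pow_inv[OF d r(2)] by blast
  have main: "un (\<lambda>x. root_iter (H i) i x - root_iter (H j) j x) < e" if ij: "i \<ge> j" "j \<ge> max M N" for i j
  proof -
    have "un (\<lambda>x. root_iter (H i) i x - root_iter (H j) j x)
        \<le> un (\<lambda>x. root_iter (H i) i x - root_iter (H i) j x) + un (\<lambda>x. root_iter (H i) j x - root_iter (H j) j x)"
      by (intro un_triangle Cc_root_iter CS_Cc H)
    then have "un (\<lambda>x. root_iter (H i) i x - root_iter (H j) j x) * (1 - r)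
        \<le> un (\<lambda>x. root_iter (H i) i x - root_iter (H i) j x) * (1 - r)
          + un (\<lambda>x. root_iter (H i) j x - root_iter (H j) j x) * (1 - r)"
      using r by (simp add: mult_right_mono flip: distrib_right)
    also have "\<dots> \<le> (r ^ Suc j - r ^ Suc i) + un (\<lambda>x. H i x - H j x)"
      by (intro add_mono un_root_iter_tail un_root_iter_diff CS_Cc H ij)
    also have "\<dots> < d + d"
    proof -
      have "r ^ Suc j \<le> r ^ N" using ij r by (intro power_decreasing) auto
      moreover have "0 \<le> r ^ Suc i" using r by simp
      ultimately show ?thesis using M[of i j] N ij by simp
    qed
    also have "\<dots> = e * (1 - r)" by (simp add: d_def)
    finally show ?thesis using r by simp
  qed
  have "un (\<lambda>x. root_iter (H i) i x - root_iter (H j) j x) < e" if "i \<ge> max M N" "j \<ge> max M N" for i j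
    using main[of i j] main[of j i] that un_minus_commute[OF Cc_root_iter Cc_root_iter, of "H i" "H j" i j]
    by (cases "i \<ge> j") (auto simp: CS_Cc H)
  then show "\<exists>M. \<forall>i\<ge>M. \<forall>j\<ge>M. un (\<lambda>x. root_iter (H i) i x - root_iter (H j) j x) < e" by blast
qed

text \<open>At index \<open>k\<close> the two sides differ by twice the difference of consecutive
  iterates, which is at most \<open>2 * r ^ Suc k\<close>.\<close>

lemma CE_root_iter:
  assumes H: "H \<in> CS" "\<And>k. un (H k) \<le> r"
  defines "E \<equiv> \<lambda>k. root_iter (H k) k"
  shows "(\<lambda>k x. 2 * E k x, \<lambda>k x. H k x + conv (E k) (E k) x) \<in> CE"
proof -
  have E: "E \<in> CS" unfolding E_def by (rule CS_root_iter[OF H])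
  have "(\<lambda>k. un (\<lambda>x. 2 * E k x - (H k x + conv (E k) (E k) x))) \<longlonglongrightarrow> 0"
  proof (rule tendsto_zero_sandwich)
    show "0 \<le> un (\<lambda>x. 2 * E k x - (H k x + conv (E k) (E k) x))" for k
      by (intro un_nonneg Cc_diff Cc_scale Cc_add Cc_conv CS_Cc H E)
    fix k
    have "un (\<lambda>x. 2 * E k x - (H k x + conv (E k) (E k) x))
        = un (\<lambda>x. 2 * (root_iter (H k) k x - root_iter (H k) (Suc k) x))"
      by (simp add: E_def algebra_simps)
    also have "\<dots> \<le> cmod 2 * un (\<lambda>x. root_iter (H k) k x - root_iter (H k) (Suc k) x)"
      by (intro un_scale_le Cc_diff Cc_root_iter CS_Cc H)
    also have "un (\<lambda>x. root_iter (H k) k x - root_iter (H k) (Suc k) x)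
        = un (\<lambda>x. root_iter (H k) (Suc k) x - root_iter (H k) k x)"
      by (intro un_minus_commute Cc_root_iter CS_Cc H)
    also have "cmod 2 * \<dots> \<le> 2 * r ^ Suc k"
      using un_root_iter_step[OF CS_Cc[OF H(1)] H(2), of k k] by (simp del: root_iter.simps)
    finally show "un (\<lambda>x. 2 * E k x - (H k x + conv (E k) (E k) x)) \<le> 2 * r ^ Suc k" .
  next
    have "(\<lambda>k. 2 * r ^ Suc k) \<longlonglongrightarrow> 2 * 0"
      by (intro tendsto_mult tendsto_const LIMSEQ_Suc LIMSEQ_realpow_zero r)
    then show "(\<lambda>k. 2 * r ^ Suc k) \<longlonglongrightarrow> 0" by simp
  qed
  then show ?thesis using E H by (simp add: CE_iff CS_scale CS_add CS_conv)
qed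

end

end

section \<open>Compactness in Hilbert spaces\<close>

lemma bounded_linear_scaleC_left: "bounded_linear (\<lambda>k. scaleC k (x :: 'a::complex_hilbert))"
proof (rule bounded_linear_intro)
  show "scaleC (r *\<^sub>R k) x = r *\<^sub>R scaleC k x" for r k
    by (simp add: scaleC_of_real[symmetric] scaleC_scaleC scaleR_conv_of_real)
qed (auto simp: scaleC_add_left norm_scaleC)

lemma bounded_linear_scaleC_right: "bounded_linear (scaleC c :: 'a::complex_hilbert \<Rightarrow> 'a)"
proof (rule bounded_linear_intro)
  show "scaleC c (r *\<^sub>R x) = r *\<^sub>R scaleC c x" for r and x :: 'a
    by (simp add: scaleC_of_real[symmetric] scaleC_scaleC mult.commute)
  show "norm (scaleC c x) \<le> norm x * cmod c" for x :: 'a by (simp add: norm_scaleC)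
qed (simp add: scaleC_add_right)

lemma closed_if_compact_balls:
  fixes V :: "'a::real_normed_vector set"
  assumes "\<And>r. compact (V \<inter> cball 0 r)"
  shows "closed V"
  unfolding closed_sequential_limits
proof (intro allI impI)
  fix x l assume *: "(\<forall>n. x n \<in> V) \<and> x \<longlonglongrightarrow> l"
  then have "Bseq x" using convergent_imp_Bseq convergentI by blast
  then obtain r where "\<And>n. norm (x n) \<le> r" unfolding Bseq_def by blast
  then have "\<forall>n. x n \<in> V \<inter> cball 0 r" using * by auto
  moreover have "closed (V \<inter> cball 0 r)" by (rule compact_imp_closed[OF assms])
  ultimately show "l \<in> V" using * unfolding closed_sequential_limits by blast
qed

text \<open>By induction the smaller span is closed, so a new vector \<open>x\<close> has positive
  distance \<open>d\<close> from it. This bounds the coefficient of \<open>x\<close> and exhibits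
  the set as a closed part of a continuous image of a compact product.\<close>

lemma compact_span_cball:
  fixes S :: "'a::complex_hilbert set"
  assumes "finite S"
  shows "compact (complex_vector.span S \<inter> cball 0 r)"
  using assms
proof (induction S arbitrary: r rule: finite_induct)
  case empty
  have "{0} \<inter> cball (0::'a) r = {} \<or> {0} \<inter> cball (0::'a) r = {0}" by auto
  then show ?case by (auto simp: complex_vector.span_empty)
next
  case (insert x S)
  show ?case
  proof (cases "x \<in> complex_vector.span S")
    case True
    then show ?thesis using insert.IH by (simp add: complex_vector.span_redundant)
  next
    case False
    have "closed (complex_vector.span S)" by (rule closed_if_compact_balls) (rule insert.IH)
    then obtain d where d: "d > 0" "\<And>y. y \<in> complex_vector.span S \<Longrightarrow> d \<le> norm (x - y)"
      using False unfolding closed_def open_dist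
      by (metis ComplI ComplD dist_norm norm_minus_commute not_le)
    \<comment> \<open>For \<open>z = scaleC k x + y\<close> in the ball,
      \<open>cmod k * d \<le> norm z \<le> r\<close> bounds \<open>k\<close>, and the triangle
      inequality then bounds \<open>y\<close>.\<close>
    define A where "A = cball (0::complex) (r / d) \<times> (complex_vector.span S \<inter> cball 0 (r + r / d * norm x))"
    have "compact ((\<lambda>(k, y). scaleC k x + y) ` A)"
    proof (rule compact_continuous_image)
      show "continuous_on A (\<lambda>(k, y). scaleC k x + y)"
        unfolding case_prod_beta
        by (intro continuous_on_add bounded_linear.continuous_on[OF bounded_linear_scaleC_left]
            continuous_on_fst continuous_on_snd continuous_on_id)
      show "compact A" unfolding A_def by (intro compact_Times insert.IH compact_cball)
    qed
    moreover have "complex_vector.span (insert x S) \<inter> cball 0 r = (\<lambda>(k, y). scaleC k x + y) ` A \<inter> cball 0 r"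
    proof (intro equalityI subsetI)
      fix z assume z: "z \<in> complex_vector.span (insert x S) \<inter> cball 0 r"
      then obtain k where k: "z - scaleC k x \<in> complex_vector.span S"
        by (auto simp: complex_vector.span_breakdown_eq)
      define y where "y = z - scaleC k x"
      have zr: "norm z \<le> r" using z by simp
      have "cmod k * d \<le> norm z"
      proof (cases "k = 0")
        case False
        have "scaleC (- inverse k) y \<in> complex_vector.span S"
          unfolding y_def by (rule complex_vector.span_scale[OF k])
        then have "d \<le> norm (x - scaleC (- inverse k) y)" by (rule d(2))
        then have "cmod k * d \<le> norm (scaleC k (x - scaleC (- inverse k) y))"
          by (simp add: norm_scaleC mult_left_mono)
        also have "scaleC k (x - scaleC (- inverse k) y) = z"
          using False by (simp add: y_def complex_vector.scale_right_diff_distrib scaleC_scaleC)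
        finally show ?thesis .
      qed (use d in simp)
      then have kr: "cmod k \<le> r / d" using zr d(1) by (simp add: field_simps)
      have "norm y \<le> norm z + cmod k * norm x"
        unfolding y_def using norm_triangle_ineq4[of z "scaleC k x"] by (simp add: norm_scaleC)
      also have "\<dots> \<le> r + r / d * norm x" using zr kr by (intro add_mono mult_right_mono) auto
      finally have "(k, y) \<in> A" using k kr by (simp add: A_def y_def)
      then have "z \<in> (\<lambda>(k, y). scaleC k x + y) ` A" by (intro image_eqI[of _ _ "(k, y)"]) (auto simp: y_def)
      with zr show "z \<in> (\<lambda>(k, y). scaleC k x + y) ` A \<inter> cball 0 r" by simp
    next
      fix z assume "z \<in> (\<lambda>(k, y). scaleC k x + y) ` A \<inter> cball 0 r"
      then obtain k y where z: "z = scaleC k x + y" "y \<in> complex_vector.span S" "z \<in> cball 0 r"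
        by (auto simp: A_def)
      have "z - scaleC k x \<in> complex_vector.span S" by (simp add: z)
      with z(3) show "z \<in> complex_vector.span (insert x S) \<inter> cball 0 r"
        by (auto simp: complex_vector.span_breakdown_eq)
    qed
    ultimately show ?thesis by (simp add: compact_Int_closed)
  qed
qed

lemma compact_operatorI_approx:
  fixes S :: "'a::complex_hilbert \<Rightarrow> 'b::complex_hilbert"
  assumes S: "bounded_clinear_map S"
    and approx: "\<And>e. e > 0 \<Longrightarrow> \<exists>C. compact C \<and> (\<forall>v\<in>cball 0 1. \<exists>y\<in>C. dist (S v) y < e)"
  shows "compact_operator S"
  unfolding compact_operator_def
proof (rule conjI[OF S])
  show "compact (closure (S ` cball 0 1))"
    unfolding compact_eq_totally_bounded
  proof (intro conjI allI impI)
    show "complete (closure (S ` cball 0 1))" by (simp add: complete_eq_closed)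
    fix e :: real assume e: "e > 0"
    then obtain C where C: "compact C" "\<And>v. v \<in> cball 0 1 \<Longrightarrow> \<exists>y\<in>C. dist (S v) y < e / 3"
      using approx[of "e / 3"] by auto
    obtain k where k: "finite k" "C \<subseteq> (\<Union>x\<in>k. ball x (e / 3))"
      using C(1) e unfolding compact_eq_totally_bounded by (meson divide_pos_pos zero_less_numeral)
    have "closure (S ` cball 0 1) \<subseteq> (\<Union>x\<in>k. ball x e)"
    proof
      fix z assume "z \<in> closure (S ` cball 0 1)"
      then obtain v where v: "v \<in> cball 0 1" "dist (S v) z < e / 3"
        using e unfolding closure_approachable by (metis divide_pos_pos imageE zero_less_numeral)
      obtain y where y: "y \<in> C" "dist (S v) y < e / 3" using C(2)[OF v(1)] by blast
      obtain x where x: "x \<in> k" "dist x y < e / 3" using k(2) y(1) by auto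
      have "dist x z \<le> dist x y + dist y (S v) + dist (S v) z"
        by (metis add.assoc dist_triangle order_trans add_left_mono)
      also have "\<dots> < e" using x y v by (simp add: dist_commute)
      finally show "z \<in> (\<Union>x\<in>k. ball x e)" using x(1) by auto
    qed
    with k(1) show "\<exists>k. finite k \<and> closure (S ` cball 0 1) \<subseteq> (\<Union>x\<in>k. ball x e)" by blast
  qed
qed

text \<open>The fixed bound 1 survives composition and strong limits, so equality or convergence on
  generating vectors extends by closedness.\<close>

definition clinear_contraction :: "('a::complex_hilbert \<Rightarrow> 'a) \<Rightarrow> bool" where
  "clinear_contraction S \<longleftrightarrow> clinear_map S \<and> (\<forall>v. norm (S v) \<le> norm v)"

lemma clinear_mapD:
  assumes "clinear_map S"
  shows clinear_map_add: "S (x + y) = S x + S y" and clinear_map_scale: "S (scaleC c x) = scaleC c (S x)"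
    and clinear_map_zero: "S 0 = 0" and clinear_map_diff: "S (x - y) = S x - S y"
proof -
  show add: "S (x + y) = S x + S y" for x y using assms by (simp add: clinear_map_def)
  show sc: "S (scaleC c x) = scaleC c (S x)" for c x using assms by (simp add: clinear_map_def)
  show "S 0 = 0" using sc[of 0 0] by simp
  show "S (x - y) = S x - S y" using add[of "x - y" y] by simp
qed

lemma clinear_map_sum: "clinear_map S \<Longrightarrow> S (sum f A) = (\<Sum>i\<in>A. S (f i))"
  by (induction A rule: infinite_finite_induct) (simp_all add: clinear_map_zero clinear_map_add)

lemma clinear_contractionD:
  assumes "clinear_contraction S"
  shows contraction_linear: "clinear_map S" and contraction_norm: "norm (S v) \<le> norm v"
  using assms by (auto simp: clinear_contraction_def)

lemma contraction_bounded_linear: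
  assumes "clinear_contraction S"
  shows "bounded_linear S"
proof (rule bounded_linear_intro)
  note * = contraction_linear[OF assms]
  show "S (x + y) = S x + S y" for x y by (rule clinear_map_add[OF *])
  show "S (r *\<^sub>R x) = r *\<^sub>R S x" for r x
    using clinear_map_scale[OF *, of "complex_of_real r" x] by (simp add: scaleC_of_real)
  show "norm (S x) \<le> norm x * 1" for x using contraction_norm[OF assms] by simp
qed

lemma contraction_comp:
  "clinear_contraction S \<Longrightarrow> clinear_contraction T \<Longrightarrow> clinear_contraction (\<lambda>v. S (T v))"
  by (auto simp: clinear_contraction_def clinear_map_def intro: order_trans)

lemma contraction_id: "clinear_contraction (\<lambda>v. v)"
  by (auto simp: clinear_contraction_def clinear_map_def)

lemma closed_csubspace_equalizer:
  assumes "clinear_contraction S" "clinear_contraction T"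
  shows "closed_csubspace {v. S v = T v}"
  unfolding closed_csubspace_def
proof (intro conjI)
  show "closed {v. S v = T v}"
    by (intro closed_Collect_eq linear_continuous_on contraction_bounded_linear assms)
qed (use assms in \<open>auto simp: clinear_mapD contraction_linear\<close>)

text \<open>The common norm bound lets the Cauchy property pass to limits of vectors. Together with
  \<open>sig_generates\<close> this gives strong convergence everywhere from convergence on the
  vectors \<open>sig f w\<close>.\<close>

lemma closed_csubspace_convergent:
  fixes T :: "nat \<Rightarrow> 'a::complex_hilbert \<Rightarrow> 'a"
  assumes T: "\<And>m. clinear_contraction (T m)"
  shows "closed_csubspace {v. convergent (\<lambda>m. T m v)}"
  unfolding closed_csubspace_def
proof (intro conjI ballI allI)
  note lin = contraction_linear[OF T]
  show "closed {v. convergent (\<lambda>m. T m v)}"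
    unfolding closed_sequential_limits
  proof (intro allI impI)
    fix x l assume x: "(\<forall>n. x n \<in> {v. convergent (\<lambda>m. T m v)}) \<and> x \<longlonglongrightarrow> l"
    have "Cauchy (\<lambda>m. T m l)"
    proof (rule metric_CauchyI)
      fix e :: real assume e: "e > 0"
      then obtain n where n: "dist (x n) l < e / 3"
        using x by (metis LIMSEQ_def divide_pos_pos order_refl zero_less_numeral)
      have "Cauchy (\<lambda>m. T m (x n))" using x by (auto intro: convergent_Cauchy)
      then obtain M where M: "\<And>i j. i \<ge> M \<Longrightarrow> j \<ge> M \<Longrightarrow> dist (T i (x n)) (T j (x n)) < e / 3"
        using metric_CauchyD[of "\<lambda>m. T m (x n)" "e / 3"] e by auto
      have close: "dist (T i l) (T i (x n)) < e / 3" for i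
        using contraction_norm[OF T, of i "l - x n"] n
        by (simp add: dist_norm clinear_map_diff[OF lin] norm_minus_commute)
      have "dist (T i l) (T j l) < e" if "i \<ge> M" "j \<ge> M" for i j
      proof -
        have "dist (T i l) (T j l) \<le> dist (T i l) (T i (x n)) + dist (T i (x n)) (T j (x n)) + dist (T j (x n)) (T j l)"
          by (metis add.assoc dist_triangle order_trans add_left_mono)
        then show ?thesis using close[of i] close[of j] M[OF that] by (simp add: dist_commute)
      qed
      then show "\<exists>M. \<forall>i\<ge>M. \<forall>j\<ge>M. dist (T i l) (T j l) < e" by blast
    qed
    then show "l \<in> {v. convergent (\<lambda>m. T m v)}" by (simp add: Cauchy_convergent)
  qed
  show "0 \<in> {v. convergent (\<lambda>m. T m v)}" by (simp add: clinear_map_zero[OF lin] convergent_const)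
  fix v assume v: "v \<in> {v. convergent (\<lambda>m. T m v)}"
  show "v + w \<in> {v. convergent (\<lambda>m. T m v)}" if "w \<in> {v. convergent (\<lambda>m. T m v)}" for w
    using v that by (simp add: clinear_map_add[OF lin] convergent_add)
  show "scaleC c v \<in> {v. convergent (\<lambda>m. T m v)}" for c
  proof -
    have "convergent (\<lambda>m. scaleC c (T m v))"
      using v by (auto simp: convergent_def intro: bounded_linear.tendsto[OF bounded_linear_scaleC_right])
    then show ?thesis by (simp add: clinear_map_scale[OF lin])
  qed
qed

section \<open>Irreducible representations of the group C*-algebra\<close>

locale td_irrep = td_group G K \<mu> for G :: "'g::{second_countable_topology,t2_space} monoid" (structure) and K \<mu> +
  fixes \<pi> :: "(nat \<Rightarrow> 'g \<Rightarrow> complex) set \<Rightarrow> 'h::complex_hilbert \<Rightarrow> 'h"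
  assumes irr: "irreducible_star_rep (group_cstar G euclidean \<mu>) \<pi>"
begin

definition rep :: "(nat \<Rightarrow> 'g \<Rightarrow> complex) \<Rightarrow> 'h \<Rightarrow> 'h" where
  "rep F = \<pi> (cls F)"

lemma star_rep: "star_rep CA \<pi>"
  using irr by (simp add: irreducible_star_rep_def)

lemma rep_bounded: "F \<in> CS \<Longrightarrow> bounded_clinear_map (rep F)"
  using star_rep by (simp add: star_rep_def rep_def carrier_CA)

lemma rep_linear: "F \<in> CS \<Longrightarrow> clinear_map (rep F)"
  using rep_bounded by (simp add: bounded_clinear_map_def)

lemma rep_cong: "(F, H) \<in> CE \<Longrightarrow> rep F = rep H"
  by (simp add: rep_def cls_eq)

lemma rep_add: "F \<in> CS \<Longrightarrow> H \<in> CS \<Longrightarrow> rep (\<lambda>k x. F k x + H k x) v = rep F v + rep H v"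
  using star_rep by (simp add: star_rep_def rep_def carrier_CA flip: CA_add)

lemma rep_scale: "F \<in> CS \<Longrightarrow> rep (\<lambda>k x. c * F k x) v = scaleC c (rep F v)"
  using star_rep by (simp add: star_rep_def rep_def carrier_CA flip: CA_scale)

lemma rep_mult: "F \<in> CS \<Longrightarrow> H \<in> CS \<Longrightarrow> rep (\<lambda>k. conv (F k) (H k)) v = rep F (rep H v)"
  using star_rep by (simp add: star_rep_def rep_def carrier_CA flip: CA_mult)

lemma rep_star: "F \<in> CS \<Longrightarrow> cinner (rep (\<lambda>k. star (F k)) v) w = cinner v (rep F w)"
  using star_rep by (simp add: star_rep_def rep_def carrier_CA flip: CA_star)

lemma rep_diff:
  assumes "F \<in> CS" "H \<in> CS"
  shows "rep (\<lambda>k x. F k x - H k x) v = rep F v - rep H v"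
  using rep_add[OF assms(1) CS_scale[OF assms(2), of "-1"], of v] rep_scale[OF assms(2), of "-1" v]
  by simp

text \<open>With \<open>h = a\<^sup>* a = 2 b - b\<^sup>2\<close>, the operator \<open>1 - \<pi>(h) = (1 - \<pi>(b))\<^sup>2\<close> is positive.\<close>

lemma rep_contraction_lt_1:
  assumes F: "F \<in> CS" and q: "0 \<le> q" "q < 1" "\<And>k. un (F k) \<le> q"
  shows "norm (rep F v) \<le> norm v"
proof -
  define H where "H k = conv (star (F k)) (F k)" for k
  define E where "E k = root_iter (H k) k" for k
  have H: "H \<in> CS" unfolding H_def by (intro CS_conv CS_star F)
  have Hq: "un (H k) \<le> q" for k
  proof -
    have c: "F k \<in> Cc" by (rule CS_Cc[OF F])
    have "un (H k) \<le> un (star (F k)) * un (F k)"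
      unfolding H_def by (rule un_conv[OF Cc_star[OF c] c])
    also have "\<dots> \<le> q * 1"
      using un_star[OF c] q(2) q(3)[of k] un_nonneg[OF c] un_nonneg[OF Cc_star[OF c]] by (intro mult_mono) auto
    finally show ?thesis by simp
  qed
  have E: "E \<in> CS" unfolding E_def by (rule CS_root_iter[OF q(1,2) H Hq])
  have Hs: "star (H k) = H k" for k
    unfolding H_def by (simp add: star_conv Cc_star CS_Cc[OF F] star_star)
  have Es: "star (E k) = E k" for k
    unfolding E_def by (rule star_root_iter[OF CS_Cc[OF H] Hs])
  have EE: "(\<lambda>k. conv (E k) (E k)) \<in> CS" by (rule CS_conv[OF E E])
  have "(\<lambda>k x. 2 * E k x, \<lambda>k x. H k x + conv (E k) (E k) x) \<in> CE"
    unfolding E_def by (rule CE_root_iter[OF q(1,2) H Hq])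
  from rep_cong[OF this] have "scaleC 2 (rep E v) = rep H v + rep E (rep E v)"
    by (simp add: rep_scale[OF E, symmetric] rep_mult[OF E E, symmetric] rep_add[OF H EE, symmetric])
  then have eq: "rep H v = scaleC 2 (rep E v) - rep E (rep E v)" by simp
  have Eadj: "cinner (rep E a) b = cinner a (rep E b)" for a b
    using rep_star[OF E, of a b] by (simp add: Es)
  have HF: "rep H v = rep (\<lambda>k. star (F k)) (rep F v)"
    unfolding H_def by (rule rep_mult[OF CS_star[OF F] F])
  have "cinner (rep H v) v = cinner (rep F v) (rep F v)"
    unfolding HF by (rule rep_star[OF F])
  also have "cinner (rep H v) v = 2 * cinner (rep E v) v - cinner (rep E v) (rep E v)"
    by (simp add: eq cinner_diff(1) cinner_scaleC_left Eadj)
  finally have 1: "cinner (rep F v) (rep F v) = 2 * cinner (rep E v) v - cinner (rep E v) (rep E v)" ..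
  have "cinner (v - rep E v) (v - rep E v)
      = cinner v v - 2 * cinner (rep E v) v + cinner (rep E v) (rep E v)"
    using Eadj[of v v] by (simp add: cinner_diff)
  with 1 have "cinner (v - rep E v) (v - rep E v) = cinner v v - cinner (rep F v) (rep F v)" by simp
  then have "(norm (v - rep E v))\<^sup>2 = (norm v)\<^sup>2 - (norm (rep F v))\<^sup>2"
    by (simp add: norm_sq_cinner)
  then have "(norm (rep F v))\<^sup>2 \<le> (norm v)\<^sup>2" by (metis diff_ge_0_iff_ge zero_le_power2)
  then show ?thesis by (rule power2_le_imp_le) simp
qed

text \<open>Dividing by any \<open>q' > q\<close> brings the sequence strictly inside the unit ball,
  as the square root requires; then \<open>q'\<close> tends to \<open>q\<close>.\<close>

lemma rep_norm_le:
  assumes F: "F \<in> CS" and q: "0 \<le> q" "\<And>k. un (F k) \<le> q"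
  shows "norm (rep F v) \<le> q * norm v"
proof -
  have *: "norm (rep F v) \<le> q' * norm v" if q': "q < q'" for q'
  proof -
    let ?c = "complex_of_real (1 / q')"
    have pos: "q' > 0" using q q' by simp
    have "norm (rep (\<lambda>k x. ?c * F k x) v) \<le> norm v"
    proof (rule rep_contraction_lt_1[OF CS_scale[OF F]])
      show "0 \<le> q / q'" "q / q' < 1" using q q' pos by (simp_all add: field_simps)
      fix k
      have "un (\<lambda>x. ?c * F k x) \<le> cmod ?c * un (F k)" by (rule un_scale_le[OF CS_Cc[OF F]])
      also have "\<dots> = un (F k) / q'" using pos by (simp add: norm_divide)
      also have "\<dots> \<le> q / q'" using pos q(2) by (simp add: divide_right_mono)
      finally show "un (\<lambda>x. ?c * F k x) \<le> q / q'" .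
    qed
    then have "cmod ?c * norm (rep F v) \<le> norm v" by (simp only: rep_scale[OF F] norm_scaleC)
    then show ?thesis using pos by (simp add: norm_divide field_simps)
  qed
  show ?thesis
  proof (rule field_le_epsilon)
    fix e :: real assume e: "e > 0"
    define d where "d = e / (norm v + 1)"
    have d: "d > 0" using e by (simp add: d_def add_nonneg_pos)
    have "norm (rep F v) \<le> (q + d) * norm v" using * d by simp
    also have "\<dots> \<le> q * norm v + d * (norm v + 1)" using d by (simp add: algebra_simps)
    also have "d * (norm v + 1) = e" by (simp add: d_def add_nonneg_pos less_imp_neq[symmetric] add_pos_nonneg)
    finally show "norm (rep F v) \<le> q * norm v + e" .
  qed
qed

text \<open>The representation on the dense subalgebra of compactly supported functions, embedded as
  constant sequences.\<close>

definition sig :: "('g \<Rightarrow> complex) \<Rightarrow> 'h \<Rightarrow> 'h" where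
  "sig f = rep (\<lambda>_. f)"

lemma sig_linear: "f \<in> Cc \<Longrightarrow> clinear_map (sig f)"
  by (simp add: sig_def rep_linear CS_const)

lemma sig_add: "f \<in> Cc \<Longrightarrow> h \<in> Cc \<Longrightarrow> sig (\<lambda>x. f x + h x) v = sig f v + sig h v"
  using rep_add[OF CS_const CS_const] by (simp add: sig_def)

lemma sig_diff: "f \<in> Cc \<Longrightarrow> h \<in> Cc \<Longrightarrow> sig (\<lambda>x. f x - h x) v = sig f v - sig h v"
  using rep_diff[OF CS_const CS_const] by (simp add: sig_def)

lemma sig_scale: "f \<in> Cc \<Longrightarrow> sig (\<lambda>x. c * f x) v = scaleC c (sig f v)"
  using rep_scale[OF CS_const] by (simp add: sig_def)

lemma sig_conv: "f \<in> Cc \<Longrightarrow> h \<in> Cc \<Longrightarrow> sig (conv f h) v = sig f (sig h v)"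
  using rep_mult[OF CS_const CS_const] by (simp add: sig_def)

lemma sig_zero: "sig (\<lambda>x. 0) v = 0"
  using sig_scale[OF Cc_zero, of 0] by simp

lemma sig_sum:
  "(\<And>i. i \<in> A \<Longrightarrow> f i \<in> Cc) \<Longrightarrow> sig (\<lambda>x. \<Sum>i\<in>A. f i x) v = (\<Sum>i\<in>A. sig (f i) v)"
  by (induction A rule: infinite_finite_induct) (simp_all add: sig_zero sig_add Cc_sum)

lemma sig_norm_le: "f \<in> Cc \<Longrightarrow> norm (sig f v) \<le> L1 f * norm v"
  unfolding sig_def by (rule rep_norm_le) (simp_all add: CS_const L1_nonneg un_le_L1)

lemma rep_approx:
  assumes F: "F \<in> CS" and e: "e > 0"
  obtains f where "f \<in> Cc" "\<And>v. norm (rep F v - sig f v) \<le> e * norm v"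
proof -
  obtain M where M: "\<And>i j. i \<ge> M \<Longrightarrow> j \<ge> M \<Longrightarrow> un (\<lambda>x. F i x - F j x) < e"
    using CS_cauchy[OF F e] by blast
  have f: "F M \<in> Cc" by (rule CS_Cc[OF F])
  have "norm (rep F v - sig (F M) v) \<le> e * norm v" for v
  proof -
    have "rep F v - sig (F M) v = rep (\<lambda>k x. F (k + M) x - F M x) v"
      using rep_cong[OF CE_offset[OF F, of M]]
      by (simp add: sig_def rep_diff[OF CS_offset[OF F, of M] CS_const[OF f]])
    also have "norm \<dots> \<le> e * norm v"
    proof (rule rep_norm_le)
      have "(\<lambda>k x. F (k + M) x + - 1 * F M x) \<in> CS"
        by (rule CS_add[OF CS_offset[OF F, of M] CS_scale[OF CS_const[OF f]]])
      then show "(\<lambda>k x. F (k + M) x - F M x) \<in> CS" by simp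
      show "un (\<lambda>x. F (k + M) x - F M x) \<le> e" for k using M[of "k + M" M] by simp
    qed (use e in simp)
    finally show ?thesis .
  qed
  with f show ?thesis by (rule that)
qed

lemma closed_csubspace_approx:
  assumes W: "closed_csubspace W" and F: "F \<in> CS" and in_W: "\<And>f. f \<in> Cc \<Longrightarrow> sig f v \<in> W"
  shows "rep F v \<in> W"
proof -
  have "closed W" using W by (simp add: closed_csubspace_def)
  moreover have "\<exists>y\<in>W. dist y (rep F v) < e" if e: "e > 0" for e
  proof -
    have d: "e / (norm v + 1) > 0" using e by (simp add: add_nonneg_pos)
    obtain f where f: "f \<in> Cc" "norm (rep F v - sig f v) \<le> e / (norm v + 1) * norm v"
      using rep_approx[OF F d] by metis
    note f(2)
    also have "e / (norm v + 1) * norm v < e" using e by (simp add: field_simps add_pos_nonneg)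
    finally show ?thesis using in_W[OF f(1)] by (intro bexI[of _ "sig f v"]) (simp_all add: dist_norm norm_minus_commute)
  qed
  ultimately show ?thesis using closed_approachable by blast
qed

lemma irreducible_invariant:
  assumes "closed_csubspace W" "\<And>F v. F \<in> CS \<Longrightarrow> v \<in> W \<Longrightarrow> rep F v \<in> W" "w \<in> W" "w \<noteq> 0"
  shows "W = UNIV"
proof -
  have "\<forall>a\<in>carrier CA. \<pi> a ` W \<subseteq> W" using assms(2) by (auto simp: carrier_CA rep_def)
  then have "W = {0} \<or> W = UNIV" using irr assms(1) by (simp add: irreducible_star_rep_def)
  then show ?thesis using assms(3,4) by auto
qed

text \<open>By density such a \<open>W\<close> contains the range of every operator of the algebra.
  It is therefore invariant, and nonzero since the representation does not vanish, so irreducibility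
  makes it everything.\<close>

lemma sig_generates:
  assumes W: "closed_csubspace W" and in_W: "\<And>f w. f \<in> Cc \<Longrightarrow> sig f w \<in> W"
  shows "v \<in> W"
proof -
  have *: "rep F w \<in> W" if "F \<in> CS" for F w using closed_csubspace_approx[OF W that in_W] .
  obtain F w where "F \<in> CS" "rep F w \<noteq> 0"
    using irr unfolding irreducible_star_rep_def carrier_CA rep_def by blast
  then have "W = UNIV" using irreducible_invariant[OF W * *] by blast
  then show ?thesis by simp
qed

text \<open>Reduces operator identities for \<open>u\<close> and \<open>P\<close> to identities
  between convolutions and translates of functions.\<close>

lemma contraction_ext:
  assumes "clinear_contraction S" "clinear_contraction T"
    and "\<And>f w. f \<in> Cc \<Longrightarrow> S (sig f w) = T (sig f w)"
  shows "S v = T v"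
  using sig_generates[OF closed_csubspace_equalizer[OF assms(1,2)], of v] assms(3) by simp

section \<open>Approximate unit and the representation of the group\<close>

definition P :: "nat \<Rightarrow> 'h \<Rightarrow> 'h" where
  "P m = sig (bump m)"

lemma sig_shift_bump_contraction: "clinear_contraction (sig (shift g (bump m)))"
  unfolding clinear_contraction_def
  using sig_linear[OF Cc_shift[OF Cc_bump]] sig_norm_le[OF Cc_shift[OF Cc_bump], of g m]
  by (simp add: L1_shift Cc_bump L1_bump)

lemma P_contraction: "clinear_contraction (P m)"
  using sig_shift_bump_contraction[of \<one> m] by (simp add: P_def shift_one)

lemma P_idem: "P m (P m v) = P m v"
  by (simp add: P_def sig_conv[symmetric] Cc_bump conv_bump_bump)

lemma sig_shift_bump_tendsto:
  assumes f: "f \<in> Cc"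
  shows "(\<lambda>m. sig (shift g (bump m)) (sig f w)) \<longlonglongrightarrow> sig (shift g f) w"
proof -
  have eq: "sig (shift g (bump m)) (sig f w) - sig (shift g f) w
      = sig (shift g (\<lambda>x. conv (bump m) f x - f x)) w" for m
  proof -
    have "sig (shift g (bump m)) (sig f w) = sig (shift g (conv (bump m) f)) w"
      by (simp add: sig_conv[symmetric] Cc_shift Cc_bump f conv_shift_left)
    moreover have "shift g (\<lambda>x. conv (bump m) f x - f x) = (\<lambda>x. shift g (conv (bump m) f) x - shift g f x)"
      by (simp add: shift_def)
    ultimately show ?thesis by (simp add: sig_diff Cc_shift Cc_conv Cc_bump f)
  qed
  have "(\<lambda>m. sig (shift g (bump m)) (sig f w) - sig (shift g f) w) \<longlonglongrightarrow> 0"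
  proof (rule Lim_null_comparison)
    have c: "(\<lambda>x. conv (bump m) f x - f x) \<in> Cc" for m by (intro Cc_diff Cc_conv Cc_bump f)
    show "eventually (\<lambda>m. norm (sig (shift g (bump m)) (sig f w) - sig (shift g f) w)
        \<le> L1 (\<lambda>x. conv (bump m) f x - f x) * norm w) sequentially"
      unfolding eq using sig_norm_le[OF Cc_shift[OF c]] by (simp add: L1_shift[OF c])
    show "(\<lambda>m. L1 (\<lambda>x. conv (bump m) f x - f x) * norm w) \<longlonglongrightarrow> 0"
      using tendsto_mult[OF L1_conv_bump_tendsto[OF f] tendsto_const[of "norm w"]] by simp
  qed
  then show ?thesis by (simp add: LIM_zero_iff)
qed

text \<open>The image of the point mass at \<open>g\<close>, approached by translated bumps.\<close>

definition u :: "'g \<Rightarrow> 'h \<Rightarrow> 'h" where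
  "u g v = lim (\<lambda>m. sig (shift g (bump m)) v)"

lemma u_tendsto: "(\<lambda>m. sig (shift g (bump m)) v) \<longlonglongrightarrow> u g v"
proof -
  have "v \<in> {v. convergent (\<lambda>m. sig (shift g (bump m)) v)}"
    by (rule sig_generates[OF closed_csubspace_convergent[OF sig_shift_bump_contraction]])
      (use sig_shift_bump_tendsto in \<open>auto simp: convergent_def\<close>)
  then show ?thesis by (simp add: u_def convergent_LIMSEQ_iff)
qed

lemma u_sig: "f \<in> Cc \<Longrightarrow> u g (sig f w) = sig (shift g f) w"
  using LIMSEQ_unique[OF u_tendsto sig_shift_bump_tendsto] .

lemma u_contraction: "clinear_contraction (u g)"
  unfolding clinear_contraction_def clinear_map_def
proof (intro conjI allI)
  note lin = contraction_linear[OF sig_shift_bump_contraction]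
  show "u g (v + w) = u g v + u g w" for v w
    using LIMSEQ_unique[OF u_tendsto, of g "v + w"] tendsto_add[OF u_tendsto[of g v] u_tendsto[of g w]]
    by (simp add: clinear_map_add[OF lin])
  show "u g (scaleC c v) = scaleC c (u g v)" for c v
    using LIMSEQ_unique[OF u_tendsto, of g "scaleC c v"]
      bounded_linear.tendsto[OF bounded_linear_scaleC_right u_tendsto[of g v], of c]
    by (simp add: clinear_map_scale[OF lin])
  show "norm (u g v) \<le> norm v" for v
    by (rule LIMSEQ_le_const2[OF tendsto_norm[OF u_tendsto]])
      (auto intro: contraction_norm[OF sig_shift_bump_contraction])
qed

lemmas u_linear = contraction_linear[OF u_contraction]

lemma u_mult: "u g (u h v) = u (g \<otimes> h) v"
  by (rule contraction_ext[OF contraction_comp[OF u_contraction u_contraction] u_contraction])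
    (simp add: u_sig Cc_shift shift_shift)

lemma u_one: "u \<one> v = v"
  by (rule contraction_ext[OF u_contraction contraction_id]) (simp add: u_sig shift_one)

lemma P_tendsto: "(\<lambda>m. P m v) \<longlonglongrightarrow> v"
  using u_tendsto[of \<one> v] by (simp add: u_one shift_one P_def)

lemma u_P: "k \<in> K m \<Longrightarrow> u k (P m v) = P m v"
  by (simp add: P_def u_sig Cc_bump shift_bump)

lemma P_u: "k \<in> K m \<Longrightarrow> P m (u k v) = P m v"
  by (rule contraction_ext[OF contraction_comp[OF P_contraction u_contraction] P_contraction])
    (simp add: u_sig P_def sig_conv[symmetric] Cc_shift Cc_bump conv_bump_shift)

lemma u_P_eq: "u g (P m v) = sig (shift g (bump m)) v"
  by (simp add: P_def u_sig Cc_bump)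

text \<open>A translated bump acts as \<open>u x\<close> after \<open>P m\<close>, so step functions
  become finite combinations of such operators. As in \<open>step_approximation\<close>,
  \<open>C\<close> precedes \<open>e\<close> and \<open>m\<close>.\<close>

lemma sig_step:
  assumes f: "f \<in> Cc"
  shows "\<exists>C\<ge>0. \<forall>e>0. \<exists>M. \<forall>m\<ge>M. \<exists>X c. finite X \<and> (\<Sum>x\<in>X. cmod (c x)) \<le> C \<and>
    (\<forall>v. norm (sig f v - (\<Sum>x\<in>X. scaleC (c x) (u x (P m v)))) \<le> e * norm v)"
proof -
  obtain C where C: "\<And>e. e > 0 \<Longrightarrow> \<exists>M. \<forall>m\<ge>M. \<exists>X c. finite X \<and> (\<Sum>x\<in>X. cmod (c x)) \<le> C \<and>
    L1 (\<lambda>y. f y - (\<Sum>x\<in>X. c x * shift x (bump m) y)) < e"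
    using step_approximation[OF f] by blast
  have *: "norm (sig f v - (\<Sum>x\<in>X. scaleC (c x) (u x (P m v)))) \<le> e * norm v"
    if "finite X" "L1 (\<lambda>y. f y - (\<Sum>x\<in>X. c x * shift x (bump m) y)) < e" for X c m e v
  proof -
    have c: "(\<lambda>y. \<Sum>x\<in>X. c x * shift x (bump m) y) \<in> Cc" by (intro Cc_sum Cc_scale Cc_shift Cc_bump)
    have "sig f v - (\<Sum>x\<in>X. scaleC (c x) (u x (P m v)))
        = sig (\<lambda>y. f y - (\<Sum>x\<in>X. c x * shift x (bump m) y)) v"
      by (simp add: sig_diff f c sig_sum Cc_scale Cc_shift Cc_bump sig_scale u_P_eq)
    also have "norm \<dots> \<le> L1 (\<lambda>y. f y - (\<Sum>x\<in>X. c x * shift x (bump m) y)) * norm v"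
      by (rule sig_norm_le[OF Cc_diff[OF f c]])
    also have "\<dots> \<le> e * norm v" using that(2) by (intro mult_right_mono) auto
    finally show ?thesis .
  qed
  have "C \<ge> 0"
  proof -
    obtain X and c :: "'g \<Rightarrow> complex" where "(\<Sum>x\<in>X. cmod (c x)) \<le> C" using C[of 1] by auto
    moreover have "0 \<le> (\<Sum>x\<in>X. cmod (c x))" by (rule sum_nonneg) simp
    ultimately show ?thesis by linarith
  qed
  moreover have "\<exists>M. \<forall>m\<ge>M. \<exists>X c. finite X \<and> (\<Sum>x\<in>X. cmod (c x)) \<le> C \<and>
    (\<forall>v. norm (sig f v - (\<Sum>x\<in>X. scaleC (c x) (u x (P m v)))) \<le> e * norm v)" if e: "e > 0" for e
  proof -
    obtain M where M: "\<And>m. m \<ge> M \<Longrightarrow> \<exists>X c. finite X \<and> (\<Sum>x\<in>X. cmod (c x)) \<le> C \<and>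
      L1 (\<lambda>y. f y - (\<Sum>x\<in>X. c x * shift x (bump m) y)) < e" using C[OF e] by blast
    show ?thesis
    proof (intro exI[of _ M] allI impI)
      fix m assume "m \<ge> M"
      from M[OF this] obtain X c where "finite X" "(\<Sum>x\<in>X. cmod (c x)) \<le> C"
        "L1 (\<lambda>y. f y - (\<Sum>x\<in>X. c x * shift x (bump m) y)) < e" by blast
      with *[OF this(1,3)] show "\<exists>X c. finite X \<and> (\<Sum>x\<in>X. cmod (c x)) \<le> C \<and>
        (\<forall>v. norm (sig f v - (\<Sum>x\<in>X. scaleC (c x) (u x (P m v)))) \<le> e * norm v)" by blast
    qed
  qed
  ultimately show ?thesis by blast
qed

section \<open>Invariant subspaces and compactness of the operators\<close>

lemma csubspace_sum:
  assumes "closed_csubspace W" "\<And>i. i \<in> A \<Longrightarrow> f i \<in> W"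
  shows "(\<Sum>i\<in>A. scaleC (c i) (f i)) \<in> W"
  using assms(2)
  by (induction A rule: infinite_finite_induct) (use assms(1) in \<open>auto simp: closed_csubspace_def\<close>)

text \<open>\<open>P m v\<close> need not lie in \<open>W\<close>, so it is replaced by
  \<open>v\<close> inside the approximating sum. The cost is at most
  \<open>C * norm (P m v - v)\<close>, which is small for large \<open>m\<close> because
  \<open>C\<close> does not depend on \<open>m\<close>.\<close>

lemma sig_invariant:
  assumes W: "closed_csubspace W" and inv: "\<And>g w. w \<in> W \<Longrightarrow> u g w \<in> W" and f: "f \<in> Cc" and v: "v \<in> W"
  shows "sig f v \<in> W"
proof -
  have "closed W" using W by (simp add: closed_csubspace_def)
  moreover have "\<exists>y\<in>W. dist y (sig f v) < e" if e: "e > 0" for e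
  proof -
    obtain C where C: "C \<ge> 0" "\<forall>e>0. \<exists>M. \<forall>m\<ge>M. \<exists>X c. finite X \<and> (\<Sum>x\<in>X. cmod (c x)) \<le> C \<and>
      (\<forall>v. norm (sig f v - (\<Sum>x\<in>X. scaleC (c x) (u x (P m v)))) \<le> e * norm v)"
      using sig_step[OF f] by (elim exE conjE) (rule that)
    define d where "d = e / (norm v + C + 1)"
    have den: "norm v + C + 1 > 0" using C(1) by (simp add: add_nonneg_pos)
    have d: "d > 0" using e den by (simp add: d_def)
    obtain M where M: "\<And>m. m \<ge> M \<Longrightarrow> \<exists>X c. finite X \<and> (\<Sum>x\<in>X. cmod (c x)) \<le> C \<and>
      (\<forall>v. norm (sig f v - (\<Sum>x\<in>X. scaleC (c x) (u x (P m v)))) \<le> d * norm v)"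
      using C(2)[rule_format, OF d] by blast
    obtain N where N: "\<And>m. m \<ge> N \<Longrightarrow> norm (P m v - v) < d"
      using LIMSEQ_D[OF P_tendsto d] by blast
    define m where "m = max M N"
    obtain X c where X: "finite X" "(\<Sum>x\<in>X. cmod (c x)) \<le> C"
      "norm (sig f v - (\<Sum>x\<in>X. scaleC (c x) (u x (P m v)))) \<le> d * norm v"
      using M[of m] by (auto simp: m_def)
    let ?y = "\<Sum>x\<in>X. scaleC (c x) (u x v)" and ?z = "\<Sum>x\<in>X. scaleC (c x) (u x (P m v))"
    have "?z - ?y = (\<Sum>x\<in>X. scaleC (c x) (u x (P m v - v)))"
      by (simp add: sum_subtractf clinear_map_diff[OF u_linear] complex_vector.scale_right_diff_distrib)
    also have "norm \<dots> \<le> (\<Sum>x\<in>X. norm (scaleC (c x) (u x (P m v - v))))" by (rule norm_sum)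
    also have "\<dots> \<le> (\<Sum>x\<in>X. cmod (c x) * d)"
    proof (rule sum_mono)
      fix x
      have "norm (u x (P m v - v)) \<le> d"
        using contraction_norm[OF u_contraction, of x "P m v - v"] N[of m] by (simp add: m_def)
      then show "norm (scaleC (c x) (u x (P m v - v))) \<le> cmod (c x) * d"
        by (simp add: norm_scaleC mult_left_mono)
    qed
    also have "\<dots> \<le> C * d" using X(2) d by (simp add: mult_right_mono flip: sum_distrib_right)
    finally have "norm (sig f v - ?y) \<le> d * norm v + C * d"
      using X(3) norm_triangle_ineq[of "sig f v - ?z" "?z - ?y"] by simp
    also have "\<dots> < d * (norm v + C + 1)" using d by (simp add: algebra_simps)
    also have "\<dots> = e" using den by (simp add: d_def)
    finally have "dist ?y (sig f v) < e" by (simp add: dist_norm norm_minus_commute)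
    moreover have "?y \<in> W" by (rule csubspace_sum[OF W inv[OF v]])
    ultimately show ?thesis by blast
  qed
  ultimately show ?thesis using closed_approachable by blast
qed

lemma u_irreducible:
  assumes W: "closed_csubspace W" and inv: "\<And>g w. w \<in> W \<Longrightarrow> u g w \<in> W" and "w \<in> W" "w \<noteq> 0"
  shows "W = UNIV"
proof (rule irreducible_invariant[OF W])
  show "rep F v \<in> W" if "F \<in> CS" "v \<in> W" for F v
    by (rule closed_csubspace_approx[OF W that(1)]) (rule sig_invariant[OF W inv _ that(2)])
qed fact+

lemma compact_operator_if_finite_rank:
  assumes fin: "\<And>m. \<exists>S. finite S \<and> (\<forall>v. P m v \<in> complex_vector.span S)" and a: "a \<in> carrier CA"
  shows "compact_operator (\<pi> a)"
proof -
  obtain F where F: "F \<in> CS" "\<pi> a = rep F" using a by (auto simp: carrier_CA rep_def)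
  show ?thesis unfolding F(2)
  proof (rule compact_operatorI_approx[OF rep_bounded[OF F(1)]])
    fix e :: real assume e: "e > 0"
    then have e3: "e / 3 > 0" by simp
    obtain f where f: "f \<in> Cc" "\<And>v. norm (rep F v - sig f v) \<le> e / 3 * norm v"
      using rep_approx[OF F(1) e3] by metis
    obtain m X c where X: "finite X" "\<And>v. norm (sig f v - (\<Sum>x\<in>X. scaleC (c x) (u x (P m v)))) \<le> e / 3 * norm v"
      using sig_step[OF f(1)] e3 by (metis order_refl)
    obtain S where S: "finite S" "\<And>v. P m v \<in> complex_vector.span S" using fin by blast
    \<comment> \<open>Bounds the combination on the unit ball, as \<open>u x\<close> and
      \<open>P m\<close> are contractions; the image then lies in a bounded part of a
      finite-dimensional space.\<close>
    define r where "r = (\<Sum>x\<in>X. cmod (c x))"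
    define C where "C = complex_vector.span (\<Union>x\<in>X. u x ` S) \<inter> cball 0 r"
    have "compact C" unfolding C_def by (rule compact_span_cball) (use X S in auto)
    moreover have "\<exists>y\<in>C. dist (rep F v) y < e" if v: "v \<in> cball 0 1" for v
    proof -
      let ?y = "\<Sum>x\<in>X. scaleC (c x) (u x (P m v))"
      have sp: "u x w \<in> complex_vector.span (u x ` S)" if "w \<in> complex_vector.span S" for x w
        using that
      proof (induction rule: complex_vector.span_induct_alt)
        case base
        then show ?case by (simp add: clinear_map_zero[OF u_linear] complex_vector.span_zero)
      next
        case (step c x' y)
        then show ?case
          by (simp add: clinear_map_add[OF u_linear] clinear_map_scale[OF u_linear]
              complex_vector.span_add complex_vector.span_scale complex_vector.span_base)
      qed
      have "u x (P m v) \<in> complex_vector.span (\<Union>x\<in>X. u x ` S)" if "x \<in> X" for x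
        using sp[OF S(2), of x v] complex_vector.span_mono[of "u x ` S" "\<Union>x\<in>X. u x ` S"] that by blast
      then have "?y \<in> complex_vector.span (\<Union>x\<in>X. u x ` S)"
        by (intro complex_vector.span_sum complex_vector.span_scale)
      moreover have "norm ?y \<le> r"
      proof -
        have "norm ?y \<le> (\<Sum>x\<in>X. norm (scaleC (c x) (u x (P m v))))" by (rule norm_sum)
        also have "\<dots> \<le> (\<Sum>x\<in>X. cmod (c x) * 1)"
        proof (rule sum_mono)
          fix x
          have "norm (u x (P m v)) \<le> 1"
            using contraction_norm[OF u_contraction, of x "P m v"] contraction_norm[OF P_contraction, of m v] v by simp
          then show "norm (scaleC (c x) (u x (P m v))) \<le> cmod (c x) * 1"
            unfolding norm_scaleC by (intro mult_left_mono) auto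
        qed
        finally show ?thesis by (simp add: r_def)
      qed
      ultimately have "?y \<in> C" by (simp add: C_def)
      moreover have "dist (rep F v) ?y < e"
      proof -
        have "norm (rep F v - ?y) \<le> norm (rep F v - sig f v) + norm (sig f v - ?y)"
          using norm_triangle_ineq[of "rep F v - sig f v" "sig f v - ?y"] by simp
        also have "\<dots> \<le> e / 3 * norm v + e / 3 * norm v" by (intro add_mono f X)
        also have "\<dots> \<le> e / 3 * 1 + e / 3 * 1" using v e by (intro add_mono mult_left_mono) auto
        also have "\<dots> < e" using e by simp
        finally show ?thesis by (simp add: dist_norm)
      qed
      ultimately show ?thesis by blast
    qed
    ultimately show "\<exists>C. compact C \<and> (\<forall>v\<in>cball 0 1. \<exists>y\<in>C. dist (rep F v) y < e)" by blast
  qed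
qed

end

section \<open>Finite rank of the fixed-vector projections\<close>

lemma cis_power_neq_1:
  assumes "0 < k" "k < n"
  shows "cis (2 * pi / real n) ^ k \<noteq> 1"
proof
  assume *: "cis (2 * pi / real n) ^ k = 1"
  have "inj_on (\<lambda>k. cis (2 * pi * real k / real n)) {..<n}"
    using Complex.bij_betw_roots_unity[of n] assms by (simp add: bij_betw_def)
  moreover have "cis (2 * pi * real k / real n) = cis (2 * pi * real 0 / real n)"
    using * by (simp add: Complex.DeMoivre mult_ac)
  ultimately have "k = 0" by (rule inj_onD) (use assms in auto)
  with assms show False by simp
qed

text \<open>Orthogonality of the characters of the cyclic group of order \<open>n\<close>.\<close>

lemma sum_cis_powers:
  assumes "k < n"
  shows "(\<Sum>j<n. (cis (2 * pi / real n) ^ k) ^ j) = (if k = 0 then of_nat n else 0)"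
proof (cases "k = 0")
  case False
  have "(cis (2 * pi / real n) ^ k) ^ n = 1"
    using assms by (simp add: Complex.DeMoivre flip: power_mult)
      (metis cis_multiple_2pi Ints_of_nat mult.commute)
  then show ?thesis using False cis_power_neq_1[of k n] assms by (simp add: geometric_sum)
qed simp

context td_irrep
begin

lemma ex_nonzero: "\<exists>v :: 'h. v \<noteq> 0"
  using irr by (auto simp: irreducible_star_rep_def)

text \<open>A central element of finite order has an eigenvector, obtained by averaging over the powers.\<close>

lemma u_scalar:
  assumes comm: "\<And>h v. u g (u h v) = u h (u g v)"
  obtains c where "\<And>v. u g v = scaleC c v"
proof -
  obtain n where n: "n > 0" "g [^] (n::nat) = \<one>" using torsion by blast
  obtain v :: 'h where v: "v \<noteq> 0" using ex_nonzero by blast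
  define w where "w = cis (2 * pi / real n)"
  have wn: "w ^ n = 1" using n(1) by (simp add: w_def Complex.DeMoivre)
  \<comment> \<open>Up to the factor \<open>n\<close>, \<open>Q j\<close> is the component of
    \<open>v\<close> with eigenvalue \<open>inverse (w ^ j)\<close> under \<open>u g\<close>. These
    components add up to \<open>n\<close> times \<open>v\<close>, so one of them is nonzero.\<close>
  define a where "a j k = scaleC (w ^ (j * k)) (u (g [^] k) v)" for j k :: nat
  define Q where "Q j = (\<Sum>k<n. a j k)" for j
  have "(\<Sum>j<n. Q j) = (\<Sum>k<n. \<Sum>j<n. a j k)" unfolding Q_def by (rule sum.swap)
  also have "\<dots> = (\<Sum>k<n. scaleC (\<Sum>j<n. (w ^ k) ^ j) (u (g [^] k) v))"
    by (simp add: a_def complex_vector.scale_sum_left mult.commute flip: power_mult)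
  also have "\<dots> = (\<Sum>k<n. if k = 0 then scaleC (of_nat n) v else 0)"
    unfolding w_def by (intro sum.cong refl) (auto simp: sum_cis_powers u_one)
  also have "\<dots> = scaleC (of_nat n) v" using n(1) by simp
  finally have "(\<Sum>j<n. Q j) \<noteq> 0" using n(1) v by (simp add: complex_vector.scale_eq_0_iff)
  then obtain j where j: "Q j \<noteq> 0" by (meson sum.neutral)
  define c where "c = inverse (w ^ j)"
  have w0: "w ^ j \<noteq> 0" by (simp add: w_def)
  have "scaleC (w ^ j) (u g (Q j)) = (\<Sum>k<n. a j (Suc k))"
  proof -
    have "u g (u (g [^] k) v) = u (g [^] Suc k) v" for k :: nat
      using nat_pow_Suc2[of g k] by (simp add: u_mult del: nat_pow_Suc)
    then have "scaleC (w ^ j) (u g (a j k)) = a j (Suc k)" for k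
      by (simp add: a_def clinear_map_scale[OF u_linear] scaleC_scaleC power_add del: nat_pow_Suc)
    then show ?thesis
      by (simp add: Q_def clinear_map_sum[OF u_linear] complex_vector.scale_sum_right)
  qed
  also have "\<dots> = Q j"
  proof -
    have "a j 0 = a j n" by (simp add: a_def n(2) wn mult.commute[of j] power_mult)
    moreover have "(\<Sum>k<n. a j (Suc k)) + a j 0 = Q j + a j n"
      unfolding Q_def using sum.lessThan_Suc_shift[of "a j" n] by (simp add: add.commute)
    ultimately show ?thesis by simp
  qed
  finally have "scaleC c (scaleC (w ^ j) (u g (Q j))) = scaleC c (Q j)" by simp
  then have eig: "u g (Q j) = scaleC c (Q j)" using w0 by (simp add: scaleC_scaleC c_def)
  have cc: "clinear_contraction (\<lambda>v :: 'h. scaleC c v)"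
    by (simp add: clinear_contraction_def clinear_map_def scaleC_add_right scaleC_scaleC mult.commute
        norm_scaleC c_def w_def norm_inverse norm_power)
  have "{v. u g v = scaleC c v} = UNIV"
  proof (rule u_irreducible[OF closed_csubspace_equalizer[OF u_contraction cc] _ _ j])
    show "u h v \<in> {v. u g v = scaleC c v}" if "v \<in> {v. u g v = scaleC c v}" for h v
      using that by (simp add: comm clinear_map_scale[OF u_linear])
  qed (use eig in simp)
  then show ?thesis by (intro that[of c]) auto
qed

lemma finite_rankI:
  assumes X: "finite X"
    and span: "\<And>g v. P m (u g (P m v)) \<in> complex_vector.span ((\<lambda>x. P m (u x (P m v))) ` X)"
  shows "\<exists>S. finite S \<and> (\<forall>v. P m v \<in> complex_vector.span S)"
proof (cases "\<forall>v. P m v = 0")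
  case True
  then show ?thesis by (intro exI[of _ "{}"]) (simp add: complex_vector.span_zero)
next
  case False
  then obtain v where v: "P m v \<noteq> 0" by blast
  define S where "S = (\<lambda>x. P m (u x (P m v))) ` X"
  have S: "finite S" using X by (simp add: S_def)
  have lin: "clinear_contraction (\<lambda>w. P m (u g w))" for g
    by (rule contraction_comp[OF P_contraction u_contraction])
  note lin' = contraction_linear[OF lin]
  \<comment> \<open>Asking for all translates makes \<open>W\<close> invariant by construction, and
    closedness of finite-dimensional spans makes it closed. The hypothesis places
    \<open>P m v\<close> in it.\<close>
  define W where "W = {w. \<forall>g. P m (u g w) \<in> complex_vector.span S}"
  have "closed (complex_vector.span S)"
    by (rule closed_if_compact_balls) (rule compact_span_cball[OF S])
  then have "closed ((\<lambda>w. P m (u g w)) -` complex_vector.span S)" for g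
    by (intro closed_vimage linear_continuous_on contraction_bounded_linear lin)
  moreover have "W = (\<Inter>g. (\<lambda>w. P m (u g w)) -` complex_vector.span S)" by (auto simp: W_def)
  ultimately have "closed W" by auto
  then have W: "closed_csubspace W"
    by (auto simp: closed_csubspace_def W_def clinear_mapD[OF lin']
        complex_vector.span_zero complex_vector.span_add complex_vector.span_scale)
  have "W = UNIV"
  proof (rule u_irreducible[OF W _ _ v])
    show "P m v \<in> W" using span[of _ v] by (simp add: W_def S_def)
    show "u g w \<in> W" if "w \<in> W" for g w using that by (simp add: W_def u_mult)
  qed
  then have "P m (u \<one> w) \<in> complex_vector.span S" for w unfolding W_def by blast
  then show ?thesis using S by (auto simp: u_one)
qed

end

section \<open>The Heisenberg group is CCR\<close>

lemma continuous_on_vec_add [continuous_intros]: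
  fixes f g :: "'c::topological_space \<Rightarrow> 'a::ab_group_add fls ^ 'n::finite"
  assumes "continuous_on S f" "continuous_on S g"
  shows "continuous_on S (\<lambda>x. f x + g x)"
  unfolding plus_vec_def
  by (intro continuous_on_vec_lambda continuous_on_add continuous_on_component assms)

lemma continuous_on_vec_minus [continuous_intros]:
  fixes f :: "'c::topological_space \<Rightarrow> 'a::ab_group_add fls ^ 'n::finite"
  assumes "continuous_on S f"
  shows "continuous_on S (\<lambda>x. - f x)"
  unfolding uminus_vec_def
  by (intro continuous_on_vec_lambda continuous_on_minus continuous_on_component assms)

lemma heis_mult_eq:
  "x \<otimes>\<^bsub>heisenberg\<^esub> y = (fst x + fst y, fst (snd x) + fst (snd y),
     snd (snd x) + snd (snd y) + dot (fst x) (fst (snd y)))"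
  by (cases x, cases y) simp

lemma heis_inv_eq:
  "inv\<^bsub>heisenberg\<^esub> x = (- fst x, - fst (snd x), dot (fst x) (fst (snd x)) - snd (snd x))"
  by (cases x) simp

lemma continuous_heis_mult:
  "continuous_on UNIV (\<lambda>(x, y). x \<otimes>\<^bsub>heisenberg :: ('p::prime_card, 'n::finite) heis monoid\<^esub> y)"
  unfolding heis_mult_eq case_prod_beta by (intro continuous_intros)

lemma continuous_heis_inv:
  "continuous_on UNIV (\<lambda>x. inv\<^bsub>heisenberg :: ('p::prime_card, 'n::finite) heis monoid\<^esub> x)"
  unfolding heis_inv_eq by (intro continuous_intros)

section \<open>Compact open subgroups and torsion of the Heisenberg group\<close>

definition fls_vec_ball :: "int \<Rightarrow> ('a::zero fls ^ 'n) set" where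
  "fls_vec_ball k = {a. \<forall>i. a $ i \<in> fls_ball k}"

lemma open_fls_vec_ball: "open (fls_vec_ball k :: ('a::ab_group_add fls ^ 'n::finite) set)"
  unfolding fls_vec_ball_def by (rule open_vector_box) (simp add: open_fls_ball)

lemma compact_fls_vec_ball: "compact (fls_vec_ball k :: ('a::{finite,ab_group_add} fls ^ 'n::finite) set)"
  unfolding compact_eq_bounded_closed
proof
  have "fls_vec_ball k = (\<Inter>i. (\<lambda>a :: 'a fls ^ 'n. a $ i) -` fls_ball k)" by (auto simp: fls_vec_ball_def)
  moreover have "closed ((\<lambda>a :: 'a fls ^ 'n. a $ i) -` fls_ball k)" for i
    by (intro closed_vimage closed_fls_ball continuous_on_component continuous_on_id)
  ultimately show "closed (fls_vec_ball k :: ('a fls ^ 'n) set)" by auto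
  have "dist 0 a \<le> real CARD('n) * 2 powi (- k)" if "a \<in> fls_vec_ball k" for a :: "'a fls ^ 'n"
  proof -
    have "dist 0 a \<le> (\<Sum>i\<in>UNIV. dist (0 $ i) (a $ i))"
      unfolding dist_vec_def by (rule L2_set_le_sum) simp
    also have "\<dots> \<le> (\<Sum>i\<in>(UNIV :: 'n set). 2 powi (- k))"
      using that by (intro sum_mono) (simp add: fls_vec_ball_def dist_fls_le_iff fls_ball_uminus)
    finally show ?thesis by simp
  qed
  then show "bounded (fls_vec_ball k :: ('a fls ^ 'n) set)"
    unfolding bounded_any_center[where a = 0] by blast
qed

lemma fls_vec_ball_basis:
  fixes A :: "('a::group_add fls ^ 'n::finite) set"
  assumes "open A" "0 \<in> A"
  shows "\<exists>M. \<forall>m\<ge>M. fls_vec_ball m \<subseteq> A"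
proof -
  obtain B where B: "\<And>i. open (B i)" "\<And>i. (0 :: 'a fls ^ 'n) $ i \<in> B i" "\<And>y. (\<And>i. y $ i \<in> B i) \<Longrightarrow> y \<in> A"
    using assms unfolding open_vec_def by metis
  have "\<exists>k. fls_ball k \<subseteq> B i" for i
    using B(1)[of i] B(2)[of i] unfolding open_fls_iff by force
  then obtain k where k: "\<And>i. fls_ball (k i) \<subseteq> B i" by metis
  have "fls_vec_ball m \<subseteq> A" if "m \<ge> Max (range k)" for m
  proof
    fix y :: "'a fls ^ 'n" assume y: "y \<in> fls_vec_ball m"
    have "k i \<le> m" for i using that Max_ge[of "range k" "k i"] by simp
    then have "y $ i \<in> B i" for i
      using y k[of i] fls_ball_mono[of "k i" m] by (auto simp: fls_vec_ball_def)
    then show "y \<in> A" by (rule B(3))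
  qed
  then show ?thesis by blast
qed

text \<open>The level is a natural number because the dot product of two vectors of level
  \<open>m\<close> has level \<open>2 * m\<close>; for \<open>m \<ge> 0\<close> this lies in level
  \<open>m\<close>, which makes the set a subgroup.\<close>

definition heis_K :: "nat \<Rightarrow> ('p::prime_card, 'n::finite) heis set" where
  "heis_K m = fls_vec_ball (int m) \<times> fls_vec_ball (int m) \<times> fls_ball (int m)"

lemma dot_fls_vec_ball:
  fixes a b :: "'a::idom fls ^ 'n::finite"
  assumes "a \<in> fls_vec_ball (int m)" "b \<in> fls_vec_ball (int m)"
  shows "dot a b \<in> fls_ball (int m)"
proof -
  have "a $ i * b $ i \<in> fls_ball (int m)" for i
    using fls_ball_mult[of "a $ i" "int m" "b $ i" "int m"] fls_ball_mono[of "int m" "int m + int m"] assms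
    by (auto simp: fls_vec_ball_def)
  then show ?thesis unfolding dot_def by (intro fls_ball_sum)
qed

lemma heis_pow:
  fixes a b :: "'p::prime_card mod_ring fls ^ 'n::finite"
  shows "\<exists>z. (a, b, c) [^]\<^bsub>heisenberg\<^esub> (k::nat) = ((\<chi> i. of_nat k * a $ i), (\<chi> i. of_nat k * b $ i), z)"
proof (induction k)
  case 0
  show ?case by (simp add: vec_eq_iff)
next
  case (Suc k)
  then obtain z where "(a, b, c) [^]\<^bsub>heisenberg\<^esub> k = ((\<chi> i. of_nat k * a $ i), (\<chi> i. of_nat k * b $ i), z)" by blast
  then show ?case by (simp add: vec_eq_iff distrib_right add.commute)
qed

lemma heis_pow_center:
  "(0, 0, z) [^]\<^bsub>heisenberg\<^esub> (k::nat) = (0, 0, of_nat k * z)"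
  by (induction k) (simp_all add: distrib_right add.commute)

text \<open>The \<open>p\<close>-th power of an element is central, and a second \<open>p\<close>-th
  power kills the centre. The exponent \<open>p * p\<close> also covers \<open>p = 2\<close>, where
  squaring leaves the central term \<open>dot a b\<close>.\<close>

lemma heis_torsion:
  fixes x :: "('p::prime_card, 'n::finite) heis"
  shows "\<exists>n>0. x [^]\<^bsub>heisenberg\<^esub> (n::nat) = \<one>\<^bsub>heisenberg\<^esub>"
proof -
  interpret group "heisenberg :: ('p, 'n) heis monoid" by (rule group_heisenberg)
  let ?p = "CARD('p)"
  obtain a b c where x: "x = (a, b, c)" by (cases x)
  obtain z where "x [^]\<^bsub>heisenberg\<^esub> ?p = ((\<chi> i. of_nat ?p * a $ i), (\<chi> i. of_nat ?p * b $ i), z)"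
    using heis_pow[of a b c ?p] x by blast
  then have "x [^]\<^bsub>heisenberg\<^esub> ?p = (0, 0, z)" unfolding of_nat_card_fls by (simp add: vec_eq_iff)
  then have "(x [^]\<^bsub>heisenberg\<^esub> ?p) [^]\<^bsub>heisenberg\<^esub> ?p = \<one>\<^bsub>heisenberg\<^esub>"
    by (simp add: heis_pow_center of_nat_card_fls)
  then have "x [^]\<^bsub>heisenberg\<^esub> (?p * ?p) = \<one>\<^bsub>heisenberg\<^esub>" by (simp add: nat_pow_pow)
  then show ?thesis by (intro exI[of _ "?p * ?p"]) simp
qed

lemma td_group_heisenberg:
  fixes \<mu> :: "('p::prime_card, 'n::finite) heis measure"
  assumes "left_haar_measure heisenberg euclidean \<mu>"
  shows "td_group heisenberg heis_K \<mu>"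
proof -
  interpret group "heisenberg :: ('p, 'n) heis monoid" by (rule group_heisenberg)
  show ?thesis
  proof (unfold_locales)
    fix m :: nat and x y :: "('p, 'n) heis"
    show "\<one>\<^bsub>heisenberg\<^esub> \<in> heis_K m" by (simp add: heis_K_def fls_vec_ball_def)
    show "x \<otimes>\<^bsub>heisenberg\<^esub> y \<in> heis_K m" if "x \<in> heis_K m" "y \<in> heis_K m"
    proof -
      have "dot (fst x) (fst (snd y)) \<in> fls_ball (int m)"
        using that by (intro dot_fls_vec_ball) (auto simp: heis_K_def)
      then show ?thesis using that by (auto simp: heis_mult_eq heis_K_def fls_vec_ball_def intro!: fls_ball_add)
    qed
    show "inv\<^bsub>heisenberg\<^esub> x \<in> heis_K m" if "x \<in> heis_K m"
    proof -
      have "dot (fst x) (fst (snd x)) \<in> fls_ball (int m)"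
        using that by (intro dot_fls_vec_ball) (auto simp: heis_K_def)
      then show ?thesis using that
        by (auto simp: heis_inv_eq heis_K_def fls_vec_ball_def fls_ball_uminus intro!: fls_ball_diff)
    qed
    show "open (heis_K m :: ('p, 'n) heis set)"
      unfolding heis_K_def by (intro open_Times open_fls_vec_ball open_fls_ball)
    show "compact (heis_K m :: ('p, 'n) heis set)"
      unfolding heis_K_def by (intro compact_Times compact_fls_vec_ball compact_fls_ball)
    show "heis_K (Suc m) \<subseteq> (heis_K m :: ('p, 'n) heis set)"
      using fls_ball_mono[of "int m" "int (Suc m)"] by (auto simp: heis_K_def fls_vec_ball_def)
    show "\<exists>n>0. x [^]\<^bsub>heisenberg\<^esub> (n::nat) = \<one>\<^bsub>heisenberg\<^esub>" by (rule heis_torsion)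
  next
    fix U :: "('p, 'n) heis set" assume U: "open U" "\<one>\<^bsub>heisenberg\<^esub> \<in> U"
    then obtain A D where AD: "open A" "open D" "(0, 0, 0) \<in> A \<times> D" "A \<times> D \<subseteq> U"
      using open_prod_elim[of U "(0, 0, 0)"] by auto
    then obtain B C where BC: "open B" "open C" "(0, 0) \<in> B \<times> C" "B \<times> C \<subseteq> D"
      using open_prod_elim[of D "(0, 0)"] by auto
    obtain M1 where M1: "\<And>m. m \<ge> M1 \<Longrightarrow> fls_vec_ball m \<subseteq> A" using fls_vec_ball_basis[of A] AD by auto
    obtain M2 where M2: "\<And>m. m \<ge> M2 \<Longrightarrow> fls_vec_ball m \<subseteq> B" using fls_vec_ball_basis[of B] BC by auto
    obtain M3 where M3: "fls_ball M3 \<subseteq> C" using BC(2,3) unfolding open_fls_iff by force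
    define m where "m = nat (Max {M1, M2, M3})"
    have "M1 \<le> int m" "M2 \<le> int m" "M3 \<le> int m" by (auto simp: m_def)
    then have "heis_K m \<subseteq> A \<times> B \<times> C"
      using M1[of "int m"] M2[of "int m"] M3 fls_ball_mono[of M3 "int m"] unfolding heis_K_def by blast
    also have "\<dots> \<subseteq> U" using AD(4) BC(4) by blast
    finally show "\<exists>m. heis_K m \<subseteq> U" by blast
  qed (use assms in \<open>simp_all add: continuous_heis_mult continuous_heis_inv\<close>)
qed

section \<open>Vanishing of matrix entries and finite rank\<close>

lemma dot_axis: "dot a (axis i t) = a $ i * t" "dot (axis i t) a = t * a $ i"
  for a :: "'a::comm_ring_1 ^ 'n::finite"
  by (simp_all add: dot_def axis_def if_distrib if_distribR sum.delta cong: if_cong)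

text \<open>Subdegrees add under multiplication, so dividing \<open>c\<close> by an element of low
  subdegree gives a quotient of high subdegree.\<close>

lemma fls_quotient_in_ball:
  fixes c x :: "'a::field fls"
  assumes c: "c \<noteq> 0" and x: "x \<notin> fls_ball (fls_subdegree c - k)"
  obtains t where "t \<in> fls_ball k" "x * t = c"
proof -
  have x0: "x \<noteq> 0" using x by auto
  define t where "t = c / x"
  have xt: "x * t = c" using x0 by (simp add: t_def)
  then have "t \<noteq> 0" using c by auto
  have "fls_subdegree c = fls_subdegree x + fls_subdegree t"
    using fls_subdegree_mult[OF x0 \<open>t \<noteq> 0\<close>] xt by simp
  then have "t \<in> fls_ball k" using x x0 by (auto simp: fls_ball_iff_subdegree)
  with xt show ?thesis by (intro that)
qed

text \<open>
  If the centre acts nontrivially, \<open>P\<^sub>m u(g) P\<^sub>m\<close> vanishes unless \<open>g\<close> lies in a subgroup that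
  is compact modulo the centre: otherwise \<open>g\<close> commutes with a suitable element of \<open>K\<^sub>m\<close> up to a
  central element that acts by a scalar different from 1.
\<close>

lemma heis_finite_rank:
  fixes \<mu> :: "('p::prime_card, 'n::finite) heis measure" and \<pi> :: "_ \<Rightarrow> 'h::complex_hilbert \<Rightarrow> 'h"
  assumes irr: "td_irrep heisenberg heis_K \<mu> \<pi>"
  defines "P \<equiv> td_irrep.P heisenberg heis_K \<mu> \<pi>"
  shows "\<exists>S. finite S \<and> (\<forall>v. P m v \<in> complex_vector.span S)"
proof -
  interpret td_irrep "heisenberg :: ('p, 'n) heis monoid" heis_K \<mu> \<pi> by (rule irr)
  have P_def': "P = local.P" by (simp only: assms(2))
  have center: "u (0, 0, c) (u h v) = u h (u (0, 0, c) v)" for c h v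
    by (cases h) (simp add: u_mult add.commute)
  have "\<exists>\<psi>. \<forall>v. u (0, 0, c) v = scaleC \<psi> v" for c
    using u_scalar[OF center] by metis
  then obtain \<psi> where \<psi>: "\<And>c v. u (0, 0, c) v = scaleC (\<psi> c) v" by metis
  show ?thesis unfolding P_def'
  proof (cases "\<forall>c v. u (0, 0, c) v = v")
    case True
    show "\<exists>S. finite S \<and> (\<forall>v. local.P m v \<in> complex_vector.span S)"
    proof (rule finite_rankI[of "{\<one>\<^bsub>heisenberg\<^esub>}"])
      fix g :: "('p, 'n) heis" and v
      \<comment> \<open>Commutators are central and the centre acts trivially here, so all operators
        commute and \<open>u_scalar\<close> makes each of them a scalar.\<close>
      have comm: "u g (u h v) = u h (u g v)" for g h v
      proof -
        obtain a b c a' b' c' where gh: "g = (a, b, c)" "h = (a', b', c')" by (cases g, cases h)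
        have "g \<otimes>\<^bsub>heisenberg\<^esub> h = h \<otimes>\<^bsub>heisenberg\<^esub> g \<otimes>\<^bsub>heisenberg\<^esub> (0, 0, dot a b' - dot a' b)"
          by (simp add: gh algebra_simps)
        then show ?thesis by (metis True u_mult)
      qed
      obtain d where "\<And>v. u g v = scaleC d v" using u_scalar[OF comm] by metis
      then have "local.P m (u g (local.P m v)) = scaleC d (local.P m v)"
        by (simp add: clinear_map_scale[OF contraction_linear[OF P_contraction]] P_idem)
      then show "local.P m (u g (local.P m v))
          \<in> complex_vector.span ((\<lambda>x. local.P m (u x (local.P m v))) ` {\<one>\<^bsub>heisenberg\<^esub>})"
        by (simp add: u_one P_idem complex_vector.span_scale complex_vector.span_base del: heis_simps(2))
    qed simp
  next
    case False
    then obtain c0 v0 where c0: "u (0, 0, c0) v0 \<noteq> v0" by blast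
    then have "\<psi> c0 \<noteq> 1" using \<psi>[of c0 v0] by auto
    have "c0 \<noteq> 0" using c0 u_one by auto
    \<comment> \<open>The threshold of \<open>fls_quotient_in_ball\<close>: an entry outside
      \<open>fls_ball d\<close> divides \<open>c0\<close> with a quotient in
      \<open>fls_ball (int m)\<close>, which can serve as a coordinate of an element of
      \<open>heis_K m\<close>.\<close>
    define d where "d = fls_subdegree c0 - int m"
    \<comment> \<open>\<open>k\<close> is absorbed by \<open>P m\<close> on both sides, so
      exchanging it with \<open>g\<close> leaves the vector unchanged except for the factor
      \<open>\<psi> c0\<close>, which is not 1. The two alternatives are the two orders in which the
      central factor can appear.\<close>
    have zero: "local.P m (u g (local.P m v)) = 0"
      if eq: "u g (u k w) = u k (u g (u (0, 0, c0) w)) \<or> u k (u g w) = u g (u k (u (0, 0, c0) w))"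
        and k: "k \<in> heis_K m" and w: "w = local.P m v" for g k v w
    proof -
      let ?x = "local.P m (u g w)"
      have "?x = scaleC (\<psi> c0) ?x" using eq
      proof
        assume *: "u g (u k w) = u k (u g (u (0, 0, c0) w))"
        have "?x = local.P m (u g (u k w))" using u_P[OF k, of v] w by simp
        also have "\<dots> = local.P m (u k (u g (scaleC (\<psi> c0) w)))" by (simp only: * \<psi>)
        also have "\<dots> = scaleC (\<psi> c0) ?x"
          by (simp add: P_u[OF k] clinear_map_scale[OF u_linear]
              clinear_map_scale[OF contraction_linear[OF P_contraction]])
        finally show ?thesis .
      next
        assume *: "u k (u g w) = u g (u k (u (0, 0, c0) w))"
        have "?x = local.P m (u k (u g w))" by (simp add: P_u[OF k])
        also have "\<dots> = local.P m (u g (u k (scaleC (\<psi> c0) w)))" by (simp only: * \<psi>)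
        also have "\<dots> = scaleC (\<psi> c0) (local.P m (u g (u k w)))"
          by (simp add: clinear_map_scale[OF u_linear]
              clinear_map_scale[OF contraction_linear[OF P_contraction]])
        also have "u k w = w" using u_P[OF k, of v] w by simp
        finally show ?thesis .
      qed
      then have "scaleC (1 - \<psi> c0) ?x = 0" by (simp add: complex_vector.scale_left_diff_distrib)
      then show ?thesis using \<open>\<psi> c0 \<noteq> 1\<close> w by (simp add: complex_vector.scale_eq_0_iff)
    qed
    \<comment> \<open>Representatives modulo the centre, whose elements only contribute scalars;
      being compact, \<open>Q\<close> is covered by finitely many cosets of
      \<open>heis_K m\<close>.\<close>
    define Q :: "('p, 'n) heis set" where "Q = fls_vec_ball d \<times> fls_vec_ball d \<times> {0}"
    have "compact Q" unfolding Q_def by (intro compact_Times compact_fls_vec_ball) simp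
    then obtain X where X: "finite X" "Q \<subseteq> (\<Union>x\<in>X. coset x m)" using finite_disjoint_cosets by metis
    show "\<exists>S. finite S \<and> (\<forall>v. local.P m v \<in> complex_vector.span S)"
    proof (rule finite_rankI[OF X(1)])
      fix g :: "('p, 'n) heis" and v
      let ?w = "local.P m v"
      obtain a b c where g: "g = (a, b, c)" by (cases g)
      show "local.P m (u g ?w) \<in> complex_vector.span ((\<lambda>x. local.P m (u x ?w)) ` X)"
      proof (cases "a \<in> fls_vec_ball d \<and> b \<in> fls_vec_ball d")
        case True
        then have "(a, b, 0) \<in> Q" by (simp add: Q_def)
        then obtain x where x: "x \<in> X" "(a, b, 0) \<in> coset x m" using X(2) by blast
        then obtain k where k: "k \<in> heis_K m" "(a, b, 0) = x \<otimes>\<^bsub>heisenberg\<^esub> k" by (auto simp: coset_image)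
        have "u g ?w = u (a, b, 0) (u (0, 0, c) ?w)" by (simp add: u_mult g)
        also have "\<dots> = scaleC (\<psi> c) (u x (u k ?w))"
          by (simp only: \<psi> k(2) u_mult[symmetric] clinear_map_scale[OF u_linear])
        also have "u k ?w = ?w" by (rule u_P[OF k(1)])
        finally have "local.P m (u g ?w) = scaleC (\<psi> c) (local.P m (u x ?w))"
          by (simp add: clinear_map_scale[OF contraction_linear[OF P_contraction]])
        then show ?thesis using x(1) by (simp add: complex_vector.span_scale complex_vector.span_base)
      next
        case False
        have axis_K: "axis i t \<in> fls_vec_ball (int m)" if "t \<in> fls_ball (int m)" for i :: 'n and t :: "'p mod_ring fls"
          using that by (simp add: fls_vec_ball_def axis_def)
        have zero_K: "0 \<in> fls_vec_ball (int m)" by (simp add: fls_vec_ball_def)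
        have "local.P m (u g ?w) = 0"
        proof (cases "a \<in> fls_vec_ball d")
          case True
          with False obtain i where "b $ i \<notin> fls_ball d" by (auto simp: fls_vec_ball_def)
          then obtain t where t: "t \<in> fls_ball (int m)" "b $ i * t = c0"
            unfolding d_def by (rule fls_quotient_in_ball[OF \<open>c0 \<noteq> 0\<close>])
          \<comment> \<open>Commutators pair first coordinates with second ones, so a large entry of
            \<open>b\<close> is detected by an element of \<open>A\<close>, and a large entry of
            \<open>a\<close> below by an element of \<open>N\<close>.\<close>
          let ?k = "(axis i t, 0, 0) :: ('p, 'n) heis"
          have "?k \<in> heis_K m" using axis_K[OF t(1)] zero_K by (simp add: heis_K_def)
          moreover have "u ?k (u g ?w) = u g (u ?k (u (0, 0, c0) ?w))"
            using t(2) by (simp add: u_mult g dot_axis add_ac mult.commute)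
          ultimately show ?thesis by (intro zero) auto
        next
          case False
          then obtain i where "a $ i \<notin> fls_ball d" by (auto simp: fls_vec_ball_def)
          then obtain t where t: "t \<in> fls_ball (int m)" "a $ i * t = c0"
            unfolding d_def by (rule fls_quotient_in_ball[OF \<open>c0 \<noteq> 0\<close>])
          let ?k = "(0, axis i t, 0) :: ('p, 'n) heis"
          have "?k \<in> heis_K m" using axis_K[OF t(1)] zero_K by (simp add: heis_K_def)
          moreover have "u g (u ?k ?w) = u ?k (u g (u (0, 0, c0) ?w))"
            using t(2) by (simp add: u_mult g dot_axis add_ac)
          ultimately show ?thesis by (intro zero) auto
        qed
        then show ?thesis by (simp add: complex_vector.span_zero)
      qed
    qed
  qed
qed

lemma locally_compact_group_heisenberg:
  "locally_compact_group (heisenberg :: ('p::prime_card, 'n::finite) heis monoid) euclidean"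
proof -
  have "locally_compact_space (euclidean :: ('p, 'n) heis topology)"
    unfolding locally_compact_space_def
  proof
    fix x :: "('p, 'n) heis"
    show "\<exists>U K. openin euclidean U \<and> compactin euclidean K \<and> x \<in> U \<and> U \<subseteq> K"
      by (intro exI[of _ "ball x 1"] exI[of _ "cball x 1"]) auto
  qed
  then show ?thesis
    using continuous_heis_mult[where 'p = 'p and 'n = 'n] continuous_heis_inv[where 'p = 'p and 'n = 'n]
    unfolding locally_compact_group_def
    by (simp add: group_heisenberg flip: euclidean_product_topology)
qed

lemma CCR_heisenberg:
  "CCR_group TYPE('h::complex_hilbert) (heisenberg :: ('p::prime_card, 'n::finite) heis monoid) euclidean"
  unfolding CCR_group_def CCR_algebra_def
proof (intro conjI locally_compact_group_heisenberg allI impI ballI)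
  fix \<mu> :: "('p, 'n) heis measure"
    and \<pi> :: "(nat \<Rightarrow> ('p, 'n) heis \<Rightarrow> complex) set \<Rightarrow> 'h \<Rightarrow> 'h" and a
  assume haar: "left_haar_measure heisenberg euclidean \<mu>"
    and irr: "irreducible_star_rep (group_cstar heisenberg euclidean \<mu>) \<pi>"
    and a: "a \<in> carrier (group_cstar heisenberg euclidean \<mu>)"
  interpret td_irrep "heisenberg :: ('p, 'n) heis monoid" heis_K \<mu> \<pi>
    by (intro td_irrep.intro td_irrep_axioms.intro td_group_heisenberg haar irr)
  show "compact_operator (\<pi> a)"
    by (rule compact_operator_if_finite_rank[OF heis_finite_rank[OF td_irrep_axioms] a])
qed

theorem theorem5p15:
  shows "(\<forall>\<phi> \<in> topspace (subgroup_dual (heisenberg :: ('p::prime_card, 'n::finite) heis monoid) euclidean heis_N).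
            closedin (subgroup_dual (heisenberg :: ('p, 'n) heis monoid) euclidean heis_N)
              (dual_orbit heisenberg heis_N heis_A \<phi>))
       \<and> regularly_embedded (heisenberg :: ('p, 'n) heis monoid) euclidean heis_N
       \<and> CCR_group TYPE('h::complex_hilbert) (heisenberg :: ('p, 'n) heis monoid) euclidean"
  by (simp add: topspace_heis_dual closedin_heis_orbit regularly_embedded_heis_N CCR_heisenberg)

end
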